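(* The Destructive Shift Bribery problem for the Simplified Bucklin rule is in $\mathrm{P}$ (i.e., decidable in polynomial time).
   Context: **Elections.** An election is a pair $E=(C,V)$, where $C=\{c_1,\dots,c_m\}$ is a finite set of candidates and $V=\{v_1,\dots,v_n\}$ is a finite multiset of voters; each voter $v$ has a strict ranking (preference order) of all candidates from best to worst, and $\mathrm{pos}_v(c)\in\{1,\dots,m\}$ is the position of $c$ in $v$'s ranking (1 = best). An election rule $\mathcal{R}$ maps each election $E$ to a set $\mathcal{R}(E)\subseteq C$ of (tied) winners; $c$ is the unique winner if $\mathcal{R}(E)=\{c\}$. **Destructive Shift Bribery for $\mathcal{R}$.** Input: an election $E=(C,V)$ with $m$ candidates and $n$ voters, a despised candidate $d\in C$, a budget $B$ (a nonnegative integer), and for each voter $v_i$ a price function $\rho_i$. Shifting $d$ back by $t$ positions in a vote moves $d$ $t$ places towards the end of the ranking, each passed candidate moving up by one place and all else unchanged. A price function for a voter $v$ with $j=\mathrm{pos}_v(d)$ is $\rho:\mathbb{N}\to\mathbb{N}\cup\{+\infty\}$ with $\rho(0)=0$, $\rho(i)\le\rho(i')$ for $i<i'\le m-j$, and $\rho(i)=+\infty$ for $i>m-j$; $\rho(i)$ is the cost of shifting $d$ back by $i$ positions in $v$'s ranking. Price functions are encoded by listing their values at all arguments where they are finite; numbers are in binary. Question: are there nonnegative integers $t_1,\dots,t_n$ with $\sum_i\rho_i(t_i)\le B$ such that, after shifting $d$ back by $t_i$ positions in the ranking of each $v_i$, $d$ is not the unique $\mathcal{R}$-winner? **Simplified Bucklin.**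 The $\ell$-Approval score of a candidate is the number of voters that rank the candidate among the top $\ell$ positions. The Bucklin winning round is the smallest $\ell$ such that some candidate has $\ell$-Approval score at least $\lfloor |V|/2\rfloor+1$ (i.e., is ranked among the top $\ell$ positions by a strict majority of the voters). For $\ell$ the Bucklin winning round, all candidates whose $\ell$-Approval score is at least $\lfloor |V|/2\rfloor+1$ are the Simplified Bucklin winners. *)

theory Defs
  imports
    "HOL-Library.Multiset"
    "HOL-Library.Extended_Nat"
    "HOL-Computational_Algebra.Polynomial"
begin

section \<open>Polynomial time\<close>

text \<open>
  Deterministic multi-tape Turing machines. Control states are the numbers below \<open>states\<close>,
  tape symbols are the numbers below \<open>symbols\<close>, where 0 is the blank and 1 and 2 are the
  input symbols. Tapes are infinite in both directions; a tape is its contents together with the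
  head position. Since a configuration in a halting state is a fixed point of \<open>tm_step\<close>, being in
  a halting state after \<open>t\<close> iterations means having halted within \<open>t\<close> steps.
\<close>

datatype move = MoveLeft | Stay | MoveRight

record tm =
  states :: nat
  symbols :: nat
  tapes :: nat
  start_state :: nat
  accept_state :: nat
  reject_state :: nat
  delta :: "nat \<Rightarrow> nat list \<Rightarrow> nat \<times> (nat \<times> move) list"

definition wf_tm :: "tm \<Rightarrow> bool" where
  "wf_tm M \<longleftrightarrow>
     tapes M \<ge> 1 \<and> symbols M \<ge> 3 \<and>
     start_state M < states M \<and> accept_state M < states M \<and> reject_state M < states M \<and>
     accept_state M \<noteq> reject_state M \<and>
     (\<forall>q xs. q < states M \<and> length xs = tapes M \<and> (\<forall>a\<in>set xs. a < symbols M) \<longrightarrow>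
        fst (delta M q xs) < states M \<and>
        length (snd (delta M q xs)) = tapes M \<and>
        (\<forall>(a, mv)\<in>set (snd (delta M q xs)). a < symbols M))"

type_synonym tape = "(int \<Rightarrow> nat) \<times> int"
type_synonym tm_config = "nat \<times> tape list"

fun read_tape :: "tape \<Rightarrow> nat" where
  "read_tape (f, h) = f h"

fun move_head :: "move \<Rightarrow> int \<Rightarrow> int" where
  "move_head MoveLeft h = h - 1"
| "move_head Stay h = h"
| "move_head MoveRight h = h + 1"

fun act_tape :: "nat \<times> move \<Rightarrow> tape \<Rightarrow> tape" where
  "act_tape (a, mv) (f, h) = (f(h := a), move_head mv h)"

fun tm_step :: "tm \<Rightarrow> tm_config \<Rightarrow> tm_config" where
  "tm_step M (q, ts) =
     (if q = accept_state M \<or> q = reject_state M then (q, ts)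
      else (let (q', acts) = delta M q (map read_tape ts) in (q', map2 act_tape acts ts)))"

definition input_tape :: "bool list \<Rightarrow> tape" where
  "input_tape x =
     ((\<lambda>i. if 0 \<le> i \<and> i < int (length x) then (if x ! nat i then 2 else 1) else 0), 0)"

definition blank_tape :: tape where
  "blank_tape = ((\<lambda>_. 0), 0)"

definition tm_init :: "tm \<Rightarrow> bool list \<Rightarrow> tm_config" where
  "tm_init M x = (start_state M, input_tape x # replicate (tapes M - 1) blank_tape)"

definition decides_within :: "tm \<Rightarrow> bool list set \<Rightarrow> (nat \<Rightarrow> nat) \<Rightarrow> bool" where
  "decides_within M L T \<longleftrightarrow>
     (\<forall>x. fst ((tm_step M ^^ T (length x)) (tm_init M x)) =
            (if x \<in> L then accept_state M else reject_state M))"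

definition class_P :: "bool list set set" where
  "class_P = {L. \<exists>M (p :: nat poly). wf_tm M \<and> decides_within M L (\<lambda>n. poly p n)}"


section \<open>Elections\<close>

text \<open>A preference order is the list of the candidates from best to worst.\<close>

type_synonym 'c election = "'c set \<times> 'c list multiset"
type_synonym 'c election_rule = "'c election \<Rightarrow> 'c set"

definition ranking :: "'c set \<Rightarrow> 'c list \<Rightarrow> bool" where
  "ranking C v \<longleftrightarrow> distinct v \<and> set v = C"

definition pos :: "'c list \<Rightarrow> 'c \<Rightarrow> nat" where
  "pos v c = length (takeWhile (\<lambda>x. x \<noteq> c) v) + 1"

definition approval_score :: "nat \<Rightarrow> 'c list multiset \<Rightarrow> 'c \<Rightarrow> nat" where
  "approval_score l V c = size {#v \<in># V. pos v c \<le> l#}"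

definition majority :: "'c list multiset \<Rightarrow> nat" where
  "majority V = size V div 2 + 1"

definition bucklin_round :: "'c election \<Rightarrow> nat" where
  "bucklin_round = (\<lambda>(C, V). LEAST l. \<exists>c\<in>C. approval_score l V c \<ge> majority V)"

text \<open>
  Without voters no winning round exists; then all scores are 0 and the majority threshold is 1,
  so there is no winner, whatever value \<open>LEAST\<close> returns.
\<close>

definition simplified_bucklin :: "'c election_rule" where
  "simplified_bucklin =
     (\<lambda>(C, V). {c \<in> C. approval_score (bucklin_round (C, V)) V c \<ge> majority V})"


section \<open>Destructive shift bribery\<close>

text \<open>Only used for \<open>t \<le> length v - pos v d\<close>, since larger shifts cost \<open>\<infinity>\<close>.\<close>

definition shift_back :: "'c \<Rightarrow> nat \<Rightarrow> 'c list \<Rightarrow> 'c list" where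
  "shift_back d t v =
     (let w = remove1 d v; k = pos v d - 1 + t in take k w @ d # drop k w)"

definition price_function :: "nat \<Rightarrow> nat \<Rightarrow> (nat \<Rightarrow> enat) \<Rightarrow> bool" where
  "price_function m j \<rho> \<longleftrightarrow>
     \<rho> 0 = 0 \<and> (\<forall>i i'. i < i' \<and> i' \<le> m - j \<longrightarrow> \<rho> i \<le> \<rho> i') \<and> (\<forall>i > m - j. \<rho> i = \<infinity>)"

text \<open>The candidates of an instance are the numbers below \<open>num_cands\<close>.\<close>

record bribery_instance =
  num_cands :: nat
  despised :: nat
  budget :: nat
  voters :: "(nat list \<times> (nat \<Rightarrow> enat)) list"

definition valid_instance :: "bribery_instance \<Rightarrow> bool" where
  "valid_instance I \<longleftrightarrow>
     despised I < num_cands I \<and>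
     (\<forall>(v, \<rho>)\<in>set (voters I).
        ranking {..<num_cands I} v \<and> price_function (num_cands I) (pos v (despised I)) \<rho>)"

definition bribery_cost :: "bribery_instance \<Rightarrow> nat list \<Rightarrow> enat" where
  "bribery_cost I ts = (\<Sum>((v, \<rho>), t)\<leftarrow>zip (voters I) ts. \<rho> t)"

definition bribed_election :: "bribery_instance \<Rightarrow> nat list \<Rightarrow> nat election" where
  "bribed_election I ts =
     ({..<num_cands I},
      mset (map (\<lambda>((v, \<rho>), t). shift_back (despised I) t v) (zip (voters I) ts)))"

definition destructive_shift_bribery :: "nat election_rule \<Rightarrow> bribery_instance set" where
  "destructive_shift_bribery R =
     {I. valid_instance I \<and>
         (\<exists>ts. length ts = length (voters I) \<and> bribery_cost I ts \<le> enat (budget I) \<and>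
               R (bribed_election I ts) \<noteq> {despised I})}"


section \<open>Encoding of instances\<close>

text \<open>Binary representation, least significant bit first, without leading zeros.\<close>

fun bits :: "nat \<Rightarrow> bool list" where
  "bits n = (if n = 0 then [] else odd n # bits (n div 2))"

declare bits.simps [simp del]

text \<open>Every list element is preceded by the bit \<open>True\<close>; the bit \<open>False\<close> terminates the list.\<close>

definition encode_list :: "('a \<Rightarrow> bool list) \<Rightarrow> 'a list \<Rightarrow> bool list" where
  "encode_list f xs = concat (map (\<lambda>x. True # f x) xs) @ [False]"

definition encode_nat :: "nat \<Rightarrow> bool list" where
  "encode_nat n = encode_list (\<lambda>b. [b]) (bits n)"

definition finite_prices :: "(nat \<Rightarrow> enat) \<Rightarrow> nat list" where
  "finite_prices \<rho> = map (\<lambda>i. the_enat (\<rho> i)) (sorted_list_of_set {i. \<rho> i \<noteq> \<infinity>})"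

definition encode_voter :: "nat list \<times> (nat \<Rightarrow> enat) \<Rightarrow> bool list" where
  "encode_voter = (\<lambda>(v, \<rho>). encode_list encode_nat v @ encode_list encode_nat (finite_prices \<rho>))"

definition encode_instance :: "bribery_instance \<Rightarrow> bool list" where
  "encode_instance I =
     encode_nat (num_cands I) @ encode_nat (despised I) @ encode_nat (budget I) @
     encode_list encode_voter (voters I)"

text \<open>
  The encoding is injective on valid instances: it is prefix-free, and the finite prices of a
  price function determine it because its finite arguments form an initial segment.
\<close>

lemma encode_list_inject:
  assumes "\<And>x y r s. x \<in> A \<Longrightarrow> y \<in> A \<Longrightarrow> f x @ r = f y @ s \<Longrightarrow> x = y \<and> r = s"
    and "set xs \<subseteq> A" and "set ys \<subseteq> A" and "encode_list f xs @ r = encode_list f ys @ s"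
  shows "xs = ys \<and> r = s"
  using assms(2-)
proof (induction xs arbitrary: ys)
  case Nil
  then show ?case by (cases ys) (auto simp: encode_list_def)
next
  case (Cons x xs)
  then obtain y ys' where ys: "ys = y # ys'"
    by (cases ys) (auto simp: encode_list_def)
  have "f x @ (encode_list f xs @ r) = f y @ (encode_list f ys' @ s)"
    using Cons.prems ys by (simp add: encode_list_def)
  then have "x = y" "encode_list f xs @ r = encode_list f ys' @ s"
    using assms(1)[of x y] Cons.prems ys by auto
  then show ?case
    using Cons.IH[of ys'] Cons.prems ys by auto
qed

lemma bits_rec: "n \<noteq> 0 \<Longrightarrow> bits n = odd n # bits (n div 2)"
  by (subst bits.simps) simp

lemma bits_eq_Nil_iff: "bits n = [] \<longleftrightarrow> n = 0"
  by (subst bits.simps) simp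

lemma bits_inject: "bits m = bits n \<Longrightarrow> m = n"
proof (induction m arbitrary: n rule: less_induct)
  case (less m)
  show ?case
  proof (cases "m = 0 \<or> n = 0")
    case True
    then show ?thesis
      using less.prems bits_eq_Nil_iff by metis
  next
    case False
    then have "odd m # bits (m div 2) = odd n # bits (n div 2)"
      using less.prems by (metis bits_rec)
    then have "odd m = odd n" "bits (m div 2) = bits (n div 2)"
      by (simp_all only: list.inject)
    moreover from this have "m div 2 = n div 2"
      using less.IH[of "m div 2"] False by simp
    ultimately show ?thesis
      by (metis even_two_times_div_two odd_two_times_div_two_succ)
  qed
qed

lemma encode_nat_inject:
  assumes "encode_nat m @ r = encode_nat n @ s"
  shows "m = n \<and> r = s"
proof -
  have "bits m = bits n \<and> r = s"
    by (rule encode_list_inject[where f = "\<lambda>b. [b]" and A = UNIV])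
      (use assms in \<open>simp_all add: encode_nat_def\<close>)
  then show ?thesis
    by (blast dest: bits_inject)
qed

lemma encode_nat_list_inject:
  assumes "encode_list encode_nat xs @ r = encode_list encode_nat ys @ s"
  shows "xs = ys \<and> r = s"
  by (rule encode_list_inject[where f = encode_nat and A = UNIV])
    (use assms encode_nat_inject in blast)+

lemma price_function_finite_args:
  assumes "price_function m j \<rho>"
  shows "{i. \<rho> i \<noteq> \<infinity>} = {..<length (finite_prices \<rho>)}"
proof -
  let ?S = "{i. \<rho> i \<noteq> \<infinity>}"
  have "?S \<subseteq> {..m - j}"
  proof
    fix i assume "i \<in> ?S"
    moreover have "i > m - j \<longrightarrow> \<rho> i = \<infinity>"
      using assms unfolding price_function_def by blast
    ultimately show "i \<in> {..m - j}"
      by (cases "i \<le> m - j") simp_all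
  qed
  then have fin: "finite ?S"
    by (rule finite_subset) simp
  have down: "i \<in> ?S" if "i' \<in> ?S" "i < i'" for i i'
  proof -
    have "i' \<le> m - j"
      using that \<open>?S \<subseteq> {..m - j}\<close> by blast
    then have "\<rho> i \<le> \<rho> i'"
      using assms that(2) unfolding price_function_def by blast
    then show ?thesis
      using that by (cases "\<rho> i") auto
  qed
  define k where "k = (LEAST i. i \<notin> ?S)"
  have "\<exists>i. i \<notin> ?S"
    using ex_new_if_finite[OF infinite_UNIV_nat fin] .
  then have k: "k \<notin> ?S"
    unfolding k_def by (rule LeastI_ex)
  have "?S = {..<k}"
  proof (rule set_eqI)
    fix i
    show "i \<in> ?S \<longleftrightarrow> i \<in> {..<k}"
    proof (cases i k rule: linorder_cases)
      case less
      then show ?thesis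
        using not_less_Least[of i "\<lambda>i. i \<notin> ?S"] by (simp add: k_def)
    next
      case equal
      then show ?thesis using k by simp
    next
      case greater
      then have "i \<notin> ?S"
        using down k by blast
      then show ?thesis using greater by simp
    qed
  qed
  moreover have "length (finite_prices \<rho>) = card ?S"
    by (simp add: finite_prices_def)
  ultimately show ?thesis by (metis card_lessThan)
qed

lemma finite_prices_inject:
  assumes "price_function m j \<rho>" "price_function m' j' \<rho>'" "finite_prices \<rho> = finite_prices \<rho>'"
  shows "\<rho> = \<rho>'"
proof
  fix i
  define k where "k = length (finite_prices \<rho>)"
  have S: "{i. \<rho> i \<noteq> \<infinity>} = {..<k}" "{i. \<rho>' i \<noteq> \<infinity>} = {..<k}"
    using price_function_finite_args[OF assms(1)] price_function_finite_args[OF assms(2)] assms(3)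
    by (simp_all add: k_def)
  have "map (\<lambda>i. the_enat (\<rho> i)) [0..<k] = map (\<lambda>i. the_enat (\<rho>' i)) [0..<k]"
    using assms(3) unfolding finite_prices_def S
    by (simp add: lessThan_atLeast0)
  then have eq: "the_enat (\<rho> i) = the_enat (\<rho>' i)" if "i < k"
    using that by simp
  show "\<rho> i = \<rho>' i"
  proof (cases "i < k")
    case True
    then have "i \<in> {i. \<rho> i \<noteq> \<infinity>}" "i \<in> {i. \<rho>' i \<noteq> \<infinity>}"
      unfolding S by simp_all
    then show ?thesis
      using eq[OF True] by auto
  next
    case False
    then have "i \<notin> {i. \<rho> i \<noteq> \<infinity>}" "i \<notin> {i. \<rho>' i \<noteq> \<infinity>}"
      unfolding S by simp_all
    then show ?thesis by simp
  qed
qed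

lemma inj_on_encode_instance: "inj_on encode_instance {I. valid_instance I}"
proof (rule inj_onI)
  fix I J
  assume "I \<in> {I. valid_instance I}" "J \<in> {I. valid_instance I}"
    and eq: "encode_instance I = encode_instance J"
  then have val: "valid_instance I" "valid_instance J" by auto
  let ?A = "{(v, \<rho>). \<exists>m j. price_function m j \<rho>} :: (nat list \<times> (nat \<Rightarrow> enat)) set"
  have sub: "set (voters I) \<subseteq> ?A" "set (voters J) \<subseteq> ?A"
    using val by (fastforce simp: valid_instance_def)+
  have voter: "x = y \<and> r = s"
    if "x \<in> ?A" "y \<in> ?A" "encode_voter x @ r = encode_voter y @ s" for x y r s
  proof -
    obtain v \<rho> w \<sigma> where xy: "x = (v, \<rho>)" "y = (w, \<sigma>)"
      by (cases x, cases y)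
    have "v = w \<and> encode_list encode_nat (finite_prices \<rho>) @ r =
        encode_list encode_nat (finite_prices \<sigma>) @ s"
      by (rule encode_nat_list_inject) (use that(3) xy in \<open>simp add: encode_voter_def\<close>)
    moreover from this have "finite_prices \<rho> = finite_prices \<sigma> \<and> r = s"
      using encode_nat_list_inject by blast
    moreover from this have "\<rho> = \<sigma>"
      using that(1,2) xy finite_prices_inject by blast
    ultimately show ?thesis
      using xy by simp
  qed
  have "num_cands I = num_cands J" "despised I = despised J" "budget I = budget J"
    and "encode_list encode_voter (voters I) = encode_list encode_voter (voters J)"
    using eq by (auto simp: encode_instance_def dest!: encode_nat_inject)
  moreover from this have "voters I = voters J"
    using encode_list_inject[OF voter sub, where r = "[]" and s = "[]"] by simp
  ultimately show "I = J" by simp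
qed

end

theory Submission
  imports Defs
begin

text \<open>
  Programs over finitely many stacks of bits are compiled to Turing machines with one tape per
  stack. The functions that such programs compute in polynomial time, between types whose elements
  are written as prefix codes of binary trees, are closed under composition, pairing, case
  distinction, and folds over lists whose intermediate results stay polynomially small. This makes
  it possible to describe the decision procedure as an ordinary recursive function.

  After a bribery, \<open>d\<close> is not the unique winner iff for some candidate \<open>c \<noteq> d\<close> and some round \<open>l\<close>,
  a majority ranks \<open>c\<close> among the top \<open>l\<close> positions but no majority ranks \<open>d\<close> among the top
  \<open>l - 1\<close>. For fixed \<open>c\<close> and \<open>l\<close> only a few shifts per voter matter: the cheapest one that
  achieves the first goal, the second goal, or both. A cheapest combination is found by dynamic
  programming over the voters, in a table indexed by the numbers of voters still required to
  achieve either goal. All prices above the budget are treated alike, which keeps the entries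
  small.
\<close>

subsection \<open>Stack programs\<close>

text \<open>Prices are binary, so a table indexed by money would be exponentially large. Counting
  voters works instead, because only two yes-or-no facts about each vote matter (\<open>c\<close> is
  in, \<open>d\<close> is out); the prices become table entries. Polynomial-time functions are not
  closed under iteration: a step that doubles its argument has exponential output after linearly
  many rounds. So every fold comes with its own size bound, and this bound has to hold for all
  inputs, malformed ones included. That requirement shapes the definitions: table entries are
  capped, iteration runs over lists that are present in the data and never up to a binary number,
  and a parser never returns a rest longer than its input. Trees with a prefix code serve as
  universal data because pairing and projection then merely move blocks of bits, and because a
  function between two types is judged by its action on codes alone: one program serves all types
  with the same codes.\<close>

datatype com =
    Skip
  | Push nat bool
  | Pop nat
  | Seq com com (infixr ";;" 60)
  | Branch nat "bool option" com com
  | Loop nat com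

type_synonym store = "nat \<Rightarrow> bool list"

definition peek :: "bool list \<Rightarrow> bool option" where
  "peek l = (case l of [] \<Rightarrow> None | b # _ \<Rightarrow> Some b)"

lemma peek_simps [simp]: "peek [] = None" "peek (b # l) = Some b"
  by (simp_all add: peek_def)

text \<open>The times are the exact step counts of the compiled code. \<open>Push\<close> costs two
  because the head first moves left; a taken branch needs the test and a jump over the other
  alternative; each round of a loop needs the test and a jump back.\<close>

inductive exec :: "com \<Rightarrow> store \<Rightarrow> nat \<Rightarrow> store \<Rightarrow> bool" where
  Skip: "exec Skip s 0 s"
| Push: "exec (Push i b) s 2 (s(i := b # s i))"
| Pop: "exec (Pop i) s 1 (s(i := tl (s i)))"
| Seq: "exec c s t s' \<Longrightarrow> exec d s' u s'' \<Longrightarrow> exec (c ;; d) s (t + u) s''"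
| BranchTrue: "peek (s i) = v \<Longrightarrow> exec c s t s' \<Longrightarrow> exec (Branch i v c d) s (t + 2) s'"
| BranchFalse: "peek (s i) \<noteq> v \<Longrightarrow> exec d s t s' \<Longrightarrow> exec (Branch i v c d) s (t + 1) s'"
| LoopEnd: "s i = [] \<Longrightarrow> exec (Loop i c) s 1 s"
| LoopStep: "s i \<noteq> [] \<Longrightarrow> exec c s t s' \<Longrightarrow> exec (Loop i c) s' u s'' \<Longrightarrow>
    exec (Loop i c) s (t + u + 2) s''"

primrec below :: "nat \<Rightarrow> com \<Rightarrow> bool" where
  "below k Skip = True"
| "below k (Push i b) = (i < k)"
| "below k (Pop i) = (i < k)"
| "below k (c ;; d) = (below k c \<and> below k d)"
| "below k (Branch i v c d) = (i < k \<and> below k c \<and> below k d)"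
| "below k (Loop i c) = (i < k \<and> below k c)"

lemma below_mono: "below k c \<Longrightarrow> k \<le> k' \<Longrightarrow> below k' c"
  by (induction c) auto

text \<open>Fixes the number of tapes. It has to be positive because unconditional jumps are
  compiled to instructions that look at tape 0 and ignore what they see.\<close>

lemma ex_below: "\<exists>k>0. below k c"
proof (induction c)
  case Skip
  show ?case by (rule exI[of _ 1]) simp
next
  case (Push i b)
  show ?case by (rule exI[of _ "Suc i"]) simp
next
  case (Pop i)
  show ?case by (rule exI[of _ "Suc i"]) simp
next
  case (Seq c d)
  then obtain k l where "k > 0" "below k c" "below l d" by blast
  then show ?case by (intro exI[of _ "max k l"]) (auto intro: below_mono)
next
  case (Branch i v c d)
  then obtain k l where "below k c" "below l d" by blast
  then show ?case by (intro exI[of _ "max (Suc i) (max k l)"]) (auto intro: below_mono)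
next
  case (Loop i c)
  then obtain k where "below k c" by blast
  then show ?case by (intro exI[of _ "max (Suc i) k"]) (auto intro: below_mono)
qed


subsection \<open>Compilation to Turing machines\<close>

text \<open>An instruction reads one tape and, depending on the symbol seen, returns the symbol to
  write, the head move and the next state.\<close>

type_synonym instr = "nat \<times> (nat \<Rightarrow> nat \<times> move \<times> nat)"

definition sym :: "bool \<Rightarrow> nat" where
  "sym b = (if b then 2 else 1)"

definition peek_sym :: "bool option \<Rightarrow> nat" where
  "peek_sym v = (case v of None \<Rightarrow> 0 | Some b \<Rightarrow> sym b)"

lemma peek_sym_inject: "peek_sym v = peek_sym w \<longleftrightarrow> v = w"
  by (auto simp: peek_sym_def sym_def split: option.splits)

primrec len :: "com \<Rightarrow> nat" where
  "len Skip = 0"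
| "len (Push i b) = 2"
| "len (Pop i) = 1"
| "len (c ;; d) = len c + len d"
| "len (Branch i v c d) = len c + len d + 2"
| "len (Loop i c) = len c + 2"

text \<open>The first argument is the state in which the code is entered; it is left in the state
  \<open>p + len c\<close>.\<close>

primrec compile :: "nat \<Rightarrow> com \<Rightarrow> instr list" where
  "compile p Skip = []"
| "compile p (Push i b) = [(i, \<lambda>a. (a, MoveLeft, p + 1)), (i, \<lambda>a. (sym b, Stay, p + 2))]"
| "compile p (Pop i) = [(i, \<lambda>a. (0, MoveRight, p + 1))]"
| "compile p (c ;; d) = compile p c @ compile (p + len c) d"
| "compile p (Branch i v c d) =
     (i, \<lambda>a. (a, Stay, if a = peek_sym v then p + 1 else p + len c + 2)) # compile (p + 1) c @
     (0, \<lambda>a. (a, Stay, p + len c + len d + 2)) # compile (p + len c + 2) d"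
| "compile p (Loop i c) =
     (i, \<lambda>a. (a, Stay, if a = 0 then p + len c + 2 else p + 1)) # compile (p + 1) c @
     [(0, \<lambda>a. (a, Stay, p))]"

lemma length_compile [simp]: "length (compile p c) = len c"
  by (induction c arbitrary: p) auto

text \<open>The control state is a program counter. The two values just past the end of the program
  are the halting states, so a program answers by jumping to one of them.\<close>

definition machine :: "nat \<Rightarrow> instr list \<Rightarrow> tm" where
  "machine k prog = \<lparr>states = length prog + 2, symbols = 3, tapes = k, start_state = 0,
     accept_state = length prog, reject_state = length prog + 1,
     delta = \<lambda>q xs. if q < length prog
       then (let (i, g) = prog ! q; (a, mv, q') = g (xs ! i)
             in (q', (map (\<lambda>x. (x, Stay)) xs)[i := (a, mv)]))
       else (q, map (\<lambda>x. (x, Stay)) xs)\<rparr>"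

text \<open>The top of the stack lies under the head and the stack grows to the left. All other
  cells are blank, so reading 0 means that the stack is empty, and the initial tapes already have
  this form.\<close>

fun represents :: "tape \<Rightarrow> bool list \<Rightarrow> bool" where
  "represents (f, h) l \<longleftrightarrow>
     (\<forall>j. f j = (if h \<le> j \<and> j < h + int (length l) then sym (l ! nat (j - h)) else 0))"

definition represents_store :: "nat \<Rightarrow> tape list \<Rightarrow> store \<Rightarrow> bool" where
  "represents_store k ts s \<longleftrightarrow> length ts = k \<and> (\<forall>i<k. represents (ts ! i) (s i))"

lemma read_tape_represents: "represents t l \<Longrightarrow> read_tape t = peek_sym (peek l)"
  by (cases t; cases l) (auto simp: peek_sym_def)

lemma represents_pop:
  assumes "represents t l"
  shows "represents (act_tape (0, MoveRight) t) (tl l)"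
proof -
  obtain f h where t: "t = (f, h)" by (cases t)
  show ?thesis
  proof (cases l)
    case Nil
    then show ?thesis using assms t by auto
  next
    case (Cons b l')
    have "nat (j - h) = Suc (nat (j - (h + 1)))" if "h < j" for j
      using that by linarith
    then show ?thesis using assms t Cons by auto
  qed
qed

lemma represents_push:
  assumes "represents t l"
  shows "represents (act_tape (sym b, Stay) (act_tape (read_tape t, MoveLeft) t)) (b # l)"
proof -
  obtain f h where t: "t = (f, h)" by (cases t)
  have "nat (j - (h - 1)) = Suc (nat (j - h))" if "h \<le> j" for j
    using that by linarith
  then show ?thesis using assms t by auto
qed

lemma act_tape_id: "act_tape (read_tape t, Stay) t = t"
  by (cases t) auto

lemma machine_step:
  assumes "q < length prog" "prog ! q = (i, g)" "i < k" "length ts = k"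
    "g (read_tape (ts ! i)) = (a, mv, q')"
  shows "tm_step (machine k prog) (q, ts) = (q', ts[i := act_tape (a, mv) (ts ! i)])"
proof -
  have "map2 act_tape ((map (\<lambda>x. (x, Stay)) (map read_tape ts))[i := (a, mv)]) ts =
      ts[i := act_tape (a, mv) (ts ! i)]"
    using assms(3,4) by (intro nth_equalityI) (auto simp: nth_list_update act_tape_id)
  then show ?thesis
    using assms by (simp add: machine_def Let_def)
qed

declare tm_step.simps [simp del]

lemma machine_stay:
  assumes "q < length prog" "prog ! q = (i, g)" "i < k" "length ts = k"
    "g (read_tape (ts ! i)) = (read_tape (ts ! i), Stay, q')"
  shows "tm_step (machine k prog) (q, ts) = (q', ts)"
  using machine_step[OF assms] by (simp add: act_tape_id)

lemma represents_store_update: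
  assumes "represents_store k ts s" "represents t l"
  shows "represents_store k (ts[i := t]) (s(i := l))"
  using assms by (auto simp: represents_store_def nth_list_update)

lemma funpow_trans: "(f ^^ m) x = y \<Longrightarrow> (f ^^ n) y = z \<Longrightarrow> (f ^^ (m + n)) x = z"
  by (simp add: add.commute[of m] funpow_add)

lemma funpow_step: "f x = y \<Longrightarrow> (f ^^ n) y = z \<Longrightarrow> (f ^^ (n + 1)) x = z"
  by (simp add: funpow_swap1)

text \<open>Jump targets are absolute, and the induction hypotheses speak about fragments of the
  program; hence the code sits at address \<open>p\<close> between arbitrary \<open>pre\<close> and
  \<open>post\<close>. After the jump back, a loop is again in the situation of its own statement
  with the same \<open>pre\<close> and \<open>post\<close>.\<close>

lemma compile_correct:
  assumes "exec c s t s'" "below k c" "k > 0" "prog = pre @ compile p c @ post" "length pre = p"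
    "represents_store k ts s"
  shows "\<exists>ts'. (tm_step (machine k prog) ^^ t) (p, ts) = (p + len c, ts') \<and>
    represents_store k ts' s'"
  using assms
proof (induction arbitrary: pre p post ts rule: exec.induct)
  case (Skip s)
  then show ?case by auto
next
  case (Push i b s)
  then have i: "i < k" "length ts = k" "represents (ts ! i) (s i)"
    by (auto simp: represents_store_def)
  let ?t1 = "act_tape (read_tape (ts ! i), MoveLeft) (ts ! i)"
  have 1: "tm_step (machine k prog) (p, ts) = (p + 1, ts[i := ?t1])"
    using Push i by (intro machine_step) (auto simp: nth_append)
  have 2: "tm_step (machine k prog) (p + 1, ts[i := ?t1]) =
      (p + 2, ts[i := ?t1, i := act_tape (sym b, Stay) (ts[i := ?t1] ! i)])"
    using Push i by (intro machine_step) (auto simp: nth_append)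
  have "(tm_step (machine k prog) ^^ 2) (p, ts) =
      (p + 2, ts[i := act_tape (sym b, Stay) ?t1])"
    using 1 2 i by (simp add: numeral_2_eq_2)
  then show ?case
    using represents_store_update[OF Push(5) represents_push[OF i(3), of b], of i]
    by (intro exI conjI) (simp_all del: fun_upd_apply)
next
  case (Pop i s)
  then have i: "i < k" "length ts = k" "represents (ts ! i) (s i)"
    by (auto simp: represents_store_def)
  have 1: "tm_step (machine k prog) (p, ts) = (p + 1, ts[i := act_tape (0, MoveRight) (ts ! i)])"
    using Pop i by (intro machine_step) (auto simp: nth_append)
  show ?case
    using represents_store_update[OF Pop(5) represents_pop[OF i(3)], of i] 1
    by (intro exI conjI) (simp_all del: fun_upd_apply)
next
  case (Seq c s t s' d u s'')
  obtain ts1 where 1: "(tm_step (machine k prog) ^^ t) (p, ts) = (p + len c, ts1)"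
      "represents_store k ts1 s'"
    using Seq.IH(1)[of pre p "compile (p + len c) d @ post" ts] Seq.prems by auto
  obtain ts2 where 2: "(tm_step (machine k prog) ^^ u) (p + len c, ts1) = (p + len c + len d, ts2)"
      "represents_store k ts2 s''"
    using Seq.IH(2)[of "pre @ compile p c" "p + len c" post ts1] Seq.prems 1 by auto
  show ?case
    using 1 2 by (intro exI[of _ ts2]) (simp add: add.commute[of t] funpow_add add.assoc)
next
  case (BranchTrue s i v c t s' d)
  let ?M = "machine k prog"
  have i: "i < k" "length ts = k" "read_tape (ts ! i) = peek_sym v" "0 < k"
    using BranchTrue by (auto simp: represents_store_def read_tape_represents)
  have 0: "tm_step ?M (p, ts) = (p + 1, ts)"
    using BranchTrue.prems i by (intro machine_stay[where g =
        "\<lambda>a. (a, Stay, if a = peek_sym v then p + 1 else p + len c + 2)"])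
      (simp_all add: nth_append)
  obtain ts1 where 1: "(tm_step ?M ^^ t) (p + 1, ts) = (p + 1 + len c, ts1)"
      "represents_store k ts1 s'"
    using BranchTrue.IH[of "pre @ [compile p (Branch i v c d) ! 0]" "p + 1"
        "(0, \<lambda>a. (a, Stay, p + len c + len d + 2)) # compile (p + len c + 2) d @ post" ts]
      BranchTrue.prems by auto
  have 2: "tm_step ?M (p + 1 + len c, ts1) = (p + len c + len d + 2, ts1)"
    using BranchTrue.prems i 1(2)
    by (intro machine_stay[where i = 0]) (auto simp: nth_append represents_store_def)
  have "(tm_step ?M ^^ (t + 1 + 1)) (p, ts) = (p + len c + len d + 2, ts1)"
    by (rule funpow_step[OF 0 funpow_trans[OF 1(1)]]) (use 2 in simp)
  then show ?case
    using 1 by (intro exI[of _ ts1]) (simp add: add_ac)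
next
  case (BranchFalse s i v d t s' c)
  let ?M = "machine k prog"
  have i: "i < k" "length ts = k" "read_tape (ts ! i) \<noteq> peek_sym v" "0 < k"
    using BranchFalse by (auto simp: represents_store_def read_tape_represents peek_sym_inject)
  have 0: "tm_step ?M (p, ts) = (p + len c + 2, ts)"
    using BranchFalse.prems i by (intro machine_stay[where g =
        "\<lambda>a. (a, Stay, if a = peek_sym v then p + 1 else p + len c + 2)"])
      (simp_all add: nth_append)
  obtain ts1 where 1: "(tm_step ?M ^^ t) (p + len c + 2, ts) = (p + len c + 2 + len d, ts1)"
      "represents_store k ts1 s'"
    using BranchFalse.IH[of "pre @ take (len c + 2) (compile p (Branch i v c d))" "p + len c + 2"
        post ts] BranchFalse.prems by auto
  have "(tm_step ?M ^^ (t + 1)) (p, ts) = (p + len c + 2 + len d, ts1)"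
    by (rule funpow_step[OF 0 1(1)])
  then show ?case
    using 1 by (intro exI[of _ ts1]) (simp add: add_ac)
next
  case (LoopEnd s i c)
  let ?M = "machine k prog"
  have i: "i < k" "length ts = k" "read_tape (ts ! i) = 0"
    using LoopEnd by (auto simp: represents_store_def read_tape_represents peek_sym_def)
  have "tm_step ?M (p, ts) = (p + len c + 2, ts)"
    using LoopEnd.prems i by (intro machine_stay[where g =
        "\<lambda>a. (a, Stay, if a = 0 then p + len c + 2 else p + 1)"])
      (simp_all add: nth_append)
  then show ?case using LoopEnd by auto
next
  case (LoopStep s i c t s' u s'')
  let ?M = "machine k prog"
  have i: "i < k" "length ts = k" "read_tape (ts ! i) \<noteq> 0" "0 < k"
    using LoopStep
    by (auto simp: represents_store_def read_tape_represents peek_sym_def sym_def neq_Nil_conv)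
  have 0: "tm_step ?M (p, ts) = (p + 1, ts)"
    using LoopStep.prems i by (intro machine_stay[where g =
        "\<lambda>a. (a, Stay, if a = 0 then p + len c + 2 else p + 1)"])
      (simp_all add: nth_append)
  obtain ts1 where 1: "(tm_step ?M ^^ t) (p + 1, ts) = (p + 1 + len c, ts1)"
      "represents_store k ts1 s'"
    using LoopStep.IH(1)[of "pre @ [compile p (Loop i c) ! 0]" "p + 1"
        "(0, \<lambda>a. (a, Stay, p)) # post" ts]
      LoopStep.prems by auto
  have 2: "tm_step ?M (p + 1 + len c, ts1) = (p, ts1)"
    using LoopStep.prems i 1(2)
    by (intro machine_stay[where i = 0]) (auto simp: nth_append represents_store_def)
  obtain ts2 where 3: "(tm_step ?M ^^ u) (p, ts1) = (p + len (Loop i c), ts2)"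
      "represents_store k ts2 s''"
    using LoopStep.IH(2)[OF LoopStep.prems(1-4) 1(2)] by auto
  have "(tm_step ?M ^^ (t + (u + 1) + 1)) (p, ts) = (p + len (Loop i c), ts2)"
    by (rule funpow_step[OF 0 funpow_trans[OF 1(1) funpow_step[OF 2 3(1)]]])
  then show ?case
    using 3 by (intro exI[of _ ts2]) (simp add: add_ac)
qed

lemma compile_symbols:
  assumes "(i, g) \<in> set (compile p c)" "a < 3" "g a = (b, mv, q)"
  shows "b < 3 \<and> q \<le> p + len c"
  using assms by (induction c arbitrary: p) (fastforce simp: sym_def split: if_splits)+

lemma exec_class_P:
  fixes P :: "nat poly"
  assumes "\<And>x. \<exists>t s'. exec c ((\<lambda>_. [])(0 := x)) t s' \<and> t \<le> poly P (length x) \<and>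
    (peek (s' 0) = Some True \<longleftrightarrow> x \<in> L)"
  shows "L \<in> class_P"
proof -
  obtain k where k: "k > 0" "below k c"
    using ex_below by blast
  \<comment> \<open>One more instruction turns the top of stack 0 into the verdict: symbol 2, which
    stands for \<open>True\<close>, leads to \<open>len c + 1\<close>, the accepting state,
    everything else to the rejecting one.\<close>
  define prog where "prog = compile 0 c @ [(0, \<lambda>a. (a, Stay, if a = 2 then len c + 1 else len c + 2))]"
  let ?M = "machine k prog"
  have len: "length prog = len c + 1"
    by (simp add: prog_def)
  have "wf_tm ?M"
  proof -
    have "fst (delta ?M q xs) < states ?M \<and> length (snd (delta ?M q xs)) = tapes ?M \<and>
        (\<forall>(a, mv)\<in>set (snd (delta ?M q xs)). a < symbols ?M)"
      if q: "q < states ?M" and xs: "length xs = tapes ?M" "\<forall>a\<in>set xs. a < symbols ?M" for q xs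
    proof (cases "q < length prog")
      case False
      then show ?thesis using q xs by (auto simp: machine_def)
    next
      case True
      obtain i g where ig: "prog ! q = (i, g)" by (cases "prog ! q")
      obtain a mv q' where g: "g (xs ! i) = (a, mv, q')" by (cases "g (xs ! i)") auto
      have in_prog: "(i, g) \<in> set prog"
        using ig True nth_mem by metis
      have "i < k"
      proof -
        have "below k c \<Longrightarrow> 0 < k \<Longrightarrow> (i, g) \<in> set (compile p c) \<Longrightarrow> i < k" for p
          by (induction c arbitrary: p) auto
        then show ?thesis using in_prog k by (auto simp: prog_def)
      qed
      then have "xs ! i < 3"
        using xs by (auto simp: machine_def)
      then have "a < 3 \<and> q' < length prog + 2"
        using in_prog g compile_symbols[of i g 0 c "xs ! i"] len by (fastforce simp: prog_def split: if_splits)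
      then show ?thesis
        using True ig g xs
        by (auto simp: machine_def dest!: subsetD[OF set_update_subset_insert])
    qed
    moreover have "tapes ?M \<ge> 1" "symbols ?M \<ge> 3" "start_state ?M < states ?M"
        "accept_state ?M < states ?M" "reject_state ?M < states ?M" "accept_state ?M \<noteq> reject_state ?M"
      using k by (simp_all add: machine_def)
    ultimately show ?thesis
      unfolding wf_tm_def by blast
  qed
  \<comment> \<open>The additional 1 pays for the final instruction.\<close>
  moreover have "decides_within ?M L (\<lambda>n. poly (P + 1) n)"
    unfolding decides_within_def
  proof
    fix x
    obtain t s' where t: "exec c ((\<lambda>_. [])(0 := x)) t s'" "t \<le> poly P (length x)"
        "peek (s' 0) = Some True \<longleftrightarrow> x \<in> L"
      using assms by blast
    let ?ts = "input_tape x # replicate (k - 1) blank_tape"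
    have init: "represents_store k ?ts ((\<lambda>_. [])(0 := x))"
      using k by (auto simp: represents_store_def input_tape_def blank_tape_def sym_def nth_Cons
        split: nat.splits)
    obtain ts' where ts': "(tm_step ?M ^^ t) (0, ?ts) = (len c, ts')" "represents_store k ts' s'"
      using compile_correct[OF t(1) k(2,1) _ _ init, of prog "[]" 0] by (auto simp: prog_def)
    let ?q = "if x \<in> L then accept_state ?M else reject_state ?M"
    have "read_tape (ts' ! 0) = peek_sym (peek (s' 0))"
      using ts' k by (auto simp: represents_store_def read_tape_represents)
    moreover have "peek_sym v = 2 \<longleftrightarrow> v = Some True" for v
      by (auto simp: peek_sym_def sym_def split: option.splits)
    ultimately have "tm_step ?M (len c, ts') = (?q, ts')"
      using k ts'(2) t(3)
      by (intro machine_stay[where i = 0 and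
          g = "\<lambda>a. (a, Stay, if a = 2 then len c + 1 else len c + 2)"])
        (simp_all add: prog_def nth_append represents_store_def machine_def)
    then have halt: "(tm_step ?M ^^ (t + 1)) (0, ?ts) = (?q, ts')"
      using ts' by simp
    \<comment> \<open>Halting configurations are fixed points, so time left over in the bound does
      no harm.\<close>
    have fix_point: "(tm_step ?M ^^ n) (?q, ts') = (?q, ts')" for n
      by (induction n) (auto simp: tm_step.simps)
    obtain n where n: "poly (P + 1) (length x) = n + (t + 1)"
      using t(2) by (metis le_add_diff_inverse2 add_le_cancel_right poly_add poly_1)
    have init: "tm_init ?M x = (0, ?ts)"
      by (simp add: tm_init_def machine_def)
    have "(tm_step ?M ^^ poly (P + 1) (length x)) (tm_init ?M x) = (?q, ts')"
      unfolding n init add.commute[of n] by (rule funpow_trans[OF halt fix_point])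
    then show "fst ((tm_step ?M ^^ poly (P + 1) (length x)) (tm_init ?M x)) = ?q"
      by simp
  qed
  ultimately show ?thesis
    unfolding class_P_def by blast
qed

section \<open>Upper bounds on running times, and moving data between stacks\<close>

definition runs :: "com \<Rightarrow> store \<Rightarrow> store \<Rightarrow> nat \<Rightarrow> bool" where
  "runs c s s' T \<longleftrightarrow> (\<exists>t\<le>T. exec c s t s')"

lemma runs_Skip: "runs Skip s s 0"
  unfolding runs_def using exec.Skip by blast

lemma runs_Push: "s' = s(i := b # s i) \<Longrightarrow> runs (Push i b) s s' 2"
  unfolding runs_def using exec.Push by blast

lemma runs_Pop: "s' = s(i := tl (s i)) \<Longrightarrow> runs (Pop i) s s' 1"
  unfolding runs_def using exec.Pop by blast

lemma runs_mono: "runs c s s' T \<Longrightarrow> T \<le> T' \<Longrightarrow> runs c s s' T'"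
  unfolding runs_def by (meson le_trans)

lemma runs_Seq: "runs c s s' T \<Longrightarrow> runs d s' s'' U \<Longrightarrow> runs (c ;; d) s s'' (T + U)"
  unfolding runs_def using exec.Seq by (meson add_mono)

lemma runs_Branch:
  assumes "peek (s i) = v \<Longrightarrow> runs c s s' T" "peek (s i) \<noteq> v \<Longrightarrow> runs d s s' T"
  shows "runs (Branch i v c d) s s' (T + 2)"
proof (cases "peek (s i) = v")
  case True
  then obtain t where "t \<le> T" "exec c s t s'"
    using assms(1) unfolding runs_def by blast
  then show ?thesis
    unfolding runs_def using exec.BranchTrue[of s i v c _ s' d] True by (meson add_le_mono1)
next
  case False
  then obtain t where "t \<le> T" "exec d s t s'"
    using assms(2) unfolding runs_def by blast
  then show ?thesis
    unfolding runs_def using exec.BranchFalse[of s i v d t s' c] False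
    by (intro exI[of _ "t + 1"]) simp
qed

lemma runs_Loop_end: "s i = [] \<Longrightarrow> runs (Loop i c) s s 1"
  unfolding runs_def using exec.LoopEnd by blast

lemma runs_Loop_step:
  assumes "s i \<noteq> []" "runs c s s' T" "runs (Loop i c) s' s'' U"
  shows "runs (Loop i c) s s'' (T + U + 2)"
proof -
  obtain t u where "t \<le> T" "u \<le> U" "exec c s t s'" "exec (Loop i c) s' u s''"
    using assms(2,3) unfolding runs_def by blast
  then show ?thesis
    unfolding runs_def using exec.LoopStep[of s i c t s' u s''] assms(1)
    by (intro exI[of _ "t + u + 2"]) simp
qed

text \<open>This is what later turns a bound on time into a bound on the size of the output.\<close>

lemma exec_length: "exec c s t s' \<Longrightarrow> length (s' j) \<le> length (s j) + t"
  by (induction rule: exec.induct) auto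

definition clear :: "nat \<Rightarrow> com" where
  "clear i = Loop i (Pop i)"

lemma runs_clear: "s i = l \<Longrightarrow> s' = s(i := []) \<Longrightarrow> runs (clear i) s s' (3 * length l + 1)"
proof (induction l arbitrary: s)
  case Nil
  then have "s' = s" by (simp add: fun_upd_idem)
  then show ?case unfolding clear_def using runs_Loop_end[of s i] Nil by simp
next
  case (Cons b l)
  have "runs (Pop i) s (s(i := l)) 1"
    using Cons.prems by (intro runs_Pop) auto
  moreover have "runs (Loop i (Pop i)) (s(i := l)) s' (3 * length l + 1)"
    unfolding clear_def[symmetric] by (rule Cons.IH) (simp_all add: Cons.prems fun_eq_iff)
  ultimately have "runs (Loop i (Pop i)) s s' (1 + (3 * length l + 1) + 2)"
    by (rule runs_Loop_step[rotated]) (simp add: Cons.prems)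
  then show ?case unfolding clear_def by (rule runs_mono) simp
qed

definition transfer :: "nat \<Rightarrow> nat \<Rightarrow> com" where
  "transfer i j =
     Loop i (Branch i (Some True) (Push j True) (Push j False) ;; Pop i)"

lemma runs_transfer:
  assumes "i \<noteq> j" "s i = l" "s j = r" "s' = s(i := [], j := rev l @ r)"
  shows "runs (transfer i j) s s' (7 * length l + 1)"
  using assms(2-)
proof (induction l arbitrary: s r)
  case Nil
  then have "s' = s" by auto
  then show ?case unfolding transfer_def using runs_Loop_end[of s i] Nil(1) by simp
next
  case (Cons b l)
  let ?s = "s(j := b # r)"
  have "runs (Branch i (Some True) (Push j True) (Push j False)) s ?s (2 + 2)"
    using Cons.prems by (intro runs_Branch runs_Push) (auto simp: peek_def)
  moreover have "runs (Pop i) ?s (?s(i := l)) 1"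
    using Cons.prems assms(1) by (intro runs_Pop) auto
  ultimately have "runs (Branch i (Some True) (Push j True) (Push j False) ;; Pop i) s (?s(i := l)) (2 + 2 + 1)"
    by (rule runs_Seq)
  moreover have "runs (transfer i j) (?s(i := l)) s' (7 * length l + 1)"
    using Cons.prems assms(1) by (intro Cons.IH) auto
  ultimately have "runs (transfer i j) s s' (2 + 2 + 1 + (7 * length l + 1) + 2)"
    unfolding transfer_def by (rule runs_Loop_step[rotated]) (simp add: Cons.prems)
  then show ?case by (rule runs_mono) simp
qed

text \<open>Reading a stack destroys it, so copies have to be written simultaneously in one
  pass.\<close>

definition transfer2 :: "nat \<Rightarrow> nat \<Rightarrow> nat \<Rightarrow> com" where
  "transfer2 i j k =
     Loop i (Branch i (Some True) (Push j True ;; Push k True) (Push j False ;; Push k False) ;; Pop i)"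

lemma runs_transfer2:
  assumes "i \<noteq> j" "i \<noteq> k" "j \<noteq> k" "s i = l" "s j = r" "s k = q"
    "s' = s(i := [], j := rev l @ r, k := rev l @ q)"
  shows "runs (transfer2 i j k) s s' (9 * length l + 1)"
  using assms(4-)
proof (induction l arbitrary: s r q)
  case Nil
  then have "s' = s" by auto
  then show ?case unfolding transfer2_def using runs_Loop_end[of s i] Nil(1) by simp
next
  case (Cons b l)
  let ?s = "s(j := b # r, k := b # q)"
  have "runs (Branch i (Some True) (Push j True ;; Push k True) (Push j False ;; Push k False))
      s ?s (2 + 2 + 2)"
    using Cons.prems assms(1-3)
    by (intro runs_Branch runs_Seq[where s' = "s(j := b # r)"] runs_Push) (auto simp: peek_def)
  moreover have "runs (Pop i) ?s (?s(i := l)) 1"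
    using Cons.prems assms(1-3) by (intro runs_Pop) auto
  ultimately have "runs (Branch i (Some True) (Push j True ;; Push k True) (Push j False ;; Push k False) ;; Pop i) s (?s(i := l)) (2 + 2 + 2 + 1)"
    by (rule runs_Seq)
  moreover have "runs (transfer2 i j k) (?s(i := l)) s' (9 * length l + 1)"
    using Cons.prems assms(1-3) by (intro Cons.IH) auto
  ultimately have "runs (transfer2 i j k) s s' (2 + 2 + 2 + 1 + (9 * length l + 1) + 2)"
    unfolding transfer2_def by (rule runs_Loop_step[rotated]) (simp add: Cons.prems)
  then show ?case by (rule runs_mono) simp
qed


subsection \<open>Polynomial bounds\<close>

lemma poly_nat_mono: "a \<le> b \<Longrightarrow> poly (p :: nat poly) a \<le> poly p b"
  by (induction p) (auto intro: add_mono mult_mono)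

definition poly_bounded :: "(nat \<Rightarrow> nat) \<Rightarrow> bool" where
  "poly_bounded f \<longleftrightarrow> (\<exists>p :: nat poly. \<forall>n. f n \<le> poly p n)"

lemma poly_bounded_poly: "poly_bounded (poly p)"
  unfolding poly_bounded_def by blast

lemma poly_bounded_const: "poly_bounded (\<lambda>_. c)"
  unfolding poly_bounded_def by (rule exI[of _ "[:c:]"]) simp

lemma poly_bounded_id: "poly_bounded (\<lambda>n. n)"
  unfolding poly_bounded_def by (rule exI[of _ "[:0, 1:]"]) simp

lemma poly_bounded_add: "poly_bounded f \<Longrightarrow> poly_bounded g \<Longrightarrow> poly_bounded (\<lambda>n. f n + g n)"
  unfolding poly_bounded_def by (metis add_mono poly_add)

lemma poly_bounded_mult: "poly_bounded f \<Longrightarrow> poly_bounded g \<Longrightarrow> poly_bounded (\<lambda>n. f n * g n)"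
  unfolding poly_bounded_def by (metis mult_le_mono poly_mult)

lemma poly_bounded_comp:
  assumes "poly_bounded f" "poly_bounded g"
  shows "poly_bounded (\<lambda>n. f (g n))"
proof -
  obtain p q :: "nat poly" where "\<forall>n. f n \<le> poly p n" "\<forall>n. g n \<le> poly q n"
    using assms unfolding poly_bounded_def by blast
  then have "\<forall>n. f (g n) \<le> poly (pcompose p q) n"
    unfolding poly_pcompose by (meson le_trans poly_nat_mono)
  then show ?thesis unfolding poly_bounded_def by blast
qed

lemmas poly_bounded_intros = poly_bounded_const poly_bounded_id poly_bounded_add
  poly_bounded_mult poly_bounded_poly


subsection \<open>Encodings as binary trees\<close>

datatype data = Atom | Cell data data

primrec code :: "data \<Rightarrow> bool list" where
  "code Atom = [False]"
| "code (Cell a b) = True # code a @ code b"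

lemma code_prefix_free: "code a @ r = code b @ s \<Longrightarrow> a = b \<and> r = s"
proof (induction a arbitrary: b r s)
  case Atom
  then show ?case by (cases b) auto
next
  case (Cell a1 a2)
  obtain b1 b2 where b: "b = Cell b1 b2"
    using Cell.prems by (cases b) simp_all
  have "code a1 @ (code a2 @ r) = code b1 @ (code b2 @ s)"
    using Cell.prems b by simp
  then have 1: "a1 = b1 \<and> code a2 @ r = code b2 @ s"
    by (rule Cell.IH(1))
  then have "a2 = b2 \<and> r = s"
    by (intro Cell.IH(2)) simp
  then show ?case using 1 b by simp
qed

lemma code_not_Nil [simp]: "code a \<noteq> []"
  by (cases a) auto

class encodable =
  fixes enc :: "'a \<Rightarrow> data"
  assumes enc_inject: "enc x = enc y \<Longrightarrow> x = y"

lemma enc_eq_iff: "enc x = enc y \<longleftrightarrow> x = y"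
  using enc_inject[of x y] by blast

instantiation data :: encodable
begin
definition "enc_data (x :: data) = x"
instance by standard (simp add: enc_data_def)
end

instantiation bool :: encodable
begin
definition "enc_bool b = (if b then Cell Atom Atom else Atom)"
instance by standard (simp add: enc_bool_def split: if_splits)
end

instantiation prod :: (encodable, encodable) encodable
begin
definition "enc_prod = (\<lambda>(a, b). Cell (enc a) (enc b))"
instance by standard (simp add: enc_prod_def enc_eq_iff split: prod.splits)
end

instantiation list :: (encodable) encodable
begin
primrec enc_list where
  "enc_list [] = Atom"
| "enc_list (a # l) = Cell (enc a) (enc_list l)"
instance
proof
  show "enc x = enc y \<Longrightarrow> x = y" for x y :: "'a list"
  proof (induction x arbitrary: y)
    case Nil
    then show ?case by (cases y) simp_all
  next
    case (Cons a x)
    then show ?case by (cases y) (simp_all add: enc_eq_iff)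
  qed
qed
end

text \<open>Binary, because prices and budgets can be exponential in the length of the
  input.\<close>

instantiation nat :: encodable
begin
definition "enc_nat (n :: nat) = enc (bits n)"
instance
proof
  fix x y :: nat
  assume "enc x = enc y"
  then have "enc (bits x) = enc (bits y)" by (simp only: enc_nat_def)
  then have "bits x = bits y" by (rule enc_inject)
  then show "x = y" by (rule bits_inject)
qed
end

definition csize :: "'a::encodable \<Rightarrow> nat" where
  "csize x = length (code (enc x))"

lemma csize_Pair [simp]: "csize (a, b) = 1 + csize a + csize b"
  by (simp add: csize_def enc_prod_def)

lemma csize_Nil [simp]: "csize [] = 1"
  by (simp add: csize_def)

lemma csize_Cons [simp]: "csize (a # l) = 1 + csize a + csize l"
  by (simp add: csize_def)

lemma csize_nat: "csize (n :: nat) = csize (bits n)"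
  by (simp add: csize_def enc_nat_def)

lemma length_le_csize: "length l \<le> csize l"
  by (induction l) auto

lemma peek_bool: "peek (code (enc b)) = Some b"
  by (simp add: enc_bool_def)


subsection \<open>Polynomial-time functions\<close>

text \<open>A program reads its argument from stack 0 and replaces it by the result. It may use the stacks
  below \<open>k\<close> as scratch space, but has to leave them empty; larger stacks are free for programs
  that call it.\<close>

definition empty_below :: "nat \<Rightarrow> store \<Rightarrow> bool" where
  "empty_below k s \<longleftrightarrow> (\<forall>i. 0 < i \<and> i < k \<longrightarrow> s i = [])"

definition computes :: "com \<Rightarrow> nat \<Rightarrow> (nat \<Rightarrow> nat) \<Rightarrow> ('a::encodable \<Rightarrow> 'b::encodable) \<Rightarrow> bool" where
  "computes c k T f \<longleftrightarrow> (\<forall>x s. s 0 = code (enc x) \<longrightarrow> empty_below k s \<longrightarrow>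
     runs c s (s(0 := code (enc (f x)))) (T (csize x)))"

definition pt :: "('a::encodable \<Rightarrow> 'b::encodable) \<Rightarrow> bool" where
  "pt f \<longleftrightarrow> (\<exists>c k T. computes c k T f \<and> poly_bounded T)"

lemma ptI:
  assumes "\<And>x s. s 0 = code (enc x) \<Longrightarrow> empty_below k s \<Longrightarrow>
      runs c s (s(0 := code (enc (f x)))) (T (csize x))"
    and "poly_bounded T"
  shows "pt f"
  unfolding pt_def
proof (intro exI conjI)
  show "computes c k T f"
    unfolding computes_def using assms(1) by simp
qed (rule assms(2))

text \<open>A time bound \<open>T\<close> need not be monotone, but a polynomial over the natural
  numbers above it is. The program may therefore be charged for any upper bound \<open>m\<close> on
  the argument size, which is all that is known about intermediate results.\<close>

lemma ptE:
  assumes "pt f"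
  obtains c k p where "\<And>x s m. s 0 = code (enc x) \<Longrightarrow> empty_below k s \<Longrightarrow> csize x \<le> m \<Longrightarrow>
      runs c s (s(0 := code (enc (f x)))) (poly p m)"
proof -
  obtain c k T where c: "computes c k T f" and T: "poly_bounded T"
    using assms unfolding pt_def by (elim exE conjE)
  obtain p :: "nat poly" where p: "\<forall>n. T n \<le> poly p n"
    using T unfolding poly_bounded_def by (elim exE)
  have "runs c s (s(0 := code (enc (f x)))) (poly p m)"
    if "s 0 = code (enc x)" "empty_below k s" "csize x \<le> m" for x s m
  proof (rule runs_mono)
    show "runs c s (s(0 := code (enc (f x)))) (T (csize x))"
      using c that unfolding computes_def by simp
    show "T (csize x) \<le> poly p m"
      using spec[OF p] poly_nat_mono[OF that(3)] by (rule le_trans)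
  qed
  then show thesis by (rule that)
qed

lemma empty_belowD: "empty_below k s \<Longrightarrow> 0 < i \<Longrightarrow> i < k \<Longrightarrow> s i = []"
  by (simp add: empty_below_def)

lemma empty_below_mono: "empty_below k s \<Longrightarrow> k' \<le> k \<Longrightarrow> empty_below k' s"
  by (auto simp: empty_below_def)

text \<open>A program cannot write more than its running time allows, so the result is at most as
  long as the input (\<open>[:0, 1:]\<close>) plus the time.\<close>

lemma pt_csize:
  assumes "pt f"
  obtains q :: "nat poly" where "\<And>x m. csize x \<le> m \<Longrightarrow> csize (f x) \<le> poly q m"
proof -
  obtain c k p where c: "\<And>x s m. s 0 = code (enc x) \<Longrightarrow> empty_below k s \<Longrightarrow> csize x \<le> m \<Longrightarrow>
      runs c s (s(0 := code (enc (f x)))) (poly p m)"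
    by (rule ptE[OF assms]) blast
  have "csize (f x) \<le> poly (p + [:0, 1:]) m" if "csize x \<le> m" for x m
  proof -
    let ?s = "(\<lambda>_. [])(0 := code (enc x))"
    have "runs c ?s (?s(0 := code (enc (f x)))) (poly p m)"
      by (rule c) (simp_all add: empty_below_def that)
    then obtain t where t: "t \<le> poly p m" "exec c ?s t (?s(0 := code (enc (f x))))"
      unfolding runs_def by blast
    have "length (code (enc (f x))) \<le> length (code (enc x)) + t"
      using exec_length[OF t(2), of 0] by simp
    then show ?thesis
      using t(1) that by (simp add: csize_def)
  qed
  then show thesis by (rule that)
qed

section \<open>Closure under recoding, composition, pairing and case distinction\<close>

lemma pt_id: "pt (\<lambda>x. x)"
proof (rule ptI)
  show "runs Skip s (s(0 := code (enc x))) 0" if "s 0 = code (enc x)" for x :: 'a and s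
    unfolding fun_upd_idem[of s 0, OF that] by (rule runs_Skip)
qed (rule poly_bounded_intros)

text \<open>A program sees only codes: if \<open>g\<close> acts on codes as \<open>f\<close> does,
  the program for \<open>f\<close> also computes \<open>g\<close>, whatever the types are.\<close>

lemma pt_recode:
  fixes f :: "'a::encodable \<Rightarrow> 'b::encodable" and g :: "'c::encodable \<Rightarrow> 'd::encodable"
  assumes "pt f" "\<And>y. enc (h y) = enc y" "\<And>y. enc (g y) = enc (f (h y))"
  shows "pt g"
proof -
  obtain c k T where c: "computes c k T f" "poly_bounded T"
    using assms(1) unfolding pt_def by (elim exE conjE)
  have "runs c s (s(0 := code (enc (g y)))) (T (csize y))"
    if "s 0 = code (enc y)" "empty_below k s" for y s
  proof -
    have "runs c s (s(0 := code (enc (f (h y))))) (T (csize (h y)))"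
      using c(1) that assms(2)[of y] unfolding computes_def by simp
    then show ?thesis
      using assms(2,3)[of y] by (simp add: csize_def)
  qed
  then show ?thesis
    using c(2) by (intro ptI)
qed

lemma pt_comp:
  fixes f :: "'b::encodable \<Rightarrow> 'c::encodable" and g :: "'a::encodable \<Rightarrow> 'b"
  assumes "pt f" "pt g"
  shows "pt (\<lambda>x. f (g x))"
proof -
  obtain c k p where c: "\<And>x s m. s 0 = code (enc x) \<Longrightarrow> empty_below k s \<Longrightarrow> csize x \<le> m \<Longrightarrow>
      runs c s (s(0 := code (enc (f x)))) (poly p m)"
    by (rule ptE[OF assms(1)]) blast
  obtain d l q where d: "\<And>x s m. s 0 = code (enc x) \<Longrightarrow> empty_below l s \<Longrightarrow> csize x \<le> m \<Longrightarrow>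
      runs d s (s(0 := code (enc (g x)))) (poly q m)"
    by (rule ptE[OF assms(2)]) blast
  obtain r :: "nat poly" where r: "\<And>x m. csize x \<le> m \<Longrightarrow> csize (g x) \<le> poly r m"
    by (rule pt_csize[OF assms(2)]) blast
  show ?thesis
  proof (rule ptI)
    fix x :: 'a and s :: store
    assume s: "s 0 = code (enc x)" "empty_below (max k l) s"
    have 1: "runs d s (s(0 := code (enc (g x)))) (poly q (csize x))"
      using s by (intro d) (auto intro: empty_below_mono)
    have "empty_below k s"
      using s(2) by (rule empty_below_mono) simp
    then have 2: "runs c (s(0 := code (enc (g x)))) (s(0 := code (enc (f (g x)))))
        (poly p (poly r (csize x)))"
      using c[of "s(0 := code (enc (g x)))" "g x" "poly r (csize x)"] r
      by (simp add: empty_below_def)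
    show "runs (d ;; c) s (s(0 := code (enc (f (g x)))))
        (poly q (csize x) + poly p (poly r (csize x)))"
      by (rule runs_Seq[OF 1 2])
  qed (intro poly_bounded_intros poly_bounded_comp[of "poly p" "poly r"])
qed

definition push_code :: "bool list \<Rightarrow> com" where
  "push_code l = foldr (\<lambda>b c. c ;; Push 0 b) l Skip"

lemma runs_push_code: "s' = s(0 := l @ s 0) \<Longrightarrow> runs (push_code l) s s' (2 * length l)"
proof (induction l arbitrary: s')
  case Nil
  then show ?case by (simp add: push_code_def runs_Skip)
next
  case (Cons b l)
  have "runs (push_code l) s (s(0 := l @ s 0)) (2 * length l)"
    by (rule Cons.IH) simp
  moreover have "runs (Push 0 b) (s(0 := l @ s 0)) s' 2"
    using Cons.prems by (intro runs_Push) (auto simp: fun_eq_iff)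
  ultimately have "runs (push_code l ;; Push 0 b) s s' (2 * length l + 2)"
    by (rule runs_Seq)
  then show ?case by (simp add: push_code_def)
qed

lemma pt_const: "pt (\<lambda>x :: 'a::encodable. c :: 'b::encodable)"
proof (rule ptI)
  fix x :: 'a and s :: store
  assume s: "s 0 = code (enc x)" "empty_below 0 s"
  have 1: "runs (clear 0) s (s(0 := [])) (3 * csize x + 1)"
    unfolding csize_def by (rule runs_clear) (simp_all add: s)
  have 2: "runs (push_code (code (enc c))) (s(0 := [])) (s(0 := code (enc c))) (2 * csize c)"
    unfolding csize_def by (rule runs_push_code) (simp add: fun_eq_iff)
  show "runs (clear 0 ;; push_code (code (enc c))) s (s(0 := code (enc c)))
      (3 * csize x + 1 + 2 * csize c)"
    by (rule runs_Seq[OF 1 2])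
qed (intro poly_bounded_intros)

text \<open>A transfer reverses the order, so the copy is made by a detour: out to stack
  \<open>k + 1\<close>, and back from there to 0 and \<open>k\<close> at once.\<close>

definition duplicate :: "nat \<Rightarrow> com" where
  "duplicate k = transfer 0 (k + 1) ;; transfer2 (k + 1) 0 k"

lemma runs_duplicate:
  assumes "k > 0" "s k = []" "s (k + 1) = []" "s 0 = l" "s' = s(k := l)"
  shows "runs (duplicate k) s s' (16 * length l + 2)"
proof -
  have 1: "runs (transfer 0 (k + 1)) s (s(0 := [], k + 1 := rev l)) (7 * length l + 1)"
    by (rule runs_transfer) (use assms in auto)
  have 2: "runs (transfer2 (k + 1) 0 k) (s(0 := [], k + 1 := rev l)) s' (9 * length (rev l) + 1)"
    by (rule runs_transfer2) (use assms in \<open>auto simp: fun_eq_iff\<close>)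
  show ?thesis
    unfolding duplicate_def using runs_mono[OF runs_Seq[OF 1 2]] by simp
qed

definition restore :: "nat \<Rightarrow> nat \<Rightarrow> com" where
  "restore k j = transfer k j ;; transfer j 0"

lemma runs_restore:
  assumes "k > 0" "j > 0" "j \<noteq> k" "s j = []" "s k = l" "s 0 = []" "s' = s(k := [], 0 := l)"
  shows "runs (restore k j) s s' (14 * length l + 2)"
proof -
  have 1: "runs (transfer k j) s (s(k := [], j := rev l)) (7 * length l + 1)"
    by (rule runs_transfer) (use assms in auto)
  have 2: "runs (transfer j 0) (s(k := [], j := rev l)) s' (7 * length (rev l) + 1)"
    by (rule runs_transfer) (use assms in \<open>auto simp: fun_eq_iff\<close>)
  show ?thesis
    unfolding restore_def using runs_mono[OF runs_Seq[OF 1 2]] by simp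
qed

text \<open>The input is kept on a spare stack while \<open>g\<close> runs and put back for
  \<open>f\<close>. The results are parked in reverse and brought back second component first, so
  that one more bit completes the code of the pair.\<close>

lemma pt_Pair:
  fixes f :: "'a::encodable \<Rightarrow> 'b::encodable" and g :: "'a \<Rightarrow> 'c::encodable"
  assumes "pt f" "pt g"
  shows "pt (\<lambda>x. (f x, g x))"
proof -
  obtain c k p where c: "\<And>x s m. s 0 = code (enc x) \<Longrightarrow> empty_below k s \<Longrightarrow> csize x \<le> m \<Longrightarrow>
      runs c s (s(0 := code (enc (f x)))) (poly p m)"
    by (rule ptE[OF assms(1)]) blast
  obtain d l q where d: "\<And>x s m. s 0 = code (enc x) \<Longrightarrow> empty_below l s \<Longrightarrow> csize x \<le> m \<Longrightarrow>
      runs d s (s(0 := code (enc (g x)))) (poly q m)"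
    by (rule ptE[OF assms(2)]) blast
  obtain r1 :: "nat poly" where r1: "\<And>x m. csize x \<le> m \<Longrightarrow> csize (f x) \<le> poly r1 m"
    by (rule pt_csize[OF assms(1)]) blast
  obtain r2 :: "nat poly" where r2: "\<And>x m. csize x \<le> m \<Longrightarrow> csize (g x) \<le> poly r2 m"
    by (rule pt_csize[OF assms(2)]) blast
  \<comment> \<open>Stacks from \<open>K\<close> on lie beyond the scratch space of both programs,
    which therefore leave them untouched and find their own scratch space empty.\<close>
  define K where "K = Suc (max k l)"
  define T where "T n = (16 * n + 2) + (poly q n + ((7 * poly r2 n + 1) + ((14 * n + 2) +
    (poly p n + ((7 * poly r1 n + 1) + ((7 * poly r2 n + 1) + ((7 * poly r1 n + 1) + 2)))))))" for n
  show ?thesis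
  proof (rule ptI)
    fix x :: 'a and s :: store
    assume s: "s 0 = code (enc x)" "empty_below (K + 3) s"
    let ?X = "code (enc x)" and ?F = "code (enc (f x))" and ?G = "code (enc (g x))"
    let ?n = "csize x"
    have [simp]: "K > 0" "K \<noteq> 0" by (simp_all add: K_def)
    have [simp]: "s K = []" "s (Suc K) = []" "s (Suc (Suc K)) = []"
      by (rule empty_belowD[OF s(2)]; simp)+
    have empty: "empty_below k s" "empty_below l s"
      using s(2) by (auto intro: empty_below_mono simp: K_def)
    have X: "length ?X = ?n" and F: "length ?F \<le> poly r1 ?n" and G: "length ?G \<le> poly r2 ?n"
      using r1 r2 by (simp_all add: csize_def)
    have 1: "runs (duplicate K) s (s(K := ?X)) (16 * ?n + 2)"
      unfolding X[symmetric] by (rule runs_duplicate) (simp_all add: s)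
    have 2: "runs d (s(K := ?X)) (s(K := ?X, 0 := ?G)) (poly q ?n)"
      using empty by (intro d) (auto simp: s empty_below_def K_def)
    have 3: "runs (transfer 0 (K + 1)) (s(K := ?X, 0 := ?G)) (s(K := ?X, 0 := [], K + 1 := rev ?G))
        (7 * poly r2 ?n + 1)"
      by (rule runs_mono[OF runs_transfer[where l = ?G]]) (use G in auto)
    have 4: "runs (restore K (K + 2)) (s(K := ?X, 0 := [], K + 1 := rev ?G))
        (s(0 := ?X, K + 1 := rev ?G)) (14 * ?n + 2)"
      unfolding X[symmetric] by (rule runs_restore) (auto simp: fun_eq_iff)
    have 5: "runs c (s(0 := ?X, K + 1 := rev ?G)) (s(0 := ?X, K + 1 := rev ?G, 0 := ?F)) (poly p ?n)"
      using empty by (intro c) (auto simp: empty_below_def K_def)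
    have 6: "runs (transfer 0 K) (s(0 := ?X, K + 1 := rev ?G, 0 := ?F))
        (s(0 := [], K + 1 := rev ?G, K := rev ?F)) (7 * poly r1 ?n + 1)"
      by (rule runs_mono[OF runs_transfer[where l = ?F]]) (use F in \<open>auto simp: fun_eq_iff\<close>)
    have 7: "runs (transfer (K + 1) 0) (s(0 := [], K + 1 := rev ?G, K := rev ?F))
        (s(0 := ?G, K := rev ?F)) (7 * poly r2 ?n + 1)"
      by (rule runs_mono[OF runs_transfer[where l = "rev ?G"]]) (use G in \<open>auto simp: fun_eq_iff\<close>)
    have 8: "runs (transfer K 0) (s(0 := ?G, K := rev ?F)) (s(0 := ?F @ ?G)) (7 * poly r1 ?n + 1)"
      by (rule runs_mono[OF runs_transfer[where l = "rev ?F"]]) (use F in \<open>auto simp: fun_eq_iff\<close>)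
    have 9: "runs (Push 0 True) (s(0 := ?F @ ?G)) (s(0 := code (enc (f x, g x)))) 2"
      by (rule runs_Push) (auto simp: enc_prod_def)
    show "runs (duplicate K ;; d ;; transfer 0 (K + 1) ;; restore K (K + 2) ;; c ;; transfer 0 K ;;
        transfer (K + 1) 0 ;; transfer K 0 ;; Push 0 True) s (s(0 := code (enc (f x, g x)))) (T (csize x))"
      unfolding T_def
      by (rule runs_Seq[OF 1 runs_Seq[OF 2 runs_Seq[OF 3 runs_Seq[OF 4 runs_Seq[OF 5
        runs_Seq[OF 6 runs_Seq[OF 7 runs_Seq[OF 8 9]]]]]]]])
  qed (unfold T_def, intro poly_bounded_intros)
qed

lemma pt_If:
  fixes f g :: "'a::encodable \<Rightarrow> 'b::encodable"
  assumes "pt b" "pt f" "pt g"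
  shows "pt (\<lambda>x. if b x then f x else g x)"
proof -
  obtain cb kb pb where b: "\<And>x s m. s 0 = code (enc x) \<Longrightarrow> empty_below kb s \<Longrightarrow> csize x \<le> m \<Longrightarrow>
      runs cb s (s(0 := code (enc (b x)))) (poly pb m)"
    by (rule ptE[OF assms(1)]) blast
  obtain c k p where c: "\<And>x s m. s 0 = code (enc x) \<Longrightarrow> empty_below k s \<Longrightarrow> csize x \<le> m \<Longrightarrow>
      runs c s (s(0 := code (enc (f x)))) (poly p m)"
    by (rule ptE[OF assms(2)]) blast
  obtain d l q where d: "\<And>x s m. s 0 = code (enc x) \<Longrightarrow> empty_below l s \<Longrightarrow> csize x \<le> m \<Longrightarrow>
      runs d s (s(0 := code (enc (g x)))) (poly q m)"
    by (rule ptE[OF assms(3)]) blast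
  define K where "K = Suc (max kb (max k l))"
  define T where "T n = (16 * n + 2) + (poly pb n + (10 + ((14 * n + 2) + (poly p n + poly q n) + 2)))" for n
  show ?thesis
  proof (rule ptI)
    fix x :: 'a and s :: store
    assume s: "s 0 = code (enc x)" "empty_below (K + 3) s"
    let ?X = "code (enc x)" and ?B = "code (enc (b x))"
    let ?n = "csize x" and ?s' = "s(0 := code (enc (if b x then f x else g x)))"
    have [simp]: "K > 0" "K \<noteq> 0" by (simp_all add: K_def)
    have [simp]: "s K = []" "s (Suc K) = []"
      by (rule empty_belowD[OF s(2)]; simp)+
    have empty: "empty_below kb s" "empty_below k s" "empty_below l s"
      using s(2) by (auto intro: empty_below_mono simp: K_def)
    have X: "length ?X = ?n" by (simp add: csize_def)
    have B: "length ?B \<le> 3" by (simp add: enc_bool_def)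
    have 1: "runs (duplicate K) s (s(K := ?X)) (16 * ?n + 2)"
      unfolding X[symmetric] by (rule runs_duplicate) (simp_all add: s)
    have 2: "runs cb (s(K := ?X)) (s(K := ?X, 0 := ?B)) (poly pb ?n)"
      using empty by (intro b) (auto simp: s empty_below_def K_def)
    have 3: "runs (clear 0) (s(K := ?X, 0 := ?B)) (s(K := ?X, 0 := [])) 10"
      by (rule runs_mono[OF runs_clear[where l = ?B]]) (use B in auto)
    have 4: "runs (restore K (K + 1)) (s(K := ?X, 0 := [])) (s(0 := ?X)) (14 * ?n + 2)"
      unfolding X[symmetric] by (rule runs_restore) (auto simp: fun_eq_iff)
    have 5: "runs (Branch 0 (Some True) (clear 0 ;; restore K (K + 1) ;; c) (clear 0 ;; restore K (K + 1) ;; d))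
        (s(K := ?X, 0 := ?B)) ?s' (10 + ((14 * ?n + 2) + (poly p ?n + poly q ?n)) + 2)"
    proof (intro runs_Branch)
      assume "peek ((s(K := ?X, 0 := ?B)) 0) = Some True"
      then have bx: "b x" using peek_bool[of "b x"] by simp
      have "runs c (s(0 := ?X)) (s(0 := ?X, 0 := code (enc (f x)))) (poly p ?n)"
        using empty by (intro c) (auto simp: empty_below_def K_def)
      then have "runs c (s(0 := ?X)) ?s' (poly p ?n + poly q ?n)"
        using bx by (auto intro: runs_mono)
      then show "runs (clear 0 ;; restore K (K + 1) ;; c) (s(K := ?X, 0 := ?B)) ?s'
          (10 + ((14 * ?n + 2) + (poly p ?n + poly q ?n)))"
        by (intro runs_Seq[OF 3] runs_Seq[OF 4])
    next
      assume "peek ((s(K := ?X, 0 := ?B)) 0) \<noteq> Some True"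
      then have bx: "\<not> b x" using peek_bool[of "b x"] by simp
      have "runs d (s(0 := ?X)) (s(0 := ?X, 0 := code (enc (g x)))) (poly q ?n)"
        using empty by (intro d) (auto simp: empty_below_def K_def)
      then have "runs d (s(0 := ?X)) ?s' (poly p ?n + poly q ?n)"
        using bx by (auto intro: runs_mono)
      then show "runs (clear 0 ;; restore K (K + 1) ;; d) (s(K := ?X, 0 := ?B)) ?s'
          (10 + ((14 * ?n + 2) + (poly p ?n + poly q ?n)))"
        by (intro runs_Seq[OF 3] runs_Seq[OF 4])
    qed
    have "runs (duplicate K ;; cb ;; Branch 0 (Some True) (clear 0 ;; restore K (K + 1) ;; c)
        (clear 0 ;; restore K (K + 1) ;; d)) s ?s'
        ((16 * ?n + 2) + (poly pb ?n + (10 + ((14 * ?n + 2) + (poly p ?n + poly q ?n)) + 2)))"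
      by (intro runs_Seq[OF 1] runs_Seq[OF 2] 5)
    then show "runs (duplicate K ;; cb ;; Branch 0 (Some True) (clear 0 ;; restore K (K + 1) ;; c)
        (clear 0 ;; restore K (K + 1) ;; d)) s ?s' (T ?n)"
      by (simp add: T_def add_ac)
  qed (unfold T_def, intro poly_bounded_intros)
qed

text \<open>Moves a code from stack 0 to stack 1; stack 2 counts the subtrees still to be read.\<close>

definition move_code :: com where
  "move_code = Loop 2
     (Branch 0 (Some True) (Push 2 True ;; Push 1 True) (Pop 2 ;; Push 1 False) ;; Pop 0)"

text \<open>Stated with a continuation: once one complete code has been read, the same loop goes on
  from \<open>s''\<close> with one pending subtree less. This allows the two subtrees of a cell to
  be chained inside a single loop. Each bit costs 9 steps.\<close>

lemma runs_move_code_aux: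
  assumes "s 0 = code a @ r" "s 2 = True # cnt"
    "s'' = s(0 := r, 1 := rev (code a) @ s 1, 2 := cnt)" "runs move_code s'' s' T"
  shows "runs move_code s s' (T + 9 * length (code a))"
  using assms
proof (induction a arbitrary: s r cnt s'' T)
  case Atom
  let ?s = "s(1 := False # s 1, 2 := cnt)"
  have "runs (Branch 0 (Some True) (Push 2 True ;; Push 1 True) (Pop 2 ;; Push 1 False)) s ?s
      (2 + 2 + 2)"
    using Atom by (intro runs_Branch runs_mono[OF runs_Seq[where s' = "s(2 := cnt)", OF runs_Pop runs_Push]])
      (auto simp: fun_eq_iff)
  moreover have "runs (Pop 0) ?s (?s(0 := r)) 1"
    using Atom by (intro runs_Pop) (auto simp: fun_eq_iff)
  ultimately have step: "runs (Branch 0 (Some True) (Push 2 True ;; Push 1 True) (Pop 2 ;; Push 1 False) ;; Pop 0)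
      s (?s(0 := r)) (2 + 2 + 2 + 1)"
    by (rule runs_Seq)
  have "?s(0 := r) = s''"
    unfolding Atom(3) by (auto simp: fun_eq_iff)
  then have "runs move_code (?s(0 := r)) s' T"
    using Atom(4) by (simp only:)
  from runs_Loop_step[OF _ step this[unfolded move_code_def]] show ?case
    unfolding move_code_def[symmetric] by (rule runs_mono) (use Atom in simp_all)
next
  case (Cell a b)
  let ?s = "s(1 := True # s 1, 2 := True # True # cnt)"
  have "runs (Branch 0 (Some True) (Push 2 True ;; Push 1 True) (Pop 2 ;; Push 1 False)) s ?s
      (2 + 2 + 2)"
    using Cell.prems
    by (intro runs_Branch runs_Seq[where s' = "s(2 := True # True # cnt)"] runs_Push)
      (auto simp: fun_eq_iff)
  moreover have "runs (Pop 0) ?s (?s(0 := code a @ code b @ r)) 1"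
    using Cell.prems by (intro runs_Pop) (auto simp: fun_eq_iff)
  ultimately have step: "runs (Branch 0 (Some True) (Push 2 True ;; Push 1 True) (Pop 2 ;; Push 1 False) ;; Pop 0)
      s (?s(0 := code a @ code b @ r)) (2 + 2 + 2 + 1)"
    by (rule runs_Seq)
  let ?s1 = "?s(0 := code b @ r, 1 := rev (code a) @ True # s 1, 2 := True # cnt)"
  have b: "runs move_code ?s1 s' (T + 9 * length (code b))"
    by (rule Cell.IH(2)[OF _ _ _ Cell.prems(4)]) (auto simp: Cell.prems(3) fun_eq_iff)
  have "runs move_code (?s(0 := code a @ code b @ r)) s'
      (T + 9 * length (code b) + 9 * length (code a))"
    by (rule Cell.IH(1)[OF _ _ _ b, where r = "code b @ r" and cnt = "True # cnt"])
      (auto simp: fun_eq_iff)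
  from runs_Loop_step[OF _ step this[unfolded move_code_def]] show ?case
    unfolding move_code_def[symmetric] by (rule runs_mono) (simp_all add: Cell.prems)
qed

lemma runs_move_code:
  assumes "s 0 = code a @ r" "s 1 = []" "s 2 = [True]" "s' = s(0 := r, 1 := rev (code a), 2 := [])"
  shows "runs move_code s s' (9 * length (code a) + 1)"
proof -
  have "s' 2 = []" using assms by simp
  then have "runs move_code s' s' 1"
    unfolding move_code_def by (rule runs_Loop_end)
  then have "runs move_code s s' (1 + 9 * length (code a))"
    using assms by (intro runs_move_code_aux[where r = r and cnt = "[]" and s'' = s']) simp_all
  then show ?thesis by simp
qed

fun car :: "data \<Rightarrow> data" where
  "car Atom = Atom"
| "car (Cell a b) = a"

fun cdr :: "data \<Rightarrow> data" where
  "cdr Atom = Atom"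
| "cdr (Cell a b) = b"

definition split_cell :: com where
  "split_cell = Pop 0 ;; Push 2 True ;; move_code"

lemma runs_split_cell:
  assumes "s 0 = code (Cell a b)" "s 1 = []" "s 2 = []"
    "s' = s(0 := code b, 1 := rev (code a))"
  shows "runs split_cell s s' (9 * length (code a) + 4)"
proof -
  have 1: "runs (Pop 0) s (s(0 := code a @ code b)) 1"
    by (rule runs_Pop) (simp add: assms)
  have 2: "runs (Push 2 True) (s(0 := code a @ code b)) (s(0 := code a @ code b, 2 := [True])) 2"
    by (rule runs_Push) (simp add: assms)
  have 3: "runs move_code (s(0 := code a @ code b, 2 := [True])) s' (9 * length (code a) + 1)"
    by (rule runs_move_code) (use assms in \<open>auto simp: fun_eq_iff\<close>)
  show ?thesis
    unfolding split_cell_def by (rule runs_mono[OF runs_Seq[OF 1 runs_Seq[OF 2 3]]]) simp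
qed

lemma pt_car: "pt car"
proof (rule ptI)
  fix x :: data and s :: store
  assume s: "s 0 = code (enc x)" "empty_below 3 s"
  note [simp] = s(1)
  have [simp]: "s 1 = []" "s (Suc 0) = []" "s 2 = []"
    using s(2) by (simp_all add: empty_below_def)
  show "runs (Branch 0 (Some True) (split_cell ;; clear 0 ;; transfer 1 0) Skip) s
      (s(0 := code (enc (car x)))) (19 * csize x + 8)"
  proof (cases x)
    case Atom
    have "runs (Branch 0 (Some True) (split_cell ;; clear 0 ;; transfer 1 0) Skip) s s (0 + 2)"
      by (rule runs_Branch[OF _ runs_Skip]) (simp add: enc_data_def Atom)
    moreover have "s(0 := code (enc (car x))) = s"
      by (auto simp: Atom enc_data_def fun_eq_iff)
    ultimately show ?thesis by (auto intro: runs_mono)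
  next
    case (Cell a b)
    have x: "enc x = Cell a b" by (simp add: Cell enc_data_def)
    have 1: "runs split_cell s (s(0 := code b, 1 := rev (code a))) (9 * length (code a) + 4)"
      by (rule runs_split_cell) (simp_all add: x)
    have 2: "runs (clear 0) (s(0 := code b, 1 := rev (code a))) (s(0 := [], 1 := rev (code a)))
        (3 * length (code b) + 1)"
      by (rule runs_clear) (auto simp: fun_eq_iff)
    have 3: "runs (transfer 1 0) (s(0 := [], 1 := rev (code a))) (s(0 := code a))
        (7 * length (rev (code a)) + 1)"
      by (rule runs_transfer) (auto simp: fun_eq_iff)
    have "runs (Branch 0 (Some True) (split_cell ;; clear 0 ;; transfer 1 0) Skip) s (s(0 := code a))
        (9 * length (code a) + 4 + (3 * length (code b) + 1 + (7 * length (rev (code a)) + 1)) + 2)"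
      by (rule runs_Branch[OF runs_Seq[OF 1 runs_Seq[OF 2 3]]]) (simp add: x)
    then show ?thesis
      by (simp add: Cell enc_data_def csize_def) (auto intro: runs_mono)
  qed
qed (intro poly_bounded_intros)

lemma pt_cdr: "pt cdr"
proof (rule ptI)
  fix x :: data and s :: store
  assume s: "s 0 = code (enc x)" "empty_below 3 s"
  note [simp] = s(1)
  have [simp]: "s 1 = []" "s (Suc 0) = []" "s 2 = []"
    using s(2) by (simp_all add: empty_below_def)
  show "runs (Branch 0 (Some True) (split_cell ;; clear 1) Skip) s
      (s(0 := code (enc (cdr x)))) (19 * csize x + 8)"
  proof (cases x)
    case Atom
    have "runs (Branch 0 (Some True) (split_cell ;; clear 1) Skip) s s (0 + 2)"
      by (rule runs_Branch[OF _ runs_Skip]) (simp add: enc_data_def Atom)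
    moreover have "s(0 := code (enc (cdr x))) = s"
      by (auto simp: Atom enc_data_def fun_eq_iff)
    ultimately show ?thesis by (auto intro: runs_mono)
  next
    case (Cell a b)
    have x: "enc x = Cell a b" by (simp add: Cell enc_data_def)
    have 1: "runs split_cell s (s(0 := code b, 1 := rev (code a))) (9 * length (code a) + 4)"
      by (rule runs_split_cell) (simp_all add: x)
    have 2: "runs (clear 1) (s(0 := code b, 1 := rev (code a))) (s(0 := code b))
        (3 * length (rev (code a)) + 1)"
      by (rule runs_clear) (auto simp: fun_eq_iff)
    have "runs (Branch 0 (Some True) (split_cell ;; clear 1) Skip) s (s(0 := code b))
        (9 * length (code a) + 4 + (3 * length (rev (code a)) + 1) + 2)"
      by (rule runs_Branch[OF runs_Seq[OF 1 2]]) (simp add: x)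
    then show ?thesis
      by (simp add: Cell enc_data_def csize_def) (auto intro: runs_mono)
  qed
qed (intro poly_bounded_intros)

text \<open>\<open>enc\<close> changes the type but not the code, so the empty program computes it.
  Any typed value can thus be treated as a bare tree.\<close>

lemma pt_enc: "pt (enc :: 'a::encodable \<Rightarrow> data)"
  by (rule pt_recode[where h = enc, OF pt_id]) (simp_all add: enc_data_def)

lemma pt_on_enc:
  fixes f :: "'a::encodable \<Rightarrow> 'b::encodable" and F :: "data \<Rightarrow> data"
  assumes "pt F" "\<And>x. enc (f x) = F (enc x)"
  shows "pt f"
  by (rule pt_recode[where h = enc, OF assms(1)]) (simp_all add: enc_data_def assms(2))

lemma pt_fst: "pt fst"
  by (rule pt_on_enc[OF pt_car]) (auto simp: enc_prod_def)

lemma pt_snd: "pt snd"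
  by (rule pt_on_enc[OF pt_cdr]) (auto simp: enc_prod_def)

lemma pt_tl: "pt tl"
proof (rule pt_on_enc[OF pt_cdr])
  show "enc (tl x) = cdr (enc x)" for x :: "'a list"
    by (cases x) auto
qed

lemma pt_Cons': "pt (\<lambda>p. fst p # snd p)"
  by (rule pt_on_enc[OF pt_id]) (auto simp: enc_prod_def)


section \<open>Equality of trees\<close>

definition match :: com where
  "match = Loop 2 ((Branch 2 (Some True) (Branch 0 (Some True) Skip (Push 3 True))
     (Branch 0 (Some False) Skip (Push 3 True)) ;; Pop 2) ;; Pop 0)"

text \<open>Stack 3 receives a mark for every mismatch, because a loop cannot be left early. An
  exhausted stack 0 counts as a mismatch too, so no mark means that \<open>l\<close> is a prefix of
  \<open>m\<close>.\<close>

lemma runs_match: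
  "s 2 = l \<Longrightarrow> s 0 = m \<Longrightarrow> \<exists>f. runs match s (s(0 := drop (length l) m, 2 := [], 3 := f)) (10 * length l + 1) \<and>
     (f = [] \<longleftrightarrow> s 3 = [] \<and> l = take (length l) m)"
proof (induction l arbitrary: s m)
  case Nil
  have eq: "s(0 := drop (length ([] :: bool list)) m, 2 := [], 3 := s 3) = s"
    using Nil by (auto simp: fun_eq_iff)
  have "runs match s s 1"
    unfolding match_def using Nil(1) by (rule runs_Loop_end)
  then show ?case
    by (intro exI[of _ "s 3"], unfold eq) simp
next
  case (Cons b l)
  define g where "g = (if peek m = Some b then s 3 else True # s 3)"
  have 1: "runs (Branch 2 (Some True) (Branch 0 (Some True) Skip (Push 3 True))
     (Branch 0 (Some False) Skip (Push 3 True))) s (s(3 := g)) (2 + 2 + 2)"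
    using Cons.prems
    by (intro runs_Branch runs_mono[OF runs_Skip] runs_Push)
      (auto simp: g_def fun_eq_iff intro!: runs_mono[OF runs_Skip])
  have 2: "runs (Pop 2) (s(3 := g)) (s(3 := g, 2 := l)) 1"
    by (rule runs_Pop) (simp add: Cons.prems)
  have 3: "runs (Pop 0) (s(3 := g, 2 := l)) (s(3 := g, 2 := l, 0 := tl m)) 1"
    by (rule runs_Pop) (simp add: Cons.prems)
  let ?s = "s(3 := g, 2 := l, 0 := tl m)"
  obtain f where f: "runs match ?s (?s(0 := drop (length l) (tl m), 2 := [], 3 := f))
      (10 * length l + 1)" "f = [] \<longleftrightarrow> ?s 3 = [] \<and> l = take (length l) (tl m)"
  proof -
    have "?s 2 = l" "?s 0 = tl m" by simp_all
    from Cons.IH[OF this] show thesis using that by blast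
  qed
  have eq: "?s(0 := drop (length l) (tl m), 2 := [], 3 := f) =
      s(0 := drop (length (b # l)) m, 2 := [], 3 := f)"
    by (auto simp: fun_eq_iff drop_Suc)
  have "runs match s (s(0 := drop (length (b # l)) m, 2 := [], 3 := f))
      (2 + 2 + 2 + 1 + 1 + (10 * length l + 1) + 2)"
    unfolding match_def
    by (rule runs_Loop_step[OF _ runs_Seq[OF runs_Seq[OF 1 2] 3] f(1)[unfolded eq match_def]])
      (simp add: Cons.prems)
  then have "runs match s (s(0 := drop (length (b # l)) m, 2 := [], 3 := f)) (10 * length (b # l) + 1)"
    by (rule runs_mono) simp
  moreover have "f = [] \<longleftrightarrow> s 3 = [] \<and> b # l = take (length (b # l)) m"
    unfolding f(2) by (cases m) (auto simp: g_def)
  ultimately show ?case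
    by blast
qed

text \<open>Since codes are prefix-free, \<open>code a\<close> is a prefix of \<open>code b\<close>
  only if the trees are equal. A prefix test therefore decides equality, and what remains on stack 0
  is simply cleared.\<close>

lemma pt_data_eq: "pt (\<lambda>p :: data \<times> data. fst p = snd p)"
proof (rule ptI)
  fix x :: "data \<times> data" and s :: store
  assume s: "s 0 = code (enc x)" "empty_below 4 s"
  obtain a b where x: "x = (a, b)" by (cases x)
  have s0: "s 0 = code (Cell a b)" by (simp add: s(1) x enc_prod_def enc_data_def)
  have [simp]: "s 1 = []" "s (Suc 0) = []" "s 2 = []" "s 3 = []"
    using s(2) by (simp_all add: empty_below_def)
  let ?a = "code a" and ?b = "code b"
  have 1: "runs split_cell s (s(0 := ?b, 1 := rev ?a)) (9 * length ?a + 4)"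
    by (rule runs_split_cell) (simp_all add: s0)
  have 2: "runs (transfer 1 2) (s(0 := ?b, 1 := rev ?a)) (s(0 := ?b, 2 := ?a)) (7 * length (rev ?a) + 1)"
    by (rule runs_transfer) (auto simp: fun_eq_iff)
  obtain f where f: "runs match (s(0 := ?b, 2 := ?a)) (s(0 := drop (length ?a) ?b, 3 := f)) (10 * length ?a + 1)"
    and f_Nil: "f = [] \<longleftrightarrow> ?a = take (length ?a) ?b"
  proof -
    have "s(0 := ?b, 2 := ?a, 0 := drop (length ?a) ?b, 2 := [], 3 := f) = s(0 := drop (length ?a) ?b, 3 := f)" for f
      by (auto simp: fun_eq_iff)
    then show thesis
      using runs_match[of "s(0 := ?b, 2 := ?a)" ?a ?b] that by auto
  qed
  have f_iff: "f = [] \<longleftrightarrow> a = b"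
  proof
    assume "f = []"
    then have "code a @ drop (length ?a) ?b = code b @ []"
      using f_Nil by (metis append_Nil2 append_take_drop_id)
    then show "a = b" using code_prefix_free by blast
  qed (simp add: f_Nil)
  have 3: "runs (clear 0) (s(0 := drop (length ?a) ?b, 3 := f)) (s(0 := [], 3 := f))
      (3 * length (drop (length ?a) ?b) + 1)"
    by (rule runs_clear) (auto simp: fun_eq_iff)
  have 4: "runs (Branch 3 None (push_code (code (enc True))) (push_code (code (enc False)))) (s(0 := [], 3 := f))
      (s(0 := code (enc (a = b)), 3 := f)) (6 + 2)"
  proof (intro runs_Branch)
    assume "peek ((s(0 := [], 3 := f)) 3) = None"
    then have "a = b" using f_iff by (cases f) auto
    then show "runs (push_code (code (enc True))) (s(0 := [], 3 := f)) (s(0 := code (enc (a = b)), 3 := f)) 6"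
      by (intro runs_mono[OF runs_push_code]) (auto simp: fun_eq_iff enc_bool_def)
  next
    assume "peek ((s(0 := [], 3 := f)) 3) \<noteq> None"
    then have "a \<noteq> b" using f_iff by auto
    then show "runs (push_code (code (enc False))) (s(0 := [], 3 := f)) (s(0 := code (enc (a = b)), 3 := f)) 6"
      by (intro runs_mono[OF runs_push_code]) (auto simp: fun_eq_iff enc_bool_def)
  qed
  \<comment> \<open>The number of marks is bounded by the time in which they were written.\<close>
  have f_len: "length f \<le> 10 * length ?a + 1"
  proof -
    obtain t where "t \<le> 10 * length ?a + 1" "exec match (s(0 := ?b, 2 := ?a)) t (s(0 := drop (length ?a) ?b, 3 := f))"
      using f unfolding runs_def by blast
    from exec_length[OF this(2), of 3] this(1) show ?thesis by simp
  qed
  have 5: "runs (clear 3) (s(0 := code (enc (a = b)), 3 := f)) (s(0 := code (enc (a = b)))) (3 * length f + 1)"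
    by (rule runs_clear) (auto simp: fun_eq_iff)
  have cs: "csize x = 1 + length ?a + length ?b"
    by (simp add: csize_def x enc_prod_def enc_data_def)
  have "runs (split_cell ;; transfer 1 2 ;; match ;; clear 0 ;;
      Branch 3 None (push_code (code (enc True))) (push_code (code (enc False))) ;; clear 3) s
      (s(0 := code (enc (a = b)))) (9 * length ?a + 4 + (7 * length (rev ?a) + 1 + (10 * length ?a + 1 +
      (3 * length (drop (length ?a) ?b) + 1 + (6 + 2 + (3 * length f + 1))))))"
    by (rule runs_Seq[OF 1 runs_Seq[OF 2 runs_Seq[OF f runs_Seq[OF 3 runs_Seq[OF 4 5]]]]])
  then show "runs (split_cell ;; transfer 1 2 ;; match ;; clear 0 ;;
      Branch 3 None (push_code (code (enc True))) (push_code (code (enc False))) ;; clear 3) s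
      (s(0 := code (enc (fst x = snd x)))) (100 * csize x + 100)"
    by (simp only: x fst_conv snd_conv) (rule runs_mono, assumption, use f_len cs x in simp)
qed (intro poly_bounded_intros)

lemma pt_eq:
  fixes f g :: "'a::encodable \<Rightarrow> 'b::encodable"
  assumes "pt f" "pt g"
  shows "pt (\<lambda>x. f x = g x)"
proof -
  have "pt (\<lambda>p :: 'b \<times> 'b. fst p = snd p)"
    by (rule pt_recode[where h = "\<lambda>p. (enc (fst p), enc (snd p))", OF pt_data_eq])
      (auto simp: enc_prod_def enc_data_def enc_bool_def split: if_splits dest: enc_inject)
  from pt_comp[OF this pt_Pair[OF assms]] show ?thesis by simp
qed


subsection \<open>Iteration over lists\<close>

text \<open>Loops can only test whether a stack is empty. This one-bit stack tells them whether the
  list in the first component of a pair is nonempty, which shows in the bit after the constructor of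
  the pair.\<close>

definition list_flag :: "nat \<Rightarrow> com" where
  "list_flag k = Pop 0 ;; Branch 0 (Some True) (Push k True) Skip ;; Push 0 True"

lemma runs_list_flag:
  assumes "s 0 = code (enc (l, b))" "k > 0" "s k = []"
    "s' = s(k := if l = [] then [] else [True])"
  shows "runs (list_flag k) s s' 7"
proof -
  let ?l = "code (enc l) @ code (enc b)"
  have 1: "runs (Pop 0) s (s(0 := ?l)) 1"
    by (rule runs_Pop) (simp add: assms enc_prod_def)
  have "peek ?l = Some True \<longleftrightarrow> l \<noteq> []"
    by (cases l) auto
  then have 2: "runs (Branch 0 (Some True) (Push k True) Skip) (s(0 := ?l)) (s'(0 := ?l)) (2 + 2)"
  proof (intro runs_Branch)
    assume "peek ((s(0 := ?l)) 0) \<noteq> Some True"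
    then have "s' = s"
      using assms \<open>peek ?l = Some True \<longleftrightarrow> l \<noteq> []\<close> by (auto simp: fun_eq_iff)
    then show "runs Skip (s(0 := ?l)) (s'(0 := ?l)) 2"
      using runs_mono[OF runs_Skip] by blast
  qed (rule runs_Push, use assms in \<open>auto simp: fun_eq_iff\<close>)
  have 3: "runs (Push 0 True) (s'(0 := ?l)) s' 2"
    by (rule runs_Push) (use assms in \<open>auto simp: enc_prod_def fun_eq_iff\<close>)
  show ?thesis
    unfolding list_flag_def by (rule runs_mono[OF runs_Seq[OF 1 runs_Seq[OF 2 3]]]) simp
qed

text \<open>The time is the number of rounds times the time of \<open>step\<close> on the largest
  state. Polynomial time of \<open>step\<close> alone does not control the growth of the state,
  hence the assumption \<open>bound\<close>.\<close>

lemma pt_iterate: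
  fixes init :: "'e::encodable \<Rightarrow> 'a::encodable list \<times> 'b::encodable"
    and step :: "'a list \<times> 'b \<Rightarrow> 'a list \<times> 'b"
  assumes "pt step" "pt init" "\<And>l b. l \<noteq> [] \<Longrightarrow> fst (step (l, b)) = tl l"
    and bound: "\<And>e i. i \<le> length (fst (init e)) \<Longrightarrow> csize ((step ^^ i) (init e)) \<le> poly q (csize e)"
  shows "pt (\<lambda>e. (step ^^ length (fst (init e))) (init e))"
proof -
  obtain c k p where c: "\<And>x s m. s 0 = code (enc x) \<Longrightarrow> empty_below k s \<Longrightarrow> csize x \<le> m \<Longrightarrow>
      runs c s (s(0 := code (enc (step x)))) (poly p m)"
    by (rule ptE[OF assms(1)]) blast
  obtain d l r where d: "\<And>x s m. s 0 = code (enc x) \<Longrightarrow> empty_below l s \<Longrightarrow> csize x \<le> m \<Longrightarrow>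
      runs d s (s(0 := code (enc (init x)))) (poly r m)"
    by (rule ptE[OF assms(2)]) blast
  define K where "K = Suc (max k l)"
  let ?loop = "Loop K (Pop K ;; c ;; list_flag K)"
  have loop: "runs ?loop s (s(0 := code (enc ((step ^^ length (fst x)) x)), K := [])) (length (fst x) * (poly p m + 10) + 1)"
    if "s 0 = code (enc x)" "s K = (if fst x = [] then [] else [True])" "empty_below K s"
      "\<And>i. i \<le> length (fst x) \<Longrightarrow> csize ((step ^^ i) x) \<le> m" for s x m
    using that
  proof (induction "length (fst x)" arbitrary: s x)
    case 0
    have eq: "s(0 := code (enc ((step ^^ length (fst x)) x)), K := []) = s"
      unfolding 0(1)[symmetric] using 0 by (auto simp: fun_eq_iff)
    have "s K = []" using 0 by simp
    from runs_Loop_end[of s K, OF this] show ?case unfolding eq by (rule runs_mono) simp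
  next
    case (Suc n)
    obtain as b where x: "x = (as, b)" by (cases x)
    have as: "as \<noteq> []" using Suc.hyps(2) x by auto
    then have n: "n = length (fst (step x))"
      using Suc.hyps(2) assms(3)[of as b] by (simp add: x)
    have K: "K > 0" by (simp add: K_def)
    have 1: "runs (Pop K) s (s(K := [])) 1"
      by (rule runs_Pop) (simp add: Suc.prems(2) x as)
    have "runs c (s(K := [])) (s(K := [], 0 := code (enc (step x)))) (poly p m)"
      using Suc.prems(4)[of 0] Suc.prems(1,3)
      by (intro c) (auto simp: empty_below_def K_def)
    note 2 = this
    obtain as' b' where step_x: "step x = (as', b')" by (cases "step x")
    let ?s = "s(0 := code (enc (step x)), K := if fst (step x) = [] then [] else [True])"
    have 3: "runs (list_flag K) (s(K := [], 0 := code (enc (step x)))) ?s 7"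
      by (rule runs_list_flag[where l = as' and b = b']) (use K in \<open>auto simp: fun_eq_iff step_x\<close>)
    have bnd: "csize ((step ^^ i) (step x)) \<le> m" if "i \<le> length (fst (step x))" for i
      using Suc.prems(4)[of "Suc i"] that Suc.hyps(2) n
      by (simp add: funpow_swap1 del: funpow.simps(2)) (simp add: funpow_swap1)
    have "runs ?loop ?s (?s(0 := code (enc ((step ^^ length (fst (step x))) (step x))), K := []))
        (length (fst (step x)) * (poly p m + 10) + 1)"
      using Suc.prems(3) K by (intro Suc.hyps(1)[OF n] bnd) (auto simp: empty_below_def)
    moreover have "?s(0 := code (enc ((step ^^ length (fst (step x))) (step x))), K := []) =
        s(0 := code (enc ((step ^^ length (fst x)) x)), K := [])"
      unfolding n[symmetric] Suc.hyps(2)[symmetric] by (auto simp: fun_eq_iff funpow_swap1)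
    ultimately have 4: "runs ?loop ?s (s(0 := code (enc ((step ^^ length (fst x)) x)), K := []))
        (n * (poly p m + 10) + 1)"
      by (simp only: n)
    have "runs ?loop s (s(0 := code (enc ((step ^^ length (fst x)) x)), K := []))
        (1 + (poly p m + 7) + (n * (poly p m + 10) + 1) + 2)"
      by (rule runs_Loop_step[OF _ runs_Seq[OF 1 runs_Seq[OF 2 3]] 4]) (simp add: Suc.prems(2) x as)
    then show ?case
      by (rule runs_mono) (simp add: Suc.hyps(2)[symmetric])
  qed
  define T where "T n = poly r n + (7 + (poly q n * (poly p (poly q n) + 10) + 1))" for n
  show ?thesis
  proof (rule ptI)
    fix e :: 'e and s :: store
    assume s: "s 0 = code (enc e)" "empty_below (K + 1) s"
    have K: "K > 0" "s K = []"
      using s(2) by (auto simp: empty_below_def K_def)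
    let ?x = "init e"
    obtain as b where x: "?x = (as, b)" by (cases ?x)
    have 1: "runs d s (s(0 := code (enc ?x))) (poly r (csize e))"
      by (rule d) (use s in \<open>auto simp: K_def intro: empty_below_mono\<close>)
    let ?s = "s(0 := code (enc ?x), K := if fst ?x = [] then [] else [True])"
    have 2: "runs (list_flag K) (s(0 := code (enc ?x))) ?s 7"
      by (rule runs_list_flag[where l = as and b = b]) (use K in \<open>auto simp: fun_eq_iff x\<close>)
    have 3: "runs ?loop ?s (?s(0 := code (enc ((step ^^ length (fst ?x)) ?x)), K := []))
        (length (fst ?x) * (poly p (poly q (csize e)) + 10) + 1)"
      by (rule loop) (use K s bound in \<open>auto simp: empty_below_def\<close>)
    have "?s(0 := code (enc ((step ^^ length (fst ?x)) ?x)), K := []) =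
        s(0 := code (enc ((step ^^ length (fst ?x)) ?x)))"
      using K by (auto simp: fun_eq_iff)
    note 4 = runs_Seq[OF 1 runs_Seq[OF 2 3[unfolded this]]]
    \<comment> \<open>The initial state contains the list, so the size bound for
      \<open>i = 0\<close> also limits the number of rounds.\<close>
    have "length (fst ?x) \<le> poly q (csize e)"
      using bound[of 0 e] length_le_csize[of as] by (simp add: x)
    then show "runs (d ;; list_flag K ;; ?loop) s (s(0 := code (enc ((step ^^ length (fst ?x)) ?x)))) (T (csize e))"
      unfolding T_def by (intro runs_mono[OF 4] add_mono mult_right_mono) simp_all
  qed (unfold T_def, intro poly_bounded_intros poly_bounded_comp[of "poly p" "poly q"])
qed

text \<open>\<open>hd []\<close> is an unspecified but fixed value, so a program can output it as a
  constant.\<close>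

lemma pt_hd: "pt (hd :: 'a::encodable list \<Rightarrow> 'a)"
proof -
  have "pt (\<lambda>l :: 'a list. if l = [] then enc (hd ([] :: 'a list)) else car (enc l))"
    by (intro pt_If pt_eq pt_id pt_const pt_comp[of car, OF pt_car] pt_enc)
  then show ?thesis
  proof (rule pt_recode[where h = "\<lambda>l. l"])
    show "enc (hd l) = enc (if l = [] then enc (hd ([] :: 'a list)) else car (enc l))" for l :: "'a list"
      by (cases l) (auto simp: enc_data_def)
  qed simp
qed

text \<open>The iterated state consists of the unread part of the list, the parameter
  \<open>e\<close> and the accumulator; only the accumulator can grow.\<close>

theorem pt_foldl:
  fixes f :: "'e::encodable \<Rightarrow> 's::encodable \<Rightarrow> 'a::encodable \<Rightarrow> 's"
  assumes "pt (\<lambda>(e, s, a). f e s a)" "pt init" "pt l"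
    and bound: "\<And>e i. csize (foldl (f e) (init e) (take i (l e))) \<le> B (csize e)" "poly_bounded B"
  shows "pt (\<lambda>e. foldl (f e) (init e) (l e))"
proof -
  define step where "step = (\<lambda>x :: 'a list \<times> 'e \<times> 's.
    (tl (fst x), fst (snd x), f (fst (snd x)) (snd (snd x)) (hd (fst x))))"
  have "pt (\<lambda>x :: 'a list \<times> 'e \<times> 's. (\<lambda>(e, s, a). f e s a) (fst (snd x), snd (snd x), hd (fst x)))"
    by (intro pt_comp[OF assms(1)] pt_Pair pt_comp[OF pt_fst] pt_comp[OF pt_snd] pt_comp[OF pt_hd] pt_fst pt_snd)
  then have 1: "pt step"
    unfolding step_def by (intro pt_Pair pt_comp[OF pt_tl] pt_comp[OF pt_fst] pt_fst pt_snd) simp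
  have 2: "pt (\<lambda>e. (l e, e, init e))"
    by (intro pt_Pair assms pt_id)
  have iter: "(step ^^ i) (as, e, s) = (drop i as, e, foldl (f e) s (take i as))" if "i \<le> length as" for i as e s
    using that
  proof (induction i arbitrary: as s)
    case (Suc i)
    from Suc.prems obtain a as' where as: "as = a # as'" by (cases as) auto
    have "step (as, e, s) = (as', e, f e s a)"
      by (simp add: as step_def)
    then show ?case using Suc.IH[of as' "f e s a"] Suc.prems
      by (simp only: funpow_Suc_right comp_apply as) simp
  qed simp
  obtain q :: "nat poly" where q: "\<And>x m. csize x \<le> m \<Longrightarrow> csize (l x) \<le> poly q m"
    by (rule pt_csize[OF assms(3)]) blast
  obtain b :: "nat poly" where b: "\<forall>n. B n \<le> poly b n"
    using bound(2) unfolding poly_bounded_def by (elim exE)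
  have drop: "csize (drop i as) \<le> csize as" for i and as :: "'a list"
  proof (induction as arbitrary: i)
    case (Cons a as)
    from Cons[of "i - 1"] show ?case by (cases i) auto
  qed simp
  have "pt (\<lambda>e. (step ^^ length (fst (l e, e, init e))) (l e, e, init e))"
  proof (rule pt_iterate[OF 1 2])
    fix e i
    assume "i \<le> length (fst (l e, e, init e))"
    then have "(step ^^ i) (l e, e, init e) = (drop i (l e), e, foldl (f e) (init e) (take i (l e)))"
      using iter by simp
    moreover have "csize (foldl (f e) (init e) (take i (l e))) \<le> poly b (csize e)"
      using bound(1) spec[OF b] by (rule le_trans)
    moreover have "csize (drop i (l e)) \<le> poly q (csize e)"
      using drop q[of e "csize e"] le_trans by blast
    ultimately show "csize ((step ^^ i) (l e, e, init e)) \<le> poly (q + b + [:2, 1:]) (csize e)"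
      by simp
  qed (simp add: step_def)
  then have "pt (\<lambda>e. snd (snd ((step ^^ length (l e)) (l e, e, init e))))"
    by (intro pt_comp[OF pt_snd]) simp
  then show ?thesis by (simp add: iter)
qed


subsection \<open>From polynomial-time functions to the class P\<close>

text \<open>The input word becomes the tree of a \<open>bool list\<close>. It is reversed first, so
  that the list can be built from its end; each pushed block is the tag of a cell followed by the
  code of one truth value.\<close>

definition encode_input :: com where
  "encode_input = transfer 0 1 ;; Push 0 False ;;
     Loop 1 (Branch 1 (Some True) (push_code [True, True, False, False]) (push_code [True, False]) ;; Pop 1)"

lemma runs_encode_input:
  assumes "s 0 = l" "s 1 = []" "s' = s(0 := code (enc l))"
  shows "runs encode_input s s' (20 * length l + 10)"
proof -
  let ?loop = "Loop 1 (Branch 1 (Some True) (push_code [True, True, False, False]) (push_code [True, False]) ;; Pop 1)"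
  have loop: "runs ?loop s (s(0 := code (enc (rev r @ m)), 1 := [])) (13 * length r + 1)"
    if "s 1 = r" "s 0 = code (enc m)" for s r m
    using that
  proof (induction r arbitrary: s m)
    case Nil
    have eq: "s(0 := code (enc (rev [] @ m)), 1 := []) = s"
      using Nil by (auto simp: fun_eq_iff)
    show ?case using runs_Loop_end[of s 1, OF Nil(1)] unfolding eq by simp
  next
    case (Cons b r)
    let ?s = "s(0 := code (enc (b # m)))"
    have 1: "runs (Branch 1 (Some True) (push_code [True, True, False, False]) (push_code [True, False])) s ?s (8 + 2)"
      using Cons.prems
      by (intro runs_Branch runs_mono[OF runs_push_code]) (auto simp: fun_eq_iff enc_bool_def)
    have 2: "runs (Pop 1) ?s (?s(1 := r)) 1"
      by (rule runs_Pop) (use Cons.prems in \<open>auto simp: fun_eq_iff\<close>)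
    have 3: "runs ?loop (?s(1 := r)) (?s(1 := r, 0 := code (enc (rev r @ (b # m))), 1 := [])) (13 * length r + 1)"
      by (rule Cons.IH) simp_all
    have eq: "?s(1 := r, 0 := code (enc (rev r @ (b # m))), 1 := []) = s(0 := code (enc (rev (b # r) @ m)), 1 := [])"
      by (auto simp: fun_eq_iff)
    have "runs ?loop s (s(0 := code (enc (rev (b # r) @ m)), 1 := [])) (8 + 2 + 1 + (13 * length r + 1) + 2)"
      by (rule runs_Loop_step[OF _ runs_Seq[OF 1 2] 3[unfolded eq]]) (use Cons.prems in simp)
    then show ?case by (rule runs_mono) simp
  qed
  have 1: "runs (transfer 0 1) s (s(0 := [], 1 := rev l)) (7 * length l + 1)"
    by (rule runs_transfer) (use assms in auto)
  have 2: "runs (Push 0 False) (s(0 := [], 1 := rev l)) (s(0 := code (enc ([] :: bool list)), 1 := rev l)) 2"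
    by (rule runs_Push) (auto simp: fun_eq_iff)
  have 3: "runs ?loop (s(0 := code (enc ([] :: bool list)), 1 := rev l))
      (s(0 := code (enc ([] :: bool list)), 1 := rev l, 0 := code (enc (rev (rev l) @ [])), 1 := [])) (13 * length (rev l) + 1)"
    by (rule loop) simp_all
  have eq: "s(0 := code (enc ([] :: bool list)), 1 := rev l, 0 := code (enc (rev (rev l) @ [])), 1 := []) = s'"
    using assms by (auto simp: fun_eq_iff)
  show ?thesis
    unfolding encode_input_def
    by (rule runs_mono[OF runs_Seq[OF 1 runs_Seq[OF 2 3[unfolded eq]]]]) simp
qed

lemma csize_bool: "csize (b :: bool) \<le> 3"
  by (simp add: csize_def enc_bool_def)

theorem pt_class_P:
  fixes f :: "bool list \<Rightarrow> bool"
  assumes "pt f"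
  shows "{x. f x} \<in> class_P"
proof -
  obtain c k p where c: "\<And>x s m. s 0 = code (enc x) \<Longrightarrow> empty_below k s \<Longrightarrow> csize x \<le> m \<Longrightarrow>
      runs c s (s(0 := code (enc (f x)))) (poly p m)"
    by (rule ptE[OF assms]) blast
  \<comment> \<open>A list cell takes one bit and a truth value at most three.\<close>
  have len: "csize x \<le> 4 * length x + 1" for x :: "bool list"
  proof (induction x)
    case (Cons b x)
    then show ?case using csize_bool[of b] by simp
  qed simp
  have run: "\<exists>t s'. exec (encode_input ;; c) ((\<lambda>_. [])(0 := x)) t s' \<and>
      t \<le> poly ([:10, 20:] + pcompose p [:1, 4:]) (length x) \<and> (peek (s' 0) = Some True \<longleftrightarrow> x \<in> {x. f x})" for x
  proof -
    let ?s = "(\<lambda>_. [])(0 := code (enc x))"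
    have 1: "runs encode_input ((\<lambda>_. [])(0 := x)) ?s (20 * length x + 10)"
      by (rule runs_encode_input) (auto simp: fun_eq_iff)
    have 2: "runs c ?s (?s(0 := code (enc (f x)))) (poly p (4 * length x + 1))"
      by (rule c) (use len[of x] in \<open>simp_all add: empty_below_def\<close>)
    obtain t where t: "t \<le> 20 * length x + 10 + poly p (4 * length x + 1)"
        "exec (encode_input ;; c) ((\<lambda>_. [])(0 := x)) t (?s(0 := code (enc (f x))))"
      using runs_Seq[OF 1 2] unfolding runs_def by (elim exE conjE)
    have "poly ([:10, 20:] + pcompose p [:1, 4:]) (length x) = 20 * length x + 10 + poly p (4 * length x + 1)"
      by (simp add: poly_pcompose algebra_simps)
    then show ?thesis
      using t peek_bool[of "f x"] by (intro exI[of _ t] exI[of _ "?s(0 := code (enc (f x)))"]) simp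
  qed
  show ?thesis by (rule exec_class_P[OF run])
qed

section \<open>Boolean connectives and functions on lists\<close>

lemma pt_comp2:
  assumes "pt (\<lambda>p. h (fst p) (snd p))" "pt f" "pt g"
  shows "pt (\<lambda>x. h (f x) (g x))"
  using pt_comp[OF assms(1) pt_Pair[OF assms(2,3)]] by simp

lemma pt_cong: "pt f \<Longrightarrow> (\<And>x. g x = f x) \<Longrightarrow> pt g"
  by presburger

lemma pt_not: "pt P \<Longrightarrow> pt (\<lambda>x. \<not> P x)"
  by (rule pt_cong[OF pt_If[OF _ pt_const[of False] pt_const[of True]]]) auto

lemma pt_conj: "pt P \<Longrightarrow> pt Q \<Longrightarrow> pt (\<lambda>x. P x \<and> Q x)"
  by (rule pt_cong[OF pt_If[OF _ _ pt_const[of False], of P Q]]) auto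

lemma pt_disj: "pt P \<Longrightarrow> pt Q \<Longrightarrow> pt (\<lambda>x. P x \<or> Q x)"
  by (rule pt_cong[OF pt_If[OF _ pt_const[of True], of P Q]]) auto

lemma pt_Cons: "pt f \<Longrightarrow> pt g \<Longrightarrow> pt (\<lambda>x. f x # g x)"
  by (rule pt_comp2[OF pt_Cons'])

lemmas pt_basic = pt_const pt_id pt_Pair pt_If pt_eq pt_not pt_conj pt_disj pt_Cons
  pt_comp[OF pt_fst] pt_comp[OF pt_snd] pt_comp[OF pt_hd] pt_comp[OF pt_tl]

lemma poly_bounded_poly_comp: "poly_bounded g \<Longrightarrow> poly_bounded (\<lambda>n. poly p (g n))"
  by (rule poly_bounded_comp[OF poly_bounded_poly])

lemma csize_list: "csize l = 1 + sum_list (map (\<lambda>a. 1 + csize a) l)"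
  by (induction l) auto

lemma csize_append: "csize (k @ l) = csize k + csize l - 1"
  by (simp add: csize_list)

lemma csize_rev [simp]: "csize (rev l) = csize l"
  by (induction l) (auto simp: csize_append)

lemma csize_member: "a \<in> set l \<Longrightarrow> csize a \<le> csize l"
  by (induction l) auto

lemma csize_take: "csize (take i l) \<le> csize l"
proof (induction l arbitrary: i)
  case (Cons a l)
  from Cons[of "i - 1"] show ?case by (cases i) auto
qed simp

lemma csize_list_le:
  assumes "\<And>a. a \<in> set l \<Longrightarrow> csize a \<le> m"
  shows "csize l \<le> 1 + length l * (1 + m)"
  using assms by (induction l) force+

text \<open>The bound is required for every list, hence in particular for all prefixes of the list
  that is traversed.\<close>

lemma pt_foldl_env:
  fixes f :: "'e::encodable \<Rightarrow> 's::encodable \<Rightarrow> 'a::encodable \<Rightarrow> 's" and env :: "'x::encodable \<Rightarrow> 'e"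
  assumes body: "pt (\<lambda>x. f (fst x) (fst (snd x)) (snd (snd x)))" and init: "pt init"
    and bound: "\<And>e l. csize (foldl (f e) (init e) l) \<le> B (csize e + csize l)" "poly_bounded B"
    and args: "pt env" "pt l"
  shows "pt (\<lambda>x. foldl (f (env x)) (init (env x)) (l x))"
proof -
  obtain b :: "nat poly" where b: "\<forall>n. B n \<le> poly b n"
    using bound(2) unfolding poly_bounded_def by (elim exE)
  have "pt (\<lambda>p :: 'e \<times> 'a list. foldl (f (fst p)) (init (fst p)) (snd p))"
  proof (rule pt_foldl)
    have "pt (\<lambda>x :: ('e \<times> 'a list) \<times> 's \<times> 'a. (\<lambda>y. f (fst y) (fst (snd y)) (snd (snd y)))
        (fst (fst x), fst (snd x), snd (snd x)))"
      by (rule pt_comp[OF body]) (intro pt_basic)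
    then show "pt (\<lambda>(p :: 'e \<times> 'a list, s, a). f (fst p) s (a :: 'a))"
      by (simp add: case_prod_beta')
    show "pt (\<lambda>p :: 'e \<times> 'a list. init (fst p))" "pt (\<lambda>p :: 'e \<times> 'a list. snd p)"
      by (intro pt_comp[OF init] pt_basic)+
    show "csize (foldl (f (fst p)) (init (fst p)) (take i (snd p))) \<le> poly b (csize p)"
      for p :: "'e \<times> 'a list" and i
    proof -
      have "csize (fst p) + csize (take i (snd p)) \<le> csize p"
        using csize_take[of i "snd p"] by (cases p) simp
      then show ?thesis
        using bound(1)[of "fst p" "take i (snd p)"] b poly_nat_mono le_trans by meson
    qed
  qed (rule poly_bounded_poly)
  from pt_comp[OF this pt_Pair[OF args]] show ?thesis by simp
qed

text \<open>Serves as environment for folds whose body has no parameters.\<close>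

instantiation unit :: encodable
begin
definition "enc_unit (x :: unit) = Atom"
instance by standard simp
end

lemma foldl_push: "foldl (\<lambda>s a. f a # s) s l = rev (map f l) @ s"
  by (induction l arbitrary: s) auto

lemma pt_rev:
  assumes "pt l"
  shows "pt (\<lambda>x. rev (l x))"
proof -
  have "pt (\<lambda>x. foldl (\<lambda>s a. a # s) [] (l x))"
    by (rule pt_foldl_env[where f = "\<lambda>_ s a. a # s" and init = "\<lambda>_. []" and env = "\<lambda>_. ()"
        and B = "\<lambda>n. n"]) (intro pt_basic poly_bounded_intros assms | simp add: foldl_push[of "\<lambda>a. a"])+
  then show ?thesis by (simp add: foldl_push[of "\<lambda>a. a"])
qed

lemma pt_map:
  fixes f :: "'e::encodable \<Rightarrow> 'a::encodable \<Rightarrow> 'b::encodable"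
  assumes "pt (\<lambda>x. f (fst x) (snd x))" "pt l"
  shows "pt (\<lambda>x. map (f x) (l x))"
proof -
  obtain q :: "nat poly" where q: "\<And>x m. csize x \<le> m \<Longrightarrow> csize (f (fst x) (snd x)) \<le> poly q m"
    by (rule pt_csize[OF assms(1)]) blast
  have "pt (\<lambda>x. foldl (\<lambda>s a. f x a # s) [] (l x))"
  proof (rule pt_foldl_env[where f = "\<lambda>e s a. f e a # s" and init = "\<lambda>_. []" and env = "\<lambda>x. x"])
    have "pt (\<lambda>x :: 'e \<times> 'b list \<times> 'a. (\<lambda>y. f (fst y) (snd y)) (fst x, snd (snd x)))"
      by (rule pt_comp[OF assms(1)]) (intro pt_basic)
    then show "pt (\<lambda>x :: 'e \<times> 'b list \<times> 'a. f (fst x) (snd (snd x)) # fst (snd x))"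
      by (intro pt_basic) simp
    show "csize (foldl (\<lambda>s a. f e a # s) [] k) \<le>
        (\<lambda>n. 1 + n * (1 + poly q (1 + n))) (csize e + csize k)" for e k
    proof -
      have "csize (map (f e) k) \<le> 1 + length (map (f e) k) * (1 + poly q (1 + csize e + csize k))"
      proof (rule csize_list_le)
        fix b assume "b \<in> set (map (f e) k)"
        then obtain a where a: "a \<in> set k" "b = f e a" by auto
        have "csize (e, a) \<le> 1 + csize e + csize k"
          using csize_member[OF a(1)] by simp
        from q[OF this] show "csize b \<le> poly q (1 + csize e + csize k)"
          by (simp add: a)
      qed
      also have "\<dots> \<le> 1 + (csize e + csize k) * (1 + poly q (1 + csize e + csize k))"
        using length_le_csize[of k] by (intro add_mono mult_right_mono) simp_all
      finally show ?thesis by (simp add: foldl_push add.assoc)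
    qed
    show "poly_bounded (\<lambda>n. 1 + n * (1 + poly q (1 + n)))"
      by (intro poly_bounded_intros poly_bounded_poly_comp)
  qed (intro pt_basic assms)+
  from pt_rev[OF this] show ?thesis by (simp add: foldl_push)
qed

lemma foldl_disj: "foldl (\<lambda>s a. s \<or> P a) s l \<longleftrightarrow> s \<or> (\<exists>a\<in>set l. P a)"
  by (induction l arbitrary: s) auto

lemma pt_Bex:
  fixes P :: "'e::encodable \<Rightarrow> 'a::encodable \<Rightarrow> bool"
  assumes "pt (\<lambda>x. P (fst x) (snd x))" "pt l"
  shows "pt (\<lambda>x. \<exists>a\<in>set (l x). P x a)"
proof -
  have "pt (\<lambda>x. foldl (\<lambda>s a. s \<or> P x a) False (l x))"
  proof (rule pt_foldl_env[where f = "\<lambda>e s a. s \<or> P e a" and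
        init = "\<lambda>_. False" and env = "\<lambda>x. x" and B = "\<lambda>n. 3"])
    have "pt (\<lambda>x :: 'e \<times> bool \<times> 'a. (\<lambda>y. P (fst y) (snd y)) (fst x, snd (snd x)))"
      by (rule pt_comp[OF assms(1)]) (intro pt_basic)
    then show "pt (\<lambda>x :: 'e \<times> bool \<times> 'a. fst (snd x) \<or> P (fst x) (snd (snd x)))"
      by (intro pt_basic) simp
  qed (intro pt_basic assms poly_bounded_intros csize_bool)+
  then show ?thesis by (simp add: foldl_disj)
qed

lemma pt_Ball:
  fixes P :: "'e::encodable \<Rightarrow> 'a::encodable \<Rightarrow> bool"
  assumes "pt (\<lambda>x. P (fst x) (snd x))" "pt l"
  shows "pt (\<lambda>x. \<forall>a\<in>set (l x). P x a)"
  using pt_not[OF pt_Bex[OF pt_not[OF assms(1)] assms(2)]] by simp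

lemma pt_append:
  assumes "pt k" "pt l"
  shows "pt (\<lambda>x. k x @ l x)"
proof -
  have "pt (\<lambda>x. foldl (\<lambda>s a. a # s) (l x) (rev (k x)))"
    by (rule pt_foldl_env[where f = "\<lambda>e s a. a # s" and init = "\<lambda>e. e" and env = l and B = "\<lambda>n. n"])
      (intro pt_basic assms poly_bounded_intros pt_rev | simp add: foldl_push[of "\<lambda>a. a"] csize_append)+
  then show ?thesis by (simp add: foldl_push[of "\<lambda>a. a"])
qed

lemma foldl_concat: "foldl (\<lambda>s a. s @ a) s l = s @ concat l"
  by (induction l arbitrary: s) auto

lemma csize_concat: "csize (concat l) \<le> csize l"
  by (induction l) (auto simp: csize_append)

lemma pt_concat:
  assumes "pt l"
  shows "pt (\<lambda>x. concat (l x))"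
proof -
  have "pt (\<lambda>x. foldl (\<lambda>s a. s @ a) [] (l x))"
    by (rule pt_foldl_env[where f = "\<lambda>_ s a. s @ a" and init = "\<lambda>_. []" and env = "\<lambda>_. ()" and B = "\<lambda>n. n"])
      (intro pt_basic assms poly_bounded_intros pt_append trans_le_add2 | simp add: foldl_concat csize_concat trans_le_add2)+
  then show ?thesis by (simp add: foldl_concat)
qed


subsection \<open>Binary numbers\<close>

fun val :: "bool list \<Rightarrow> nat" where
  "val [] = 0"
| "val (b # l) = of_bool b + 2 * val l"

lemma val_bits [simp]: "val (bits n) = n"
proof (induction n rule: less_induct)
  case (less n)
  then show ?case
    by (cases "n = 0") (simp_all add: bits_rec bits_eq_Nil_iff[THEN iffD2])
qed

definition trim :: "bool list \<Rightarrow> bool list" where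
  "trim l = foldr (\<lambda>b l. if b \<or> l \<noteq> [] then b # l else []) l []"

lemma trim_Nil_iff: "trim l = [] \<longleftrightarrow> val l = 0"
  by (induction l) (auto simp: trim_def)

text \<open>\<open>trim\<close> drops the leading zeros, which stand at the end of the list. As a
  number is encoded by its canonical digits, evaluating a digit list amounts to trimming it.\<close>

lemma bits_val: "bits (val l) = trim l"
proof (induction l)
  case Nil
  then show ?case by (simp add: trim_def bits_eq_Nil_iff)
next
  case (Cons b l)
  show ?case
  proof (cases "val (b # l) = 0")
    case True
    then have "bits (val (b # l)) = []" "trim (b # l) = []"
      by (simp_all only: bits_eq_Nil_iff trim_Nil_iff)
    then show ?thesis by (simp only:)
  next
    case False
    then have "trim (b # l) = b # trim l"
      using trim_Nil_iff[of "b # l"] by (auto simp: trim_def split: if_splits)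
    then show ?thesis
      using False Cons by (simp add: bits_rec)
  qed
qed

lemma csize_bool_list: "csize l \<le> 4 * length l + 1" for l :: "bool list"
proof (induction l)
  case (Cons b l)
  then show ?case using csize_bool[of b] by simp
qed simp

lemma length_trim: "length (trim l) \<le> length l"
  by (induction l) (auto simp: trim_def)

lemma pt_bits: "pt n \<Longrightarrow> pt (\<lambda>x. bits (n x))"
  by (rule pt_comp[where f = bits])
    (rule pt_recode[where h = bits and f = "\<lambda>x. x"], simp_all add: pt_id enc_nat_def)

lemma pt_val:
  assumes "pt l"
  shows "pt (\<lambda>x. val (l x))"
proof -
  have "pt (\<lambda>x. foldl (\<lambda>l b. if b \<or> l \<noteq> [] then b # l else []) [] (rev (l x)))"
  proof (rule pt_foldl_env[where f = "\<lambda>_ l b. if b \<or> l \<noteq> [] then b # l else []" and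
        init = "\<lambda>_. []" and env = "\<lambda>_. ()" and B = "\<lambda>n. 4 * n + 1"])
    fix e :: unit and k :: "bool list"
    have "foldl (\<lambda>l b. if b \<or> l \<noteq> [] then b # l else []) [] k = trim (rev k)"
      by (simp add: trim_def foldr_conv_foldl)
    then show "csize (foldl (\<lambda>l b. if b \<or> l \<noteq> [] then b # l else []) [] k) \<le> 4 * (csize e + csize k) + 1"
      using csize_bool_list[of "trim (rev k)"] length_trim[of "rev k"] length_le_csize[of k] by simp
  qed (intro pt_basic assms poly_bounded_intros pt_rev)+
  then have "pt (\<lambda>x. trim (l x))"
    by (simp add: trim_def foldr_conv_foldl)
  then show ?thesis
    by (rule pt_recode[where h = "\<lambda>x. x"]) (simp_all add: enc_nat_def bits_val)
qed

lemma length_bits_mono: "m \<le> n \<Longrightarrow> length (bits m) \<le> length (bits n)"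
proof (induction n arbitrary: m rule: less_induct)
  case (less n)
  show ?case
  proof (cases "m = 0")
    case True
    then show ?thesis by (simp add: bits_eq_Nil_iff[THEN iffD2])
  next
    case False
    then show ?thesis
      using less.IH[of "n div 2" "m div 2"] less.prems by (simp add: bits_rec div_le_mono)
  qed
qed

lemma length_bits_le: "length (bits n) \<le> n"
proof (induction n rule: less_induct)
  case (less n)
  show ?case
  proof (cases "n = 0")
    case False
    then show ?thesis using less[of "n div 2"] by (simp add: bits_rec)
  qed (simp add: bits_eq_Nil_iff[THEN iffD2])
qed

lemma csize_nat_le: "csize n \<le> 4 * n + 1" for n :: nat
  using csize_bool_list[of "bits n"] length_bits_le[of n] by (simp add: csize_nat)

text \<open>\<open>csize\<close> is not monotone on numbers, because the digit 1 has a longer code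
  than 0: \<open>csize 7\<close> is 13 and \<open>csize 8\<close> is 11. Digit counts are monotone,
  and the factor 4 bridges the difference.\<close>

lemma csize_nat_mono:
  fixes m n :: nat
  assumes "m \<le> n"
  shows "csize m \<le> 4 * csize n + 1"
  using csize_bool_list[of "bits m"] length_bits_mono[OF assms] length_le_csize[of "bits n"]
  by (simp add: csize_nat)

text \<open>Both operations run through the digits of the two numbers in parallel; the concatenation of
  the digit lists only serves as a clock that ticks often enough.\<close>

definition lowest :: "bool list \<Rightarrow> bool" where
  "lowest l \<longleftrightarrow> l \<noteq> [] \<and> hd l"

lemma lowest_odd: "lowest l \<longleftrightarrow> odd (val l)"
  by (cases l) (auto simp: lowest_def)

lemma val_tl: "val (tl l) = val l div 2"
  by (cases l) auto

lemma pt_lowest: "pt l \<Longrightarrow> pt (\<lambda>x. lowest (l x))"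
  unfolding lowest_def by (intro pt_basic)

lemma val_less: "val l < 2 ^ length l"
  by (induction l) auto

lemma less_power_mult: "a < 2 ^ i \<Longrightarrow> a < 2 ^ i * 2 ^ j" for a :: nat
proof -
  have "(1 :: nat) \<le> 2 ^ j" by simp
  then have "(2 :: nat) ^ i * 1 \<le> 2 ^ i * 2 ^ j" by (rule mult_le_mono2)
  then show "a < 2 ^ i \<Longrightarrow> a < 2 ^ i * 2 ^ j" by linarith
qed

lemma csize_tl: "csize (tl l) \<le> csize l"
  by (cases l) auto

lemma div_power_Suc: "n div 2 ^ Suc i = n div 2 ^ i div 2" for n :: nat
  by (simp add: div_mult2_eq[symmetric] mult.commute)

definition le_step :: "bool \<times> bool list \<times> bool list \<Rightarrow> bool \<Rightarrow> bool \<times> bool list \<times> bool list" where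
  "le_step s b = (if lowest (fst (snd s)) = lowest (snd (snd s)) then fst s else lowest (snd (snd s)),
     tl (fst (snd s)), tl (snd (snd s)))"

lemma le_leading_digit:
  fixes a b p :: nat
  assumes "a < p" "b < p"
  shows "(if P \<longleftrightarrow> Q then a \<le> b else Q) \<longleftrightarrow> a + (if P then p else 0) \<le> b + (if Q then p else 0)"
  using assms by auto

text \<open>Invariant: after \<open>i\<close> digits the flag compares the numbers modulo
  \<open>2 ^ i\<close>. A further digit is more significant than all earlier ones and overrides the
  flag unless both numbers have the same digit there.\<close>

lemma foldl_le_step:
  fixes m n :: nat
  assumes "val k = m" "val l = n"
  shows "\<exists>r k' l'. foldl le_step (True, k, l) c = (r, k', l') \<and> val k' = m div 2 ^ length c \<and>
    val l' = n div 2 ^ length c \<and> (r \<longleftrightarrow> m mod 2 ^ length c \<le> n mod 2 ^ length c) \<and>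
    csize k' \<le> csize k \<and> csize l' \<le> csize l"
proof (induction c rule: rev_induct)
  case Nil
  show ?case by (intro exI[of _ True] exI[of _ k] exI[of _ l]) (simp add: assms)
next
  case (snoc b c)
  let ?i = "length c"
  obtain r k' l' where IH: "foldl le_step (True, k, l) c = (r, k', l')" "val k' = m div 2 ^ ?i"
      "val l' = n div 2 ^ ?i" "r \<longleftrightarrow> m mod 2 ^ ?i \<le> n mod 2 ^ ?i"
      "csize k' \<le> csize k" "csize l' \<le> csize l"
    using snoc by blast
  have mod: "j mod 2 ^ Suc ?i = j mod 2 ^ ?i + (if odd (j div 2 ^ ?i) then 2 ^ ?i else 0)" for j :: nat
    using mod_mult2_eq[of j "2 ^ ?i" 2] by (auto simp: mult.commute odd_iff_mod_2_eq_one)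
  have "m mod 2 ^ ?i < 2 ^ ?i" "n mod 2 ^ ?i < 2 ^ ?i" by simp_all
  then have "(if lowest k' = lowest l' then r else lowest l') \<longleftrightarrow> m mod 2 ^ Suc ?i \<le> n mod 2 ^ Suc ?i"
    unfolding mod lowest_odd IH by (rule le_leading_digit)
  moreover have "foldl le_step (True, k, l) (c @ [b]) =
      (if lowest k' = lowest l' then r else lowest l', tl k', tl l')"
    by (simp add: IH(1) le_step_def)
  moreover have "csize (tl k') \<le> csize k" "csize (tl l') \<le> csize l"
    using csize_tl[of k'] csize_tl[of l'] IH(5,6) by simp_all
  moreover have "val (tl k') = m div 2 ^ Suc ?i" "val (tl l') = n div 2 ^ Suc ?i"
    by (simp_all only: val_tl IH div_power_Suc)
  ultimately show ?case
    unfolding length_append_singleton by blast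
qed

lemma pt_le:
  fixes f g :: "'a::encodable \<Rightarrow> nat"
  assumes "pt f" "pt g"
  shows "pt (\<lambda>x. f x \<le> g x)"
proof -
  let ?s = "\<lambda>x. foldl le_step (True, fst (bits (f x), bits (g x)), snd (bits (f x), bits (g x)))
    (bits (f x) @ bits (g x))"
  have "pt ?s"
  proof (rule pt_foldl_env[where f = "\<lambda>_. le_step" and init = "\<lambda>p. (True, fst p, snd p)" and
        env = "\<lambda>x. (bits (f x), bits (g x))" and B = "\<lambda>n. n + 10"])
    show "pt (\<lambda>x :: (bool list \<times> bool list) \<times> (bool \<times> bool list \<times> bool list) \<times> bool.
        le_step (fst (snd x)) (snd (snd x)))"
      unfolding le_step_def by (intro pt_basic pt_lowest)
    show "csize (foldl le_step (True, fst e, snd e) c) \<le> csize e + csize c + 10" for e c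
    proof -
      obtain k l where e: "e = (k, l)" by (cases e)
      obtain r k' l' where "foldl le_step (True, k, l) c = (r, k', l')"
          "csize k' \<le> csize k" "csize l' \<le> csize l"
        using foldl_le_step[of k "val k" l "val l" c] by blast
      then show ?thesis using csize_bool[of r] by (simp add: e)
    qed
  qed (intro pt_basic assms poly_bounded_intros pt_bits pt_append)+
  from pt_comp[OF pt_fst this] show ?thesis
  proof (rule pt_cong)
    fix x
    let ?k = "bits (f x)" and ?l = "bits (g x)"
    \<comment> \<open>After all ticks of the clock both numbers lie below the power of two reached,
      so reducing them modulo that power changes nothing.\<close>
    have "f x < 2 ^ length ?k * 2 ^ length ?l" "g x < 2 ^ length ?k * 2 ^ length ?l"
      using less_power_mult[of "f x" "length ?k" "length ?l"] val_less[of ?k]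
        less_power_mult[of "g x" "length ?l" "length ?k"] val_less[of ?l] by (simp_all add: mult.commute)
    then show "f x \<le> g x \<longleftrightarrow> fst (?s x)"
      using foldl_le_step[of ?k "f x" ?l "g x" "?k @ ?l"] by (auto simp: power_add)
  qed
qed

text \<open>A full adder: the nested equation is the parity of the two digits and the carry, the
  conditional is their majority.\<close>

definition add_step :: "bool list \<times> bool \<times> bool list \<times> bool list \<Rightarrow> bool \<Rightarrow>
    bool list \<times> bool \<times> bool list \<times> bool list" where
  "add_step s b =
     ((lowest (fst (snd (snd s))) = (lowest (snd (snd (snd s))) = fst (snd s))) # fst s,
      (if lowest (fst (snd (snd s))) = lowest (snd (snd (snd s))) then lowest (fst (snd (snd s))) else fst (snd s)),
      tl (fst (snd (snd s))), tl (snd (snd (snd s))))"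

lemma val_append: "val (k @ l) = val k + 2 ^ length k * val l"
  by (induction k) (auto simp: algebra_simps)

lemma add_with_carry:
  fixes k l c :: nat
  assumes "k = a + 2 * k'" "l = b + 2 * l'" "c + a + b = x + 2 * c'"
  shows "c + k + l = x + 2 * (c' + k' + l')"
  using assms by simp

lemma foldl_add_step:
  fixes m n :: nat
  assumes "val k = m" "val l = n"
  shows "\<exists>r c k' l'. foldl add_step ([], False, k, l) t = (r, c, k', l') \<and> length r = length t \<and>
    val k' = m div 2 ^ length t \<and> val l' = n div 2 ^ length t \<and>
    val (rev r) + 2 ^ length t * (of_bool c + val k' + val l') = m + n \<and>
    csize k' \<le> csize k \<and> csize l' \<le> csize l"
proof (induction t rule: rev_induct)
  case Nil
  show ?case by (intro exI[of _ "[]"] exI[of _ False] exI[of _ k] exI[of _ l]) (simp add: assms)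
next
  case (snoc b t)
  let ?i = "length t"
  obtain r c k' l' where IH: "foldl add_step ([], False, k, l) t = (r, c, k', l')" "length r = ?i"
      "val k' = m div 2 ^ ?i" "val l' = n div 2 ^ ?i"
      "val (rev r) + 2 ^ ?i * (of_bool c + val k' + val l') = m + n"
      "csize k' \<le> csize k" "csize l' \<le> csize l"
    using snoc by blast
  let ?b = "lowest k' = (lowest l' = c)" and ?c = "if lowest k' = lowest l' then lowest k' else c"
  have "val k' = of_bool (lowest k') + 2 * (val k' div 2)" "val l' = of_bool (lowest l') + 2 * (val l' div 2)"
    by (simp_all add: lowest_odd)
  moreover have "of_bool c + of_bool (lowest k') + of_bool (lowest l') = of_bool ?b + 2 * (of_bool ?c :: nat)"
    by auto
  ultimately have "of_bool c + val k' + val l' = of_bool ?b + 2 * (of_bool ?c + val k' div 2 + val l' div 2)"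
    by (rule add_with_carry)
  then have "val (rev (?b # r)) + 2 ^ Suc ?i * (of_bool ?c + val (tl k') + val (tl l')) = m + n"
    unfolding IH(5)[symmetric] by (simp add: val_append IH(2) val_tl algebra_simps)
  moreover have "foldl add_step ([], False, k, l) (t @ [b]) = (?b # r, ?c, tl k', tl l')"
    by (simp add: IH(1) add_step_def)
  moreover have "csize (tl k') \<le> csize k" "csize (tl l') \<le> csize l"
    using csize_tl[of k'] csize_tl[of l'] IH(6,7) by simp_all
  moreover have "val (tl k') = m div 2 ^ Suc ?i" "val (tl l') = n div 2 ^ Suc ?i"
    by (simp_all only: val_tl IH div_power_Suc)
  moreover have "length (?b # r) = Suc ?i"
    by (simp add: IH(2))
  ultimately show ?case
    unfolding length_append_singleton by blast
qed

lemma pt_add: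
  fixes f g :: "'a::encodable \<Rightarrow> nat"
  assumes "pt f" "pt g"
  shows "pt (\<lambda>x. f x + g x)"
proof -
  let ?s = "\<lambda>x. foldl add_step ([], False, fst (bits (f x), bits (g x)), snd (bits (f x), bits (g x)))
    (bits (f x) @ bits (g x))"
  have "pt ?s"
  proof (rule pt_foldl_env[where f = "\<lambda>_. add_step" and init = "\<lambda>p. ([], False, fst p, snd p)" and
        env = "\<lambda>x. (bits (f x), bits (g x))" and B = "\<lambda>n. 5 * n + 10"])
    show "pt (\<lambda>x :: (bool list \<times> bool list) \<times> (bool list \<times> bool \<times> bool list \<times> bool list) \<times> bool.
        add_step (fst (snd x)) (snd (snd x)))"
      unfolding add_step_def by (intro pt_basic pt_lowest)
    show "csize (foldl add_step ([], False, fst e, snd e) t) \<le> 5 * (csize e + csize t) + 10" for e t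
    proof -
      obtain k l where e: "e = (k, l)" by (cases e)
      obtain r c k' l' where "foldl add_step ([], False, k, l) t = (r, c, k', l')"
          "length r = length t" "csize k' \<le> csize k" "csize l' \<le> csize l"
        using foldl_add_step[of k "val k" l "val l" t] by blast
      then show ?thesis
        using csize_bool[of c] csize_bool_list[of r] length_le_csize[of t] by (simp add: e)
    qed
  qed (intro pt_basic assms poly_bounded_intros pt_bits pt_append)+
  \<comment> \<open>The digits were collected with the most significant one in front, which is where
    the last carry belongs before the list is reversed.\<close>
  then have "pt (\<lambda>x. val (rev (fst (snd (?s x)) # fst (?s x))))"
    by (intro pt_val pt_rev pt_basic)
  then show ?thesis
  proof (rule pt_cong)
    fix x
    let ?k = "bits (f x)" and ?l = "bits (g x)"
    have "f x < 2 ^ length ?k * 2 ^ length ?l" "g x < 2 ^ length ?k * 2 ^ length ?l"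
      using less_power_mult[of "f x" "length ?k" "length ?l"] val_less[of ?k]
        less_power_mult[of "g x" "length ?l" "length ?k"] val_less[of ?l] by (simp_all add: mult.commute)
    moreover obtain r c k' l' where "?s x = (r, c, k', l')" "length r = length (?k @ ?l)"
        "val k' = f x div 2 ^ length (?k @ ?l)" "val l' = g x div 2 ^ length (?k @ ?l)"
        "val (rev r) + 2 ^ length (?k @ ?l) * (of_bool c + val k' + val l') = f x + g x"
      using foldl_add_step[of ?k "f x" ?l "g x" "?k @ ?l"] by auto
    ultimately show "f x + g x = val (rev (fst (snd (?s x)) # fst (?s x)))"
      by (simp add: power_add val_append)
  qed
qed

lemma pt_less:
  fixes f g :: "'a::encodable \<Rightarrow> nat"
  shows "pt f \<Longrightarrow> pt g \<Longrightarrow> pt (\<lambda>x. f x < g x)"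
  using pt_not[OF pt_le[of g f]] by (simp add: not_le)

lemma pt_min:
  fixes f g :: "'a::encodable \<Rightarrow> nat"
  shows "pt f \<Longrightarrow> pt g \<Longrightarrow> pt (\<lambda>x. min (f x) (g x))"
  unfolding min_def by (intro pt_If pt_le)

lemma foldl_Suc: "foldl (\<lambda>n _. n + 1) m l = m + length l"
  by (induction l arbitrary: m) auto

lemma pt_length:
  fixes l :: "'a::encodable \<Rightarrow> 'b::encodable list"
  assumes "pt l"
  shows "pt (\<lambda>x. length (l x))"
proof -
  have "pt (\<lambda>x. foldl (\<lambda>n _. n + 1) (0 :: nat) (l x))"
  proof (rule pt_foldl_env[where f = "\<lambda>_ n _. n + (1 :: nat)" and init = "\<lambda>_. 0" and env = "\<lambda>_. ()" and
        B = "\<lambda>n. 4 * n + 1"])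
    fix e :: unit and k :: "'b list"
    show "csize (foldl (\<lambda>n _. n + 1) (0 :: nat) k) \<le> 4 * (csize e + csize k) + 1"
      using csize_nat_le[of "length k"] length_le_csize[of k] unfolding foldl_Suc by simp
  qed (intro pt_basic assms poly_bounded_intros pt_add)+
  then show ?thesis by (simp only: foldl_Suc add_0)
qed

lemma foldl_upt: "foldl (\<lambda>k _. k @ [length k]) [] l = [0..<length l]"
  by (induction l rule: rev_induct) auto

text \<open>The range is given by a list because \<open>[0..<n]\<close> is exponentially long in the
  binary size of \<open>n\<close>. Each new entry is the length of the result so far.\<close>

lemma pt_upt:
  fixes l :: "'a::encodable \<Rightarrow> 'b::encodable list"
  assumes "pt l"
  shows "pt (\<lambda>x. [0..<length (l x)])"
proof -
  have "pt (\<lambda>x. foldl (\<lambda>k _. k @ [length k]) [] (l x))"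
  proof (rule pt_foldl_env[where f = "\<lambda>_ k _. k @ [length k]" and init = "\<lambda>_. []" and
        env = "\<lambda>_. ()" and B = "\<lambda>n. 1 + n * (1 + (4 * n + 1))"])
    fix e :: unit and k :: "'b list"
    have "csize i \<le> 4 * csize k + 1" if "i \<in> set [0..<length k]" for i
      using csize_nat_le[of i] that length_le_csize[of k] by simp
    then have "csize [0..<length k] \<le> 1 + length k * (1 + (4 * csize k + 1))"
      using csize_list_le[of "[0..<length k]" "4 * csize k + 1"] by simp
    also have "\<dots> \<le> 1 + (csize e + csize k) * (1 + (4 * (csize e + csize k) + 1))"
      using length_le_csize[of k] by (intro add_mono mult_mono) simp_all
    finally show "csize (foldl (\<lambda>k _. k @ [length k]) [] k) \<le>
        1 + (csize e + csize k) * (1 + (4 * (csize e + csize k) + 1))"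
      by (simp only: foldl_upt)
  qed (intro pt_basic assms poly_bounded_intros pt_append pt_length)+
  then show ?thesis by (simp only: foldl_upt)
qed

subsection \<open>Parsing\<close>

text \<open>The parsers are total and never fail: malformed input is recognised by encoding the result
  again and comparing it with the input.\<close>

definition list_step ::
  "(bool list \<Rightarrow> 'a \<times> bool list) \<Rightarrow> bool \<times> 'a list \<times> bool list \<Rightarrow> bool \<Rightarrow> bool \<times> 'a list \<times> bool list" where
  "list_step p s b =
     (if fst s then s
      else if lowest (snd (snd s))
      then (False, fst (p (tl (snd (snd s)))) # fst (snd s), snd (p (tl (snd (snd s)))))
      else (True, fst (snd s), tl (snd (snd s))))"

text \<open>Every round consumes a bit until the terminator is met, so the input itself can serve as
  the clock; the flag makes the remaining rounds idle.\<close>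

definition parse_list :: "(bool list \<Rightarrow> 'a \<times> bool list) \<Rightarrow> bool list \<Rightarrow> 'a list \<times> bool list" where
  "parse_list p x = (rev (fst (snd (foldl (list_step p) (False, [], x) x))),
     snd (snd (foldl (list_step p) (False, [], x) x)))"

lemma list_step_simps [simp]:
  "list_step p (True, l, r) b = (True, l, r)"
  "list_step p (False, l, r) b =
    (if lowest r then (False, fst (p (tl r)) # l, snd (p (tl r))) else (True, l, tl r))"
  by (simp_all add: list_step_def)

lemma foldl_list_step_done: "foldl (list_step p) (True, l, r) c = (True, l, r)"
  by (induction c) simp_all

lemma encode_list_simps [simp]:
  "encode_list f [] = [False]" "encode_list f (a # l) = True # f a @ encode_list f l"
  by (simp_all add: encode_list_def)

lemma foldl_list_step:
  assumes "\<And>a r. a \<in> set l \<Longrightarrow> p (f a @ r) = (a, r)" "length l < length c"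
  shows "foldl (list_step p) (False, k, encode_list f l @ r) c = (True, rev l @ k, r)"
  using assms
proof (induction l arbitrary: k c)
  case Nil
  then obtain b c' where "c = b # c'" by (cases c) auto
  then show ?case by (simp add: lowest_def foldl_list_step_done)
next
  case (Cons a l)
  from Cons.prems(2) obtain b c' where c: "c = b # c'" by (cases c) auto
  have "list_step p (False, k, encode_list f (a # l) @ r) b = (False, a # k, encode_list f l @ r)"
    using Cons.prems(1)[of a] by (simp add: lowest_def)
  then show ?case
    using Cons.IH[of c' "a # k"] Cons.prems c by simp
qed

lemma parse_encode_list:
  assumes "\<And>a r. a \<in> set l \<Longrightarrow> p (f a @ r) = (a, r)"
  shows "parse_list p (encode_list f l @ r) = (l, r)"
proof -
  have "length l < length (encode_list f l @ r)"
    by (induction l) auto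
  from foldl_list_step[OF assms this] show ?thesis
    by (simp add: parse_list_def)
qed

text \<open>Holds for malformed words too, as the size bounds of the folds must.\<close>

definition shrinks :: "(bool list \<Rightarrow> 'a \<times> bool list) \<Rightarrow> bool" where
  "shrinks p \<longleftrightarrow> (\<forall>r. length (snd (p r)) \<le> length r)"

text \<open>Every parsed element stems from some word no longer than the input, so its size is
  bounded through the output bound of the element parser.\<close>

lemma foldl_list_step_size:
  assumes "shrinks p"
  shows "\<exists>b l r. foldl (list_step p) (False, [], x) c = (b, l, r) \<and> length l \<le> length c \<and>
    length r \<le> length x \<and> (\<forall>a\<in>set l. \<exists>r. length r \<le> length x \<and> a = fst (p r))"
proof (induction c rule: rev_induct)
  case Nil
  show ?case by (intro exI[of _ False] exI[of _ "[]"] exI[of _ x]) simp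
next
  case (snoc u c)
  then obtain b l r where IH: "foldl (list_step p) (False, [], x) c = (b, l, r)" "length l \<le> length c"
      "length r \<le> length x" "\<forall>a\<in>set l. \<exists>r. length r \<le> length x \<and> a = fst (p r)"
    by blast
  have tl: "length (tl r) \<le> length x" using IH(3) by simp
  have p: "length (snd (p (tl r))) \<le> length x"
    using assms tl le_trans unfolding shrinks_def by blast
  show ?case
  proof (cases b)
    case False
    then show ?thesis using IH tl p by (auto simp del: length_tl)
  qed (use IH in auto)
qed

lemma shrinks_parse_list:
  assumes "shrinks p"
  shows "shrinks (parse_list p)"
  unfolding shrinks_def
proof
  fix x
  show "length (snd (parse_list p x)) \<le> length x"
    using foldl_list_step_size[OF assms, of x x] by (auto simp: parse_list_def)
qed

lemma pt_parse_list:
  fixes p :: "bool list \<Rightarrow> 'a::encodable \<times> bool list"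
  assumes "pt p" "shrinks p"
  shows "pt (parse_list p)"
proof -
  obtain q :: "nat poly" where q: "\<And>x m. csize x \<le> m \<Longrightarrow> csize (p x) \<le> poly q m"
    by (rule pt_csize[OF assms(1)]) blast
  have "pt (\<lambda>x. foldl (list_step p) (False, [], x) x)"
  proof (rule pt_foldl_env[where f = "\<lambda>_. list_step p" and init = "\<lambda>x. (False, [], x)" and env = "\<lambda>x. x"
        and l = "\<lambda>x. x"])
    show "pt (\<lambda>x :: bool list \<times> (bool \<times> 'a list \<times> bool list) \<times> bool. list_step p (fst (snd x)) (snd (snd x)))"
      unfolding list_step_def by (intro pt_basic pt_lowest pt_comp[OF assms(1)])
    show "csize (foldl (list_step p) (False, [], x) c) \<le>
        (\<lambda>n. 10 + (n * (1 + poly q (4 * n + 1)) + 4 * n)) (csize x + csize c)" for x c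
    proof -
      let ?n = "csize x + csize c"
      obtain b l r where s: "foldl (list_step p) (False, [], x) c = (b, l, r)" "length l \<le> length c"
          "length r \<le> length x" "\<forall>a\<in>set l. \<exists>r. length r \<le> length x \<and> a = fst (p r)"
        using foldl_list_step_size[OF assms(2)] by blast
      have "csize a \<le> poly q (4 * ?n + 1)" if a: "a \<in> set l" for a
      proof -
        obtain r' where r': "length r' \<le> length x" "a = fst (p r')"
          using s(4) a by blast
        have "csize r' \<le> 4 * ?n + 1"
          using csize_bool_list[of r'] r'(1) length_le_csize[of x] by simp
        from q[OF this] show ?thesis
          unfolding r'(2) by (cases "p r'") simp
      qed
      then have "csize l \<le> 1 + length l * (1 + poly q (4 * ?n + 1))"
        by (rule csize_list_le)
      also have "\<dots> \<le> 1 + ?n * (1 + poly q (4 * ?n + 1))"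
        using s(2) length_le_csize[of c] by (intro add_mono mult_right_mono) simp_all
      finally show ?thesis
        using csize_bool[of b] csize_bool_list[of r] s(3) length_le_csize[of x] by (simp add: s(1))
    qed
    show "poly_bounded (\<lambda>n. 10 + (n * (1 + poly q (4 * n + 1)) + 4 * n))"
      by (intro poly_bounded_intros poly_bounded_poly_comp)
  qed (intro pt_basic)+
  then show ?thesis
    unfolding parse_list_def[abs_def] by (intro pt_basic pt_rev)
qed

definition parse_bit :: "bool list \<Rightarrow> bool \<times> bool list" where
  "parse_bit x = (lowest x, tl x)"

definition parse_nat :: "bool list \<Rightarrow> nat \<times> bool list" where
  "parse_nat x = (val (fst (parse_list parse_bit x)), snd (parse_list parse_bit x))"

definition parse_voter :: "bool list \<Rightarrow> (nat list \<times> nat list) \<times> bool list" where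
  "parse_voter x =
     ((fst (parse_list parse_nat x), fst (parse_list parse_nat (snd (parse_list parse_nat x)))),
      snd (parse_list parse_nat (snd (parse_list parse_nat x))))"

text \<open>The first-order counterpart of an instance: candidates, despised candidate, budget, and
  for each voter the ranking with the list of finite prices.\<close>

type_synonym instance_code = "nat \<times> nat \<times> nat \<times> (nat list \<times> nat list) list"

definition parse_instance :: "bool list \<Rightarrow> instance_code" where
  "parse_instance x =
     (fst (parse_nat x),
      fst (parse_nat (snd (parse_nat x))),
      fst (parse_nat (snd (parse_nat (snd (parse_nat x))))),
      fst (parse_list parse_voter (snd (parse_nat (snd (parse_nat (snd (parse_nat x))))))))"

definition encode_voter_code :: "nat list \<times> nat list \<Rightarrow> bool list" where
  "encode_voter_code w = encode_list encode_nat (fst w) @ encode_list encode_nat (snd w)"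

definition encode_code :: "instance_code \<Rightarrow> bool list" where
  "encode_code I = encode_nat (fst I) @ encode_nat (fst (snd I)) @ encode_nat (fst (snd (snd I))) @
     encode_list encode_voter_code (snd (snd (snd I)))"

lemma parse_encode_nat: "parse_nat (encode_nat n @ r) = (n, r)"
proof -
  have "parse_list parse_bit (encode_list (\<lambda>b. [b]) (bits n) @ r) = (bits n, r)"
    by (rule parse_encode_list) (simp add: parse_bit_def lowest_def)
  then show ?thesis by (simp add: parse_nat_def encode_nat_def)
qed

lemma parse_encode_voter: "parse_voter (encode_voter_code w @ r) = (w, r)"
proof -
  have *: "parse_list parse_nat (encode_list encode_nat l @ r) = (l, r)" for l r
    by (rule parse_encode_list) (rule parse_encode_nat)
  show ?thesis by (simp add: parse_voter_def encode_voter_code_def *)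
qed

lemma parse_encode_code: "parse_instance (encode_code I) = I"
proof -
  have *: "parse_list parse_voter (encode_list encode_voter_code l) = (l, [])" for l
    using parse_encode_list[of l parse_voter encode_voter_code "[]"] parse_encode_voter by simp
  show ?thesis by (simp add: parse_instance_def encode_code_def parse_encode_nat *)
qed

lemma shrinks_parse_bit: "shrinks parse_bit"
  by (simp add: shrinks_def parse_bit_def)

lemma shrinks_parse_nat: "shrinks parse_nat"
  using shrinks_parse_list[OF shrinks_parse_bit] by (simp add: shrinks_def parse_nat_def)

lemma shrinks_parse_voter: "shrinks parse_voter"
proof -
  have "length (snd (parse_list parse_nat x)) \<le> length x" for x
    using shrinks_parse_list[OF shrinks_parse_nat] by (simp add: shrinks_def)
  then have "length (snd (parse_list parse_nat (snd (parse_list parse_nat x)))) \<le> length x" for x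
    by (rule le_trans) fact
  then show ?thesis
    by (simp add: shrinks_def parse_voter_def)
qed

lemma pt_parse_nat: "pt parse_nat"
proof -
  have "pt parse_bit"
    unfolding parse_bit_def[abs_def] by (intro pt_basic pt_lowest)
  note p = pt_comp[OF pt_parse_list[OF this shrinks_parse_bit]]
  show ?thesis
    unfolding parse_nat_def[abs_def] by (intro pt_basic pt_val p)
qed

lemma pt_parse_instance: "pt parse_instance"
proof -
  note p = pt_comp[OF pt_parse_list[OF pt_parse_nat shrinks_parse_nat]]
  have "pt parse_voter"
    unfolding parse_voter_def[abs_def] by (intro pt_basic p)
  note v = pt_comp[OF pt_parse_list[OF this shrinks_parse_voter]]
  show ?thesis
    unfolding parse_instance_def[abs_def] by (intro pt_basic v pt_comp[OF pt_parse_nat])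
qed

lemma pt_encode_list:
  assumes "pt f" "pt l"
  shows "pt (\<lambda>x. encode_list f (l x))"
  unfolding encode_list_def by (intro pt_append pt_concat pt_map pt_basic pt_comp[OF assms(1)] assms(2))

lemma pt_encode_nat: "pt n \<Longrightarrow> pt (\<lambda>x. encode_nat (n x))"
  unfolding encode_nat_def by (intro pt_encode_list pt_basic pt_bits)

lemma pt_encode_code: "pt encode_code"
proof -
  have "pt encode_voter_code"
    unfolding encode_voter_code_def[abs_def]
    by (intro pt_append pt_encode_list pt_encode_nat pt_basic)
  then show ?thesis
    unfolding encode_code_def[abs_def]
    by (intro pt_append pt_encode_list pt_encode_nat pt_basic)
qed


subsection \<open>Validity\<close>

lemma foldl_pos: "foldl (\<lambda>s a. if fst s \<or> a = c then (True, snd s) else (False, snd s + 1)) (b, n) v =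
   (b \<or> c \<in> set v, if b then n else n + length (takeWhile (\<lambda>x. x \<noteq> c) v))"
  by (induction v arbitrary: b n) auto

lemma pt_pos:
  fixes v :: "'x::encodable \<Rightarrow> 'c::encodable list"
  assumes "pt v" "pt c"
  shows "pt (\<lambda>x. pos (v x) (c x))"
proof -
  have "pt (\<lambda>x. foldl (\<lambda>s a. if fst s \<or> a = c x then (True, snd s) else (False, snd s + 1)) (False, 1 :: nat) (v x))"
  proof (rule pt_foldl_env[where f = "\<lambda>c s a. if fst s \<or> a = c then (True, snd s) else (False, snd s + (1 :: nat))" and
        init = "\<lambda>_. (False, 1)" and env = c and B = "\<lambda>n. 4 * n + 20"])
    fix e :: 'c and k :: "'c list"
    have len: "length (takeWhile (\<lambda>x. x \<noteq> e) k) \<le> csize k"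
      using length_takeWhile_le length_le_csize le_trans by blast
    show "csize (foldl (\<lambda>s a. if fst s \<or> a = e then (True, snd s) else (False, snd s + (1 :: nat))) (False, 1) k)
        \<le> 4 * (csize e + csize k) + 20"
      unfolding foldl_pos
      using len csize_nat_le[of "1 + length (takeWhile (\<lambda>x. x \<noteq> e) k)"] csize_bool[of "False \<or> e \<in> set k"]
      by (simp only: csize_Pair if_False distrib_left)
  qed (intro pt_basic assms pt_add poly_bounded_intros)+
  then have "pt (\<lambda>x. snd (foldl (\<lambda>s a. if fst s \<or> a = c x then (True, snd s) else (False, snd s + 1)) (False, 1 :: nat) (v x)))"
    by (rule pt_comp[OF pt_snd])
  then show ?thesis
    unfolding foldl_pos by (rule pt_cong) (simp add: pos_def)
qed

lemma foldl_sorted: "foldl (\<lambda>s a. (fst s \<and> snd s \<le> a, a)) (b, n) l =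
   (b \<and> sorted (n # l), last (n # l))" for n :: nat
proof (induction l arbitrary: b n)
  case (Cons a l)
  have "sorted (n # a # l) \<longleftrightarrow> n \<le> a \<and> sorted (a # l)" by auto
  then show ?case using Cons.IH[of "b \<and> n \<le> a" a] by auto
qed simp

lemma pt_sorted:
  fixes l :: "'x::encodable \<Rightarrow> nat list"
  assumes "pt l"
  shows "pt (\<lambda>x. sorted (l x))"
proof -
  have "pt (\<lambda>x. foldl (\<lambda>s a. (fst s \<and> snd s \<le> a, a)) (True, 0 :: nat) (l x))"
  proof (rule pt_foldl_env[where f = "\<lambda>_ s a. (fst s \<and> snd s \<le> a, a)" and init = "\<lambda>_. (True, 0)" and
        env = "\<lambda>_. ()" and B = "\<lambda>n. n + 10"])
    fix e :: unit and k :: "nat list"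
    have "csize (last (0 # k)) \<le> csize (0 # k)"
      by (rule csize_member) simp
    then have "csize (last (0 # k)) \<le> csize k + 2"
      by (simp add: csize_nat bits_eq_Nil_iff[THEN iffD2])
    then show "csize (foldl (\<lambda>s a. (fst s \<and> snd s \<le> a, a)) (True, 0) k) \<le> csize e + csize k + 10"
      unfolding foldl_sorted using csize_bool[of "True \<and> sorted (0 # k)"] by (simp only: csize_Pair)
  qed (intro pt_basic assms pt_le poly_bounded_intros)+
  from pt_comp[OF pt_fst this] show ?thesis
    unfolding foldl_sorted by (rule pt_cong) simp
qed

text \<open>The price list may be shorter than the number of possible shifts, since prices may
  become infinite early; hence an inequality for its length. It is written with sums to avoid
  subtraction.\<close>

definition valid_voter :: "nat \<Rightarrow> nat \<Rightarrow> nat list \<times> nat list \<Rightarrow> bool" where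
  "valid_voter m d w \<longleftrightarrow> length (fst w) = m \<and> (\<forall>k\<in>set [0..<length (fst w)]. \<exists>a\<in>set (fst w). a = k) \<and>
     snd w \<noteq> [] \<and> hd (snd w) = 0 \<and> sorted (snd w) \<and> length (snd w) + pos (fst w) d \<le> m + 1"

definition valid_code :: "instance_code \<Rightarrow> bool" where
  "valid_code I \<longleftrightarrow> fst (snd I) < fst I \<and>
     (\<forall>w\<in>set (snd (snd (snd I))). valid_voter (fst I) (fst (snd I)) w)"

lemma pt_valid_code: "pt valid_code"
  unfolding valid_code_def[abs_def] valid_voter_def
  by (intro pt_basic pt_less pt_le pt_Ball pt_Bex pt_length pt_upt pt_sorted pt_add pt_pos)


subsection \<open>The dynamic program\<close>

text \<open>The price of pushing \<open>d\<close> from position \<open>p\<close> down to position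
  \<open>l\<close>, that is, entry \<open>l - p\<close>. Counting positions upwards from
  \<open>p\<close> avoids the subtraction; \<open>K\<close> stands for an impossible shift.\<close>

definition price :: "nat \<Rightarrow> nat list \<Rightarrow> nat \<Rightarrow> nat \<Rightarrow> nat" where
  "price K ps p l = (if l \<le> p then 0
     else snd (foldl (\<lambda>s a. (fst s + 1, if fst s = l then a else snd s)) (p, K) ps))"

text \<open>The least prices for moving \<open>d\<close> out of the top \<open>l - 1\<close> positions, for having \<open>c\<close> among
  the top \<open>l\<close>, and for both. A shift moves \<open>c\<close> up by at most one position. Prices that exceed
  the budget are represented by \<open>K\<close>, the budget plus one.\<close>

definition weight :: "nat \<Rightarrow> nat \<Rightarrow> nat \<Rightarrow> nat \<Rightarrow> nat list \<times> nat list \<Rightarrow> nat \<times> nat \<times> nat" where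
  "weight K d c l w =
     (price K (snd w) (pos (fst w) d) l,
      if pos (fst w) c \<le> l then 0
      else if pos (fst w) c = l + 1 \<and> pos (fst w) d \<le> l then price K (snd w) (pos (fst w) d) (l + 1) else K,
      if pos (fst w) c \<le> l then price K (snd w) (pos (fst w) d) l
      else if pos (fst w) c = l + 1 \<and> pos (fst w) d \<le> l then price K (snd w) (pos (fst w) d) (l + 1) else K)"

text \<open>A number in a key is accompanied by its predecessor, so that no subtraction is needed.\<close>

type_synonym key = "(nat \<times> nat) \<times> (nat \<times> nat)"
type_synonym table = "((nat \<times> nat) \<times> nat) list"

definition numbers :: "'a list \<Rightarrow> (nat \<times> nat) list" where
  "numbers vs = (0, 0) # map (\<lambda>k. (k, k + 1)) [0..<length vs]"

definition keys :: "'a list \<Rightarrow> key list" where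
  "keys vs = concat (map (\<lambda>a. map (\<lambda>b. (a, b)) (numbers vs)) (numbers vs))"

definition lookup :: "nat \<Rightarrow> table \<Rightarrow> nat \<times> nat \<Rightarrow> nat" where
  "lookup K T k = foldl (\<lambda>r e. if fst e = k then snd e else r) K T"

definition dp_init :: "nat \<Rightarrow> key list \<Rightarrow> table" where
  "dp_init K ks = map (\<lambda>k. ((snd (fst k), snd (snd k)),
     if snd (fst k) = 0 \<and> snd (snd k) = 0 then 0 else K)) ks"

text \<open>A key holds the number required for \<open>c\<close> first and the one required for
  \<open>d\<close> second. The alternatives for the next voter are to contribute nothing, to the
  goal for \<open>d\<close>, to the goal for \<open>c\<close>, or to both.\<close>

definition dp_step :: "nat \<Rightarrow> key list \<Rightarrow> table \<Rightarrow> nat \<times> nat \<times> nat \<Rightarrow> table" where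
  "dp_step K ks T w = map (\<lambda>k. ((snd (fst k), snd (snd k)),
     min K (min (lookup K T (snd (fst k), snd (snd k)))
       (min (fst w + lookup K T (snd (fst k), fst (snd k)))
         (min (fst (snd w) + lookup K T (fst (fst k), snd (snd k)))
           (snd (snd w) + lookup K T (fst (fst k), fst (snd k)))))))) ks"

definition dp :: "nat \<Rightarrow> key list \<Rightarrow> (nat \<times> nat \<times> nat) list \<Rightarrow> table" where
  "dp K ks ws = foldl (dp_step K ks) (dp_init K ks) ws"

definition test :: "nat \<Rightarrow> nat \<Rightarrow> nat \<Rightarrow> nat \<Rightarrow> (nat list \<times> nat list) list \<Rightarrow> bool" where
  "test B d c l vs \<longleftrightarrow> (\<exists>k\<in>set (keys vs).
     length vs < snd (fst k) + snd (fst k) \<and> length vs \<le> snd (snd k) + snd (snd k) \<and>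
     lookup (B + 1) (dp (B + 1) (keys vs) (map (weight (B + 1) d c l) vs)) (snd (fst k), snd (snd k)) \<le> B)"

text \<open>Without voters nobody wins and the answer is yes. Otherwise candidates and rounds are
  taken from the first ranking: counting up to the binary number of candidates could take
  exponential time on a malformed code or on one without voters.\<close>

definition solve :: "instance_code \<Rightarrow> bool" where
  "solve I \<longleftrightarrow> snd (snd (snd I)) = [] \<or>
     (\<exists>c\<in>set (fst (hd (snd (snd (snd I))))). c \<noteq> fst (snd I) \<and>
        (\<exists>l\<in>set [0..<length (fst (hd (snd (snd (snd I)))))].
           test (fst (snd (snd I))) (fst (snd I)) c (l + 1) (snd (snd (snd I)))))"

lemma foldl_price:
  "foldl (\<lambda>s a. (fst s + 1, if fst s = l then a else snd s)) (p, K) ps =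
    (p + length ps, if p \<le> l \<and> l < p + length ps then ps ! (l - p) else K)" for l p :: nat
proof (induction ps arbitrary: p K)
  case (Cons a ps)
  show ?case
  proof (cases "p = l")
    case False
    then have "l - p = Suc (l - (p + 1))" if "p \<le> l" using that by simp
    moreover have "p \<le> l \<longleftrightarrow> p + 1 \<le> l" using False by linarith
    ultimately show ?thesis using False Cons.IH[of "p + 1" K] by simp
  next
    case True
    then show ?thesis using Cons.IH[of "p + 1" a] by simp
  qed
qed auto

lemma length_bits_Suc: "length (bits (Suc n)) \<le> length (bits n) + 1"
proof (induction n rule: less_induct)
  case (less n)
  show ?case
  proof (cases "n = 0")
    case True
    then show ?thesis using length_bits_le[of 1] by simp
  next
    case False
    have Suc: "length (bits (Suc n)) = length (bits (Suc n div 2)) + 1"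
      using bits_rec[of "Suc n"] by simp
    have n: "length (bits n) = length (bits (n div 2)) + 1"
      using bits_rec[of n] False by simp
    have "Suc n div 2 = n div 2 \<or> Suc n div 2 = Suc (n div 2)" by presburger
    moreover have "length (bits (Suc (n div 2))) \<le> length (bits (n div 2)) + 1"
      using False by (intro less.IH) simp
    ultimately show ?thesis
      unfolding Suc n by auto
  qed
qed

lemma csize_nat_add: "csize (m + n) \<le> 4 * (csize m + n) + 1" for m n :: nat
proof -
  have "length (bits (m + n)) \<le> length (bits m) + n"
  proof (induction n)
    case (Suc n)
    then show ?case using length_bits_Suc[of "m + n"] by simp
  qed simp
  then show ?thesis
    using csize_bool_list[of "bits (m + n)"] length_le_csize[of "bits m"] by (simp add: csize_nat)
qed

lemma pt_price:
  fixes ps :: "'x::encodable \<Rightarrow> nat list"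
  assumes "pt K" "pt ps" "pt p" "pt l"
  shows "pt (\<lambda>x. price (K x) (ps x) (p x) (l x))"
proof -
  have "pt (\<lambda>x. foldl (\<lambda>s a. (fst s + 1, if fst s = fst (l x, p x, K x) then a else snd s))
      (snd (l x, p x, K x)) (ps x))"
  proof (rule pt_foldl_env[where f = "\<lambda>e s a. (fst s + 1, if fst s = fst e then a else snd s)" and
        init = "\<lambda>e. snd e" and env = "\<lambda>x. (l x, p x, K x)" and B = "\<lambda>n. 10 * n + 10"])
    fix e :: "nat \<times> nat \<times> nat" and ps :: "nat list"
    obtain l p K where e: "e = (l, p, K)" by (cases e)
    have 1: "csize (p + length ps) \<le> 4 * (csize p + csize ps) + 1"
      using csize_nat_add[of p "length ps"] length_le_csize[of ps] by simp
    have 2: "csize (if p \<le> l \<and> l < p + length ps then ps ! (l - p) else K) \<le> csize ps + csize K"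
      using csize_member[OF nth_mem[of "l - p" ps]] by (auto intro: trans_le_add1)
    show "csize (foldl (\<lambda>s a. (fst s + 1, if fst s = fst e then a else snd s)) (snd e) ps)
        \<le> 10 * (csize e + csize ps) + 10"
      using 1 2 by (simp only: e fst_conv snd_conv foldl_price csize_Pair distrib_left)
  qed (intro pt_basic assms pt_add poly_bounded_intros)+
  from pt_comp[OF pt_snd this] show ?thesis
    unfolding price_def by (intro pt_If pt_le pt_const assms) simp
qed

lemma pt_weight: "pt K \<Longrightarrow> pt d \<Longrightarrow> pt c \<Longrightarrow> pt l \<Longrightarrow> pt w \<Longrightarrow>
    pt (\<lambda>x. weight (K x) (d x) (c x) (l x) (w x))"
  unfolding weight_def by (intro pt_basic pt_price pt_pos pt_le pt_add)

lemma pt_keys: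
  fixes vs :: "'x::encodable \<Rightarrow> 'a::encodable list"
  assumes "pt vs"
  shows "pt (\<lambda>x. keys (vs x))"
proof -
  have "pt (\<lambda>vs :: 'a list. keys vs)"
    unfolding keys_def numbers_def by (intro pt_concat pt_map pt_basic pt_upt pt_add)
  from pt_comp[OF this assms] show ?thesis .
qed

lemma foldl_lookup:
  "foldl (\<lambda>r e. if fst e = k then snd e else r) r T = r \<or> foldl (\<lambda>r e. if fst e = k then snd e else r) r T \<in> snd ` set T"
  by (induction T arbitrary: r) auto

lemma pt_lookup:
  assumes "pt K" "pt T" "pt k"
  shows "pt (\<lambda>x. lookup (K x) (T x) (k x))"
proof -
  have "pt (\<lambda>x. foldl (\<lambda>r e. if fst e = snd (K x, k x) then snd e else r) (fst (K x, k x)) (T x))"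
  proof (rule pt_foldl_env[where f = "\<lambda>p r e. if fst e = snd p then snd e else r" and
        init = fst and env = "\<lambda>x. (K x, k x)" and B = "\<lambda>n. n"])
    fix p :: "nat \<times> nat \<times> nat" and T :: table
    have "csize (snd e) \<le> csize T" if "e \<in> set T" for e
      using csize_member[OF that] by (cases e) simp
    moreover have "csize (fst p) \<le> csize p" by (cases p) simp
    ultimately show "csize (foldl (\<lambda>r e. if fst e = snd p then snd e else r) (fst p) T) \<le> csize p + csize T"
      using foldl_lookup[of "snd p" "fst p" T] by (fastforce simp: trans_le_add1 trans_le_add2)
  qed (intro pt_basic assms poly_bounded_intros pt_fst)+
  then show ?thesis by (simp add: lookup_def)
qed

text \<open>The purpose of the cap: with fixed keys and entries at most \<open>K\<close>, the size
  of the table does not depend on how many voters have been processed.\<close>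

lemma csize_table:
  fixes K :: nat and ks :: "key list"
  assumes "T = map (\<lambda>k. ((snd (fst k), snd (snd k)), f k)) ks" "\<And>k. f k \<le> K"
  shows "csize T \<le> 1 + csize ks * (4 + (csize ks + 4 * csize K))"
proof -
  have "csize T \<le> 1 + length T * (1 + (3 + (csize ks + 4 * csize K)))"
  proof (rule csize_list_le)
    fix e assume "e \<in> set T"
    then obtain k where k: "k \<in> set ks" "e = ((snd (fst k), snd (snd k)), f k)"
      using assms(1) by auto
    obtain x' x y' y where "k = ((x', x), (y', y))" by (metis surj_pair)
    then show "csize e \<le> 3 + (csize ks + 4 * csize K)"
      using csize_member[OF k(1)] csize_nat_mono[OF assms(2)[of k]] k(2) by simp
  qed
  also have "\<dots> \<le> 1 + csize ks * (1 + (3 + (csize ks + 4 * csize K)))"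
    using length_le_csize[of ks] assms(1) by (intro add_mono mult_right_mono) simp_all
  finally show ?thesis by simp
qed

lemma pt_dp:
  assumes "pt K" "pt ks" "pt ws"
  shows "pt (\<lambda>x. dp (K x) (ks x) (ws x))"
proof -
  have "pt (\<lambda>x. foldl (\<lambda>T. dp_step (fst (K x, ks x)) (snd (K x, ks x)) T)
     (dp_init (fst (K x, ks x)) (snd (K x, ks x))) (ws x))"
  proof (rule pt_foldl_env[where f = "\<lambda>e T. dp_step (fst e) (snd e) T" and
        init = "\<lambda>e. dp_init (fst e) (snd e)" and env = "\<lambda>x. (K x, ks x)" and
        B = "\<lambda>n. 1 + n * (4 + 4 * n)"])
    show "pt (\<lambda>x :: (nat \<times> key list) \<times> table \<times> nat \<times> nat \<times> nat.
        dp_step (fst (fst x)) (snd (fst x)) (fst (snd x)) (snd (snd x)))"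
      unfolding dp_step_def by (intro pt_map pt_basic pt_min pt_add pt_lookup)
    show "pt (\<lambda>e. dp_init (fst e) (snd e))"
      unfolding dp_init_def by (intro pt_map pt_basic)
    fix e :: "nat \<times> key list" and ws :: "(nat \<times> nat \<times> nat) list"
    obtain K ks where e: "e = (K, ks)" by (cases e)
    have "csize (foldl (dp_step K ks) (dp_init K ks) ws) \<le> 1 + csize ks * (4 + (csize ks + 4 * csize K))"
    \<comment> \<open>Only the last step matters, as it rebuilds the whole table with capped
      entries, whatever the previous table was.\<close>
    proof (cases ws rule: rev_cases)
      case Nil
      show ?thesis
        unfolding Nil dp_init_def foldl_Nil by (rule csize_table[OF refl]) simp
    next
      case (snoc ws' w)
      show ?thesis
        unfolding snoc foldl_append foldl_Cons foldl_Nil dp_step_def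
        by (rule csize_table[OF refl]) (rule min.cobounded1)
    qed
    also have "\<dots> \<le> 1 + (csize e + csize ws) * (4 + 4 * (csize e + csize ws))"
      by (intro add_mono mult_mono) (simp_all add: e)
    finally show "csize (foldl (\<lambda>T. dp_step (fst e) (snd e) T) (dp_init (fst e) (snd e)) ws) \<le>
        1 + (csize e + csize ws) * (4 + 4 * (csize e + csize ws))"
      by (simp add: e)
  qed (intro pt_basic assms poly_bounded_intros)+
  then show ?thesis by (simp add: dp_def)
qed

lemma pt_solve: "pt solve"
  unfolding solve_def[abs_def] test_def
  by (intro pt_basic pt_Bex pt_upt pt_keys pt_less pt_le pt_add pt_length pt_lookup pt_dp pt_map pt_weight)

subsection \<open>Codes and instances\<close>

definition price_of :: "nat list \<Rightarrow> nat \<Rightarrow> enat" where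
  "price_of ps i = (if i < length ps then enat (ps ! i) else \<infinity>)"

definition to_instance :: "instance_code \<Rightarrow> bribery_instance" where
  "to_instance I = \<lparr>num_cands = fst I, despised = fst (snd I), budget = fst (snd (snd I)),
     voters = map (\<lambda>w. (fst w, price_of (snd w))) (snd (snd (snd I)))\<rparr>"

definition of_instance :: "bribery_instance \<Rightarrow> instance_code" where
  "of_instance I = (num_cands I, despised I, budget I,
     map (\<lambda>w. (fst w, finite_prices (snd w))) (voters I))"

lemma finite_prices_price_of: "finite_prices (price_of ps) = ps"
proof -
  have "{i. price_of ps i \<noteq> \<infinity>} = {0..<length ps}"
    by (auto simp: price_of_def)
  then show ?thesis
    unfolding finite_prices_def by (auto simp: price_of_def intro!: nth_equalityI)
qed

lemma price_of_finite_prices: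
  assumes "price_function m j \<rho>"
  shows "price_of (finite_prices \<rho>) = \<rho>"
proof
  fix i
  define n where "n = length (finite_prices \<rho>)"
  have S: "{i. \<rho> i \<noteq> \<infinity>} = {..<n}"
    using price_function_finite_args[OF assms] by (simp add: n_def)
  have eq: "finite_prices \<rho> = map (\<lambda>i. the_enat (\<rho> i)) [0..<n]"
    unfolding finite_prices_def S by (simp add: lessThan_atLeast0)
  show "price_of (finite_prices \<rho>) i = \<rho> i"
  proof (cases "i < n")
    case True
    then have "\<rho> i \<noteq> \<infinity>" using S by blast
    then show ?thesis using True by (auto simp: price_of_def eq)
  next
    case False
    then have "\<rho> i = \<infinity>" using S by blast
    then show ?thesis using False by (simp add: price_of_def eq)
  qed
qed

lemma encode_to_instance: "encode_instance (to_instance I) = encode_code I"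
  by (simp add: encode_instance_def to_instance_def encode_code_def encode_list_def
      encode_voter_def encode_voter_code_def finite_prices_price_of o_def case_prod_beta')

lemma to_of_instance:
  assumes "valid_instance I"
  shows "to_instance (of_instance I) = I"
proof -
  have "map (\<lambda>w. (fst w, price_of (finite_prices (snd w)))) (voters I) = voters I"
  proof (rule map_idI)
    fix w assume "w \<in> set (voters I)"
    then have "price_function (num_cands I) (pos (fst w) (despised I)) (snd w)"
      using assms by (auto simp: valid_instance_def)
    then show "(fst w, price_of (finite_prices (snd w))) = w"
      by (simp add: price_of_finite_prices)
  qed
  then show ?thesis
    by (simp add: to_instance_def of_instance_def o_def)
qed

lemma pos_ge_1: "1 \<le> pos v c"
  by (simp add: pos_def)

lemma pos_le_length: "c \<in> set v \<Longrightarrow> pos v c \<le> length v"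
  by (induction v) (auto simp: pos_def)

lemma price_function_price_of:
  assumes "1 \<le> j" "j \<le> m"
  shows "price_function m j (price_of ps) \<longleftrightarrow>
    ps \<noteq> [] \<and> hd ps = 0 \<and> sorted ps \<and> length ps + j \<le> m + 1"
proof
  assume p: "price_function m j (price_of ps)"
  then have "price_of ps 0 = 0" by (simp add: price_function_def)
  then have ps: "ps \<noteq> []" "hd ps = 0"
    by (auto simp: price_of_def hd_conv_nth zero_enat_def split: if_splits)
  have "price_of ps (m - j + 1) = \<infinity>"
    using p by (simp add: price_function_def)
  then have len: "length ps \<le> m - j + 1"
    by (simp add: price_of_def split: if_splits)
  have "sorted ps"
    unfolding sorted_iff_nth_mono_less
  proof (intro allI impI)
    fix i k assume ik: "i < k" "k < length ps"
    then have "k \<le> m - j" using len by simp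
    then have "price_of ps i \<le> price_of ps k"
      using p ik(1) unfolding price_function_def by blast
    then show "ps ! i \<le> ps ! k" using ik by (simp add: price_of_def)
  qed
  then show "ps \<noteq> [] \<and> hd ps = 0 \<and> sorted ps \<and> length ps + j \<le> m + 1"
    using ps len assms by simp
next
  assume "ps \<noteq> [] \<and> hd ps = 0 \<and> sorted ps \<and> length ps + j \<le> m + 1"
  then show "price_function m j (price_of ps)"
    by (auto simp: price_function_def price_of_def hd_conv_nth zero_enat_def sorted_nth_mono)
qed

text \<open>By the pigeonhole principle, a list of length \<open>m\<close> in which all numbers
  below \<open>m\<close> occur is a permutation of them.\<close>

lemma ranking_iff:
  "ranking {..<m} v \<longleftrightarrow> length v = m \<and> (\<forall>k\<in>set [0..<length v]. \<exists>a\<in>set v. a = k)" for v :: "nat list"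
proof
  assume "ranking {..<m} v"
  then show "length v = m \<and> (\<forall>k\<in>set [0..<length v]. \<exists>a\<in>set v. a = k)"
    using distinct_card[of v] by (auto simp: ranking_def)
next
  assume v: "length v = m \<and> (\<forall>k\<in>set [0..<length v]. \<exists>a\<in>set v. a = k)"
  then have sub: "{..<m} \<subseteq> set v" by auto
  have "card (set v) \<le> m" using v card_length[of v] by simp
  then have eq: "{..<m} = set v"
    using card_seteq[OF _ sub] by simp
  then have "card (set v) = length v"
    using v card_lessThan[of m] by simp
  then show "ranking {..<m} v"
    using eq card_distinct by (simp add: ranking_def)
qed

lemma valid_voter_iff:
  assumes "d < m"
  shows "valid_voter m d w \<longleftrightarrow> ranking {..<m} (fst w) \<and> price_function m (pos (fst w) d) (price_of (snd w))"
proof (cases "ranking {..<m} (fst w)")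
  case True
  then have "length (fst w) = m" "d \<in> set (fst w)"
    using assms ranking_iff by (auto simp: ranking_def)
  then have "pos (fst w) d \<le> m" using pos_le_length by metis
  then show ?thesis
    using True ranking_iff[of m "fst w"] price_function_price_of[OF pos_ge_1, of "fst w" d m "snd w"]
    by (simp add: valid_voter_def)
next
  case False
  then show ?thesis using ranking_iff[of m "fst w"] by (auto simp: valid_voter_def)
qed

lemma valid_code_iff: "valid_code I \<longleftrightarrow> valid_instance (to_instance I)"
  using valid_voter_iff[of "fst (snd I)" "fst I"]
  by (auto simp: valid_code_def valid_instance_def to_instance_def)


subsection \<open>Positions after a shift\<close>

lemma pos_Cons: "pos (a # v) c = (if a = c then 1 else pos v c + 1)"
  by (simp add: pos_def)

lemma pos_append: "pos (u @ v) c = (if c \<in> set u then pos u c else length u + pos v c)"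
  by (induction u) (auto simp: pos_Cons)

lemma shift_back_append:
  assumes "d \<notin> set u"
  shows "shift_back d t (u @ d # v) = u @ take t v @ d # drop t v"
proof -
  have "pos (u @ d # v) d = length u + 1" "remove1 d (u @ d # v) = u @ v"
    using assms by (simp_all add: pos_append pos_Cons remove1_append)
  then show ?thesis by (simp add: shift_back_def)
qed

lemma
  assumes "distinct v" "d \<in> set v" "pos v d + t \<le> length v"
  shows pos_shift_back_self: "pos (shift_back d t v) d = pos v d + t"
    and pos_shift_back_other: "c \<in> set v \<Longrightarrow> c \<noteq> d \<Longrightarrow> pos (shift_back d t v) c =
      (if pos v d < pos v c \<and> pos v c \<le> pos v d + t then pos v c - 1 else pos v c)"
    and set_shift_back: "set (shift_back d t v) = set v"
    and distinct_shift_back: "distinct (shift_back d t v)"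
proof -
  obtain u w where v: "v = u @ d # w" "d \<notin> set u"
    using split_list_first[OF assms(2)] by blast
  have pos_d: "pos v d = length u + 1"
    using v by (simp add: pos_append pos_Cons)
  \<comment> \<open>The shift exchanges \<open>d\<close> with the block \<open>x\<close> of the
    \<open>t\<close> candidates behind it. Only \<open>d\<close> and this block move, the block by
    one position.\<close>
  define x y where "x = take t w" and "y = drop t w"
  have w: "w = x @ y" "length x = t"
    using assms(3) pos_d by (auto simp: x_def y_def v)
  have shift: "shift_back d t v = u @ x @ d # y"
    using shift_back_append[OF v(2), of t w] by (simp add: v(1) x_def y_def)
  have dist: "d \<notin> set x" "d \<notin> set y" "set u \<inter> set x = {}" "set u \<inter> set y = {}" "set x \<inter> set y = {}"
    "distinct u" "distinct x" "distinct y"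
    using assms(1) v(1) w(1) by auto
  show "pos (shift_back d t v) d = pos v d + t"
    using v(2) dist(1) w(2) unfolding pos_d by (simp add: shift pos_append pos_Cons)
  show "set (shift_back d t v) = set v"
    unfolding shift by (auto simp: v(1) w(1))
  show "distinct (shift_back d t v)"
    unfolding shift using dist v(2) by auto
  show "pos (shift_back d t v) c =
      (if pos v d < pos v c \<and> pos v c \<le> pos v d + t then pos v c - 1 else pos v c)"
    if c: "c \<in> set v" "c \<noteq> d"
  proof -
    consider "c \<in> set u" | "c \<notin> set u" "c \<in> set x" | "c \<notin> set u" "c \<notin> set x" "c \<in> set y"
      using c by (auto simp: v(1) w(1))
    then show ?thesis
    proof cases
      case 1
      then show ?thesis
        using pos_le_length[OF 1] unfolding pos_d shift by (simp add: v(1) pos_append)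
    next
      case 2
      have "pos v c = length u + (pos x c + 1)" "pos (shift_back d t v) c = length u + pos x c"
        using 2 c(2) unfolding shift by (simp_all add: v(1) w(1) pos_append pos_Cons)
      then show ?thesis
        using pos_le_length[OF 2(2)] pos_ge_1[of x c] w(2) unfolding pos_d by simp
    next
      case 3
      have "pos v c = length u + (t + pos y c + 1)" "pos (shift_back d t v) c = length u + (t + (pos y c + 1))"
        using 3 c(2) w(2) unfolding shift by (simp_all add: v(1) w(1) pos_append pos_Cons)
      then show ?thesis
        using pos_ge_1[of y c] unfolding pos_d by simp
    qed
  qed
qed


subsection \<open>Simplified Bucklin\<close>

lemma approval_score_mset: "approval_score l (mset us) c = length (filter (\<lambda>u. pos u c \<le> l) us)"
  unfolding approval_score_def mset_filter[symmetric] by (rule size_mset)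

lemma approval_score_mono: "k \<le> l \<Longrightarrow> approval_score k V c \<le> approval_score l V c"
  unfolding approval_score_def by (induction V) auto

text \<open>If \<open>c\<close> has a majority in round \<open>l\<close> while \<open>d\<close> has none in round \<open>l - 1\<close>, then either \<open>c\<close>
  itself or someone who reached the majority earlier wins besides \<open>d\<close>.\<close>

lemma not_unique_winner_iff:
  assumes us: "us \<noteq> []" "\<And>u. u \<in> set us \<Longrightarrow> ranking {..<m} u" and d: "d < m"
  shows "simplified_bucklin ({..<m}, mset us) \<noteq> {d} \<longleftrightarrow>
    (\<exists>c<m. c \<noteq> d \<and> (\<exists>l\<in>{1..m}. length us < 2 * length (filter (\<lambda>u. pos u c \<le> l) us) \<and>
       length us \<le> 2 * length (filter (\<lambda>u. l \<le> pos u d) us)))"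
proof -
  define S where "S l c = approval_score l (mset us) c" for l c
  define maj where "maj = length us div 2 + 1"
  define r where "r = (LEAST l. \<exists>c\<in>{..<m}. S l c \<ge> maj)"
  let ?W = "simplified_bucklin ({..<m}, mset us)"
  have W: "?W = {c. c < m \<and> maj \<le> S r c}"
    by (auto simp: simplified_bucklin_def bucklin_round_def majority_def r_def S_def maj_def)
  have n: "0 < length us" using us(1) by simp
  have "pos u d \<le> m" if "u \<in> set us" for u
    using us(2)[OF that] d pos_le_length[of d u] ranking_iff[of m u] by (auto simp: ranking_def)
  then have "S m d = length us"
    unfolding S_def approval_score_mset by (subst filter_True) auto
  \<comment> \<open>In round \<open>m\<close> every voter approves \<open>d\<close>, so a winning
    round exists and is at most \<open>m\<close>.\<close>
  then have m: "\<exists>c\<in>{..<m}. S m c \<ge> maj"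
  proof (intro bexI[of _ d])
    have "maj \<le> length us" unfolding maj_def using n by arith
    then show "maj \<le> S m d" using \<open>S m d = length us\<close> by simp
  qed (use d in simp)
  have r: "\<exists>c\<in>{..<m}. S r c \<ge> maj"
    unfolding r_def by (rule LeastI[of "\<lambda>l. \<exists>c\<in>{..<m}. S l c \<ge> maj", OF m])
  have r_least: "S l c < maj" if "l < r" "c < m" for l c
    using not_less_Least[of l "\<lambda>l. \<exists>c\<in>{..<m}. S l c \<ge> maj"] that by (auto simp: r_def not_le)
  have "r \<le> m"
    unfolding r_def by (rule Least_le[of "\<lambda>l. \<exists>c\<in>{..<m}. S l c \<ge> maj", OF m])
  have S0: "S 0 c = 0" for c
    using pos_ge_1[of _ c] by (simp add: S_def approval_score_mset filter_empty_conv not_le Suc_le_eq)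
  have "r \<ge> 1"
  proof (rule ccontr)
    assume "\<not> r \<ge> 1"
    then have "r = 0" by simp
    then show False using r S0 by (simp add: maj_def)
  qed
  have S_maj: "maj \<le> S l c \<longleftrightarrow> length us < 2 * length (filter (\<lambda>u. pos u c \<le> l) us)" for l c
    unfolding S_def approval_score_mset maj_def by linarith
  \<comment> \<open>Missing a strict majority in round \<open>l - 1\<close> means that at least half
    of the voters place the candidate at \<open>l\<close> or later. Both goals thereby become lower
    bounds on numbers of voters.\<close>
  have S_not_maj: "S (l - 1) c < maj \<longleftrightarrow> length us \<le> 2 * length (filter (\<lambda>u. l \<le> pos u c) us)"
    if "l \<ge> 1" for l c
  proof -
    have "filter (\<lambda>u. l \<le> pos u c) us = filter (\<lambda>u. \<not> pos u c \<le> l - 1) us"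
      using that by (intro filter_cong) auto
    then have "S (l - 1) c + length (filter (\<lambda>u. l \<le> pos u c) us) = length us"
      unfolding S_def approval_score_mset using sum_length_filter_compl[of "\<lambda>u. pos u c \<le> l - 1" us] by simp
    then show ?thesis by (auto simp: maj_def)
  qed
  have "?W \<noteq> {d} \<longleftrightarrow> (\<exists>c<m. c \<noteq> d \<and> (\<exists>l\<in>{1..m}. maj \<le> S l c \<and> S (l - 1) d < maj))"
  proof
    assume "?W \<noteq> {d}"
    moreover have "?W \<noteq> {}" using r unfolding W by blast
    ultimately obtain c where "c \<in> ?W" "c \<noteq> d" by blast
    moreover have "S (r - 1) d < maj"
      using \<open>r \<ge> 1\<close> d by (intro r_least) simp_all
    ultimately show "\<exists>c<m. c \<noteq> d \<and> (\<exists>l\<in>{1..m}. maj \<le> S l c \<and> S (l - 1) d < maj)"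
      using \<open>r \<ge> 1\<close> \<open>r \<le> m\<close> unfolding W by (intro exI[of _ c] conjI bexI[of _ r]) simp_all
  next
    assume "\<exists>c<m. c \<noteq> d \<and> (\<exists>l\<in>{1..m}. maj \<le> S l c \<and> S (l - 1) d < maj)"
    then obtain c l where c: "c < m" "c \<noteq> d" "maj \<le> S l c" "S (l - 1) d < maj"
      by blast
    show "?W \<noteq> {d}"
    proof
      assume "?W = {d}"
      then have "d \<in> ?W" by simp
      then have "maj \<le> S r d" unfolding W by simp
      then have "\<not> r \<le> l - 1"
        using c(4) approval_score_mono[of r "l - 1" "mset us" d] by (auto simp: S_def)
      moreover have "\<not> l < r"
        using r_least[of l c] c(1,3) by linarith
      ultimately have "l = r" by simp
      then have "c \<in> ?W" using c unfolding W by simp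
      then show False using \<open>?W = {d}\<close> c(2) by simp
    qed
  qed
  also have "\<dots> \<longleftrightarrow> (\<exists>c<m. c \<noteq> d \<and> (\<exists>l\<in>{1..m}. length us < 2 * length (filter (\<lambda>u. pos u c \<le> l) us) \<and>
       length us \<le> 2 * length (filter (\<lambda>u. l \<le> pos u d) us)))"
    by (intro ex_cong1 conj_cong bex_cong refl S_maj S_not_maj) simp
  finally show ?thesis .
qed

lemma no_voters_no_winner: "simplified_bucklin (C, {#}) = {}"
  by (simp add: simplified_bucklin_def approval_score_def majority_def)


subsection \<open>Correctness of the dynamic program\<close>

lemma price_eq: "price K ps p l =
    (if l \<le> p then 0 else if l < p + length ps then ps ! (l - p) else K)"
  unfolding price_def foldl_price by auto

text \<open>Prices are sorted, so the smallest sufficient shift \<open>l - p\<close>, truncated at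
  0, is a cheapest one. With \<open>b < K\<close> the value \<open>K\<close> never counts as
  affordable.\<close>

lemma price_le_iff:
  assumes "b < K" "ps \<noteq> []" "hd ps = 0" "sorted ps"
  shows "price K ps p l \<le> b \<longleftrightarrow> (\<exists>t<length ps. ps ! t \<le> b \<and> l \<le> p + t)"
proof
  assume "price K ps p l \<le> b"
  then show "\<exists>t<length ps. ps ! t \<le> b \<and> l \<le> p + t"
    using assms by (intro exI[of _ "l - p"]) (auto simp: price_eq hd_conv_nth split: if_splits)
next
  assume "\<exists>t<length ps. ps ! t \<le> b \<and> l \<le> p + t"
  then obtain t where t: "t < length ps" "ps ! t \<le> b" "l \<le> p + t" by blast
  then have "ps ! (l - p) \<le> ps ! t"
    by (intro sorted_nth_mono assms) auto
  then show "price K ps p l \<le> b"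
    using t by (auto simp: price_eq)
qed

definition c_in :: "nat \<Rightarrow> nat \<Rightarrow> nat \<Rightarrow> (nat list \<times> nat list) \<times> nat \<Rightarrow> bool" where
  "c_in d c l z \<longleftrightarrow> pos (shift_back d (snd z) (fst (fst z))) c \<le> l"

definition d_out :: "nat \<Rightarrow> nat \<Rightarrow> (nat list \<times> nat list) \<times> nat \<Rightarrow> bool" where
  "d_out d l z \<longleftrightarrow> l \<le> pos (shift_back d (snd z) (fst (fst z))) d"

lemma valid_voter_shift:
  assumes "valid_voter m d w" "d < m" "t < length (snd w)"
  shows "distinct (fst w)" "d \<in> set (fst w)" "pos (fst w) d + t \<le> length (fst w)"
proof -
  have "ranking {..<m} (fst w)" using assms(1,2) valid_voter_iff by blast
  then show "distinct (fst w)" "d \<in> set (fst w)"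
    using assms(2) by (auto simp: ranking_def)
  show "pos (fst w) d + t \<le> length (fst w)"
    using assms by (auto simp: valid_voter_def)
qed

lemma d_out_iff:
  assumes "valid_voter m d w" "d < m" "t < length (snd w)"
  shows "d_out d l (w, t) \<longleftrightarrow> l \<le> pos (fst w) d + t"
  using pos_shift_back_self[OF valid_voter_shift[OF assms]] by (simp add: d_out_def)

lemma c_in_iff:
  assumes "valid_voter m d w" "d < m" "t < length (snd w)" "c < m" "c \<noteq> d"
  shows "c_in d c l (w, t) \<longleftrightarrow> pos (fst w) c \<le> l \<or>
    (pos (fst w) c = l + 1 \<and> pos (fst w) d \<le> l \<and> l + 1 \<le> pos (fst w) d + t)"
proof -
  have "ranking {..<m} (fst w)" using assms(1,2) valid_voter_iff by blast
  then have "c \<in> set (fst w)" using assms(4) by (auto simp: ranking_def)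
  from pos_shift_back_other[OF valid_voter_shift[OF assms(1-3)] this assms(5)]
  show ?thesis by (auto simp: c_in_def)
qed

text \<open>Each goal either is met by every shift, cannot be met, or is a lower bound on the final
  position of \<open>d\<close>, so \<open>price_le_iff\<close> applies. If \<open>c\<close> stands
  at \<open>l + 1\<close>, it enters exactly when \<open>d\<close>, ranked above it, passes it;
  \<open>d\<close> then ends at \<open>l + 1\<close> or later, so the goal for \<open>d\<close> is
  met as well and the last two weights coincide.\<close>

lemma weight_le_iff:
  assumes w: "valid_voter m d w" "d < m" and c: "c < m" "c \<noteq> d" and b: "b < K"
  shows "fst (weight K d c l w) \<le> b \<longleftrightarrow>
      (\<exists>t<length (snd w). snd w ! t \<le> b \<and> d_out d l (w, t))"
    and "fst (snd (weight K d c l w)) \<le> b \<longleftrightarrow>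
      (\<exists>t<length (snd w). snd w ! t \<le> b \<and> c_in d c l (w, t))"
    and "snd (snd (weight K d c l w)) \<le> b \<longleftrightarrow>
      (\<exists>t<length (snd w). snd w ! t \<le> b \<and> c_in d c l (w, t) \<and> d_out d l (w, t))"
proof -
  have ps: "snd w \<noteq> []" "hd (snd w) = 0" "sorted (snd w)"
    using w by (auto simp: valid_voter_def)
  have zero: "\<exists>t<length (snd w). snd w ! t \<le> b"
    using ps by (intro exI[of _ 0]) (auto simp: hd_conv_nth)
  note out = d_out_iff[OF w] and inn = c_in_iff[OF w _ c]
  note price = price_le_iff[OF b ps]
  show "fst (weight K d c l w) \<le> b \<longleftrightarrow> (\<exists>t<length (snd w). snd w ! t \<le> b \<and> d_out d l (w, t))"
    by (auto simp: weight_def price out)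
  show "fst (snd (weight K d c l w)) \<le> b \<longleftrightarrow> (\<exists>t<length (snd w). snd w ! t \<le> b \<and> c_in d c l (w, t))"
    using b zero by (auto simp: weight_def price inn)
  show "snd (snd (weight K d c l w)) \<le> b \<longleftrightarrow>
      (\<exists>t<length (snd w). snd w ! t \<le> b \<and> c_in d c l (w, t) \<and> d_out d l (w, t))"
    using b by (auto simp: weight_def price inn out)
qed

text \<open>The dynamic program without its table: a function of the required numbers, with genuine
  (truncated) predecessors.\<close>

fun opt_step :: "nat \<Rightarrow> (nat \<times> nat \<Rightarrow> nat) \<Rightarrow> nat \<times> nat \<times> nat \<Rightarrow> nat \<times> nat \<Rightarrow> nat" where
  "opt_step K f w (x, y) = min K (min (f (x, y)) (min (fst w + f (x, y - 1))
     (min (fst (snd w) + f (x - 1, y)) (snd (snd w) + f (x - 1, y - 1)))))"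

definition opt :: "nat \<Rightarrow> (nat \<times> nat \<times> nat) list \<Rightarrow> nat \<times> nat \<Rightarrow> nat" where
  "opt K ws = foldl (opt_step K) (\<lambda>k. if k = (0, 0) then 0 else K) ws"

lemma set_numbers: "set (numbers vs) = (\<lambda>x. (x - 1, x)) ` {..length vs}"
proof (intro equalityI subsetI)
  fix p assume "p \<in> set (numbers vs)"
  then have "p = (0, 0) \<or> (\<exists>k<length vs. p = (k, k + 1))"
    by (auto simp: numbers_def)
  then show "p \<in> (\<lambda>x. (x - 1, x)) ` {..length vs}"
  proof (elim disjE exE conjE)
    assume "p = (0, 0)"
    then show ?thesis by (intro image_eqI[of _ _ 0]) simp_all
  next
    fix k assume "k < length vs" "p = (k, k + 1)"
    then show ?thesis by (intro image_eqI[of _ _ "k + 1"]) simp_all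
  qed
next
  fix p assume "p \<in> (\<lambda>x. (x - 1, x)) ` {..length vs}"
  then obtain x where x: "x \<le> length vs" "p = (x - 1, x)" by blast
  show "p \<in> set (numbers vs)"
  proof (cases x)
    case 0
    then show ?thesis using x by (simp add: numbers_def)
  next
    case (Suc k)
    then show ?thesis using x by (simp add: numbers_def image_iff)
  qed
qed

lemma set_keys: "set (keys vs) = (\<lambda>(x, y). ((x - 1, x), (y - 1, y))) ` ({..length vs} \<times> {..length vs})"
proof -
  have "set (keys vs) = set (numbers vs) \<times> set (numbers vs)"
    by (auto simp: keys_def)
  then show ?thesis
    unfolding set_numbers image_paired_Times .
qed

lemma lookup_eq:
  assumes "\<And>e. e \<in> set T \<Longrightarrow> snd e = f (fst e)" "k \<in> fst ` set T"
  shows "lookup K T k = f k"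
proof -
  have "foldl (\<lambda>r e. if fst e = k then snd e else r) r T = (if k \<in> fst ` set T then f k else r)" for r
    using assms(1) by (induction T arbitrary: r) auto
  then show ?thesis using assms(2) by (simp add: lookup_def)
qed

lemma fst_entries: "fst ` set (map (\<lambda>k. ((snd (fst k), snd (snd k)), f k)) (keys vs)) =
    {..length vs} \<times> {..length vs}"
proof -
  have "fst ` set (map (\<lambda>k. ((snd (fst k), snd (snd k)), f k)) (keys vs)) =
      (\<lambda>k. (snd (fst k), snd (snd k))) ` set (keys vs)"
    by (simp only: set_map image_image fst_conv)
  also have "\<dots> = (\<lambda>p. p) ` ({..length vs} \<times> {..length vs})"
    unfolding set_keys image_image by (intro image_cong refl) (simp add: case_prod_beta')
  finally show ?thesis by simp
qed

lemma lookup_dp: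
  assumes "x \<le> length vs" "y \<le> length vs"
  shows "lookup K (dp K (keys vs) ws) (x, y) = opt K ws (x, y)"
proof -
  let ?n = "length vs"
  have "(\<forall>e\<in>set (dp K (keys vs) ws). snd e = opt K ws (fst e)) \<and>
      fst ` set (dp K (keys vs) ws) = {..?n} \<times> {..?n}"
  proof (induction ws rule: rev_induct)
    case Nil
    have dp: "dp K (keys vs) [] = map (\<lambda>k. ((snd (fst k), snd (snd k)),
        if snd (fst k) = 0 \<and> snd (snd k) = 0 then 0 else K)) (keys vs)"
      by (simp add: dp_def dp_init_def)
    show ?case
      unfolding dp fst_entries by (simp add: opt_def)
  next
    case (snoc w ws)
    let ?T = "dp K (keys vs) ws"
    have T: "lookup K ?T (i, j) = opt K ws (i, j)" if "i \<le> ?n" "j \<le> ?n" for i j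
    proof (rule lookup_eq)
      show "snd e = opt K ws (fst e)" if "e \<in> set ?T" for e
        using snoc that by blast
      show "(i, j) \<in> fst ` set ?T"
        using conjunct2[OF snoc] that by simp
    qed
    have dp: "dp K (keys vs) (ws @ [w]) = dp_step K (keys vs) ?T w"
      by (simp add: dp_def)
    have opt: "opt K (ws @ [w]) = opt_step K (opt K ws) w"
      by (simp add: opt_def)
    show ?case
    proof
      show "\<forall>e\<in>set (dp K (keys vs) (ws @ [w])). snd e = opt K (ws @ [w]) (fst e)"
      proof
        fix e assume "e \<in> set (dp K (keys vs) (ws @ [w]))"
        then obtain k where k: "k \<in> set (keys vs)" "e = ((snd (fst k), snd (snd k)),
            min K (min (lookup K ?T (snd (fst k), snd (snd k)))
              (min (fst w + lookup K ?T (snd (fst k), fst (snd k)))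
                (min (fst (snd w) + lookup K ?T (fst (fst k), snd (snd k)))
                  (snd (snd w) + lookup K ?T (fst (fst k), fst (snd k)))))))"
          unfolding dp dp_step_def set_map by blast
        from k(1) obtain x y where xy: "x \<le> ?n" "y \<le> ?n" "k = ((x - 1, x), (y - 1, y))"
          unfolding set_keys by (elim imageE) (simp add: case_prod_beta' mem_Times_iff)
        \<comment> \<open>Predecessors stay inside the square of keys, so these lookups find an
          entry.\<close>
        have "x - 1 \<le> ?n" "y - 1 \<le> ?n" using xy by simp_all
        then show "snd e = opt K (ws @ [w]) (fst e)"
          unfolding k(2) xy(3) opt fst_conv snd_conv opt_step.simps by (simp only: T xy(1,2))
      qed
      show "fst ` set (dp K (keys vs) (ws @ [w])) = {..?n} \<times> {..?n}"
        unfolding dp dp_step_def by (rule fst_entries)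
    qed
  qed
  note entries = conjunct1[OF this] and range = conjunct2[OF this]
  show ?thesis
    by (rule lookup_eq) (use entries in blast, use range assms in simp)
qed

definition feasible :: "nat \<Rightarrow> nat \<Rightarrow> nat \<Rightarrow> (nat list \<times> nat list) list \<Rightarrow> nat \<Rightarrow> nat \<Rightarrow> nat \<Rightarrow> bool" where
  "feasible d c l vs b x y \<longleftrightarrow> (\<exists>zs. map fst zs = vs \<and> (\<forall>z\<in>set zs. snd z < length (snd (fst z))) \<and>
     (\<Sum>z\<leftarrow>zs. snd (fst z) ! snd z) \<le> b \<and> x \<le> length (filter (c_in d c l) zs) \<and>
     y \<le> length (filter (d_out d l) zs))"

text \<open>The numbers are lower bounds, which makes the truncated predecessor of 0 harmless: a
  voter may contribute more than is still required.\<close>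

lemma feasible_mono:
  "feasible d c l vs b x y \<Longrightarrow> b \<le> b' \<Longrightarrow> x' \<le> x \<Longrightarrow> y' \<le> y \<Longrightarrow> feasible d c l vs b' x' y'"
  unfolding feasible_def by (elim exE conjE) (rule exI, intro conjI, assumption+, simp_all)

lemma feasible_snocI:
  assumes "feasible d c l vs b x y" "t < length (snd w)"
  shows "feasible d c l (vs @ [w]) (b + snd w ! t) (x + of_bool (c_in d c l (w, t))) (y + of_bool (d_out d l (w, t)))"
proof -
  obtain zs where "map fst zs = vs" "\<forall>z\<in>set zs. snd z < length (snd (fst z))"
      "(\<Sum>z\<leftarrow>zs. snd (fst z) ! snd z) \<le> b" "x \<le> length (filter (c_in d c l) zs)"
      "y \<le> length (filter (d_out d l) zs)"
    using assms(1) unfolding feasible_def by blast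
  then show ?thesis
    unfolding feasible_def using assms(2) by (intro exI[of _ "zs @ [(w, t)]"]) auto
qed

lemma feasible_snocE:
  assumes "feasible d c l (vs @ [w]) b x y"
  obtains t b' where "t < length (snd w)" "b' + snd w ! t \<le> b"
    "feasible d c l vs b' (x - of_bool (c_in d c l (w, t))) (y - of_bool (d_out d l (w, t)))"
proof -
  obtain us where us: "map fst us = vs @ [w]" "\<forall>z\<in>set us. snd z < length (snd (fst z))"
      "(\<Sum>z\<leftarrow>us. snd (fst z) ! snd z) \<le> b" "x \<le> length (filter (c_in d c l) us)"
      "y \<le> length (filter (d_out d l) us)"
    using assms(1) unfolding feasible_def by blast
  obtain zs z where "us = zs @ [z]" "map fst zs = vs" "fst z = w"
    using us(1) by (auto simp: map_eq_append_conv)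
  then have zs: "us = zs @ [(w, snd z)]" "map fst zs = vs" by auto
  show thesis
  proof (rule that[of "snd z" "\<Sum>z\<leftarrow>zs. snd (fst z) ! snd z"])
    show "feasible d c l vs (\<Sum>z\<leftarrow>zs. snd (fst z) ! snd z) (x - of_bool (c_in d c l (w, snd z)))
        (y - of_bool (d_out d l (w, snd z)))"
      unfolding feasible_def using us zs by (intro exI[of _ zs]) (auto split: if_splits)
  qed (use us zs in auto)
qed

text \<open>Compares with every threshold below \<open>K\<close> instead of stating an equation,
  because the cap destroys exact values from \<open>K\<close> on. The induction takes off the last
  voter, following the order of \<open>foldl\<close>.\<close>

lemma opt_le_iff:
  assumes "\<And>w. w \<in> set vs \<Longrightarrow> valid_voter m d w" "d < m" "c < m" "c \<noteq> d" "b < K"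
  shows "opt K (map (weight K d c l) vs) (x, y) \<le> b \<longleftrightarrow> feasible d c l vs b x y"
  using assms(1,5)
proof (induction vs arbitrary: b x y rule: rev_induct)
  case Nil
  then show ?case by (auto simp: opt_def feasible_def)
next
  case (snoc w vs)
  let ?w = "weight K d c l w" and ?f = "opt K (map (weight K d c l) vs)"
  have w: "valid_voter m d w" using snoc.prems(1) by simp
  have IH: "?f (i, j) \<le> b' \<longleftrightarrow> feasible d c l vs b' i j" if "b' \<le> b" for b' i j
    using snoc.prems that by (intro snoc.IH) auto
  note weight = weight_le_iff[OF w assms(2-4), of _ K l]
  have opt: "opt K (map (weight K d c l) (vs @ [w])) (x, y) = opt_step K ?f ?w (x, y)"
    by (simp add: opt_def)
  show ?case
  proof
    assume "opt K (map (weight K d c l) (vs @ [w])) (x, y) \<le> b"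
    then consider (none) "?f (x, y) \<le> b" | (out) "fst ?w + ?f (x, y - 1) \<le> b"
      | (inn) "fst (snd ?w) + ?f (x - 1, y) \<le> b"
      | (both) "snd (snd ?w) + ?f (x - 1, y - 1) \<le> b"
      unfolding opt opt_step.simps min_le_iff_disj using snoc.prems(2) by fastforce
    then show "feasible d c l (vs @ [w]) b x y"
    proof cases
      case none
      have 0: "0 < length (snd w)" "snd w ! 0 = 0"
        using w by (auto simp: valid_voter_def hd_conv_nth)
      have "feasible d c l vs b x y" using none IH by simp
      from feasible_snocI[OF this 0(1)] show ?thesis
        by (rule feasible_mono) (simp_all add: 0)
    next
      case out
      then have "fst ?w < K" using snoc.prems(2) by simp
      from weight(1)[OF this] obtain t where t: "t < length (snd w)" "snd w ! t \<le> fst ?w" "d_out d l (w, t)"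
        by auto
      \<comment> \<open>The hypothesis is used with the table value itself as budget; the rest of
        \<open>b\<close> pays for the last voter.\<close>
      have "feasible d c l vs (?f (x, y - 1)) x (y - 1)"
        by (rule IH[THEN iffD1, OF _ order_refl]) (use out in linarith)
      from feasible_snocI[OF this t(1)] show ?thesis
        by (rule feasible_mono) (use out t in auto)
    next
      case inn
      then have "fst (snd ?w) < K" using snoc.prems(2) by simp
      from weight(2)[OF this] obtain t where t: "t < length (snd w)" "snd w ! t \<le> fst (snd ?w)" "c_in d c l (w, t)"
        by auto
      have "feasible d c l vs (?f (x - 1, y)) (x - 1) y"
        by (rule IH[THEN iffD1, OF _ order_refl]) (use inn in linarith)
      from feasible_snocI[OF this t(1)] show ?thesis
        by (rule feasible_mono) (use inn t in auto)
    next
      case both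
      then have "snd (snd ?w) < K" using snoc.prems(2) by simp
      from weight(3)[OF this] obtain t where t: "t < length (snd w)" "snd w ! t \<le> snd (snd ?w)"
          "c_in d c l (w, t)" "d_out d l (w, t)"
        by auto
      have "feasible d c l vs (?f (x - 1, y - 1)) (x - 1) (y - 1)"
        by (rule IH[THEN iffD1, OF _ order_refl]) (use both in linarith)
      from feasible_snocI[OF this t(1)] show ?thesis
        by (rule feasible_mono) (use both t in auto)
    qed
  next
    assume "feasible d c l (vs @ [w]) b x y"
    then obtain t b' where t: "t < length (snd w)" "b' + snd w ! t \<le> b"
        "feasible d c l vs b' (x - of_bool (c_in d c l (w, t))) (y - of_bool (d_out d l (w, t)))"
      by (rule feasible_snocE)
    have f: "?f (x - of_bool (c_in d c l (w, t)), y - of_bool (d_out d l (w, t))) \<le> b'"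
      using IH t by simp
    have K: "snd w ! t < K" using t(2) snoc.prems(2) by simp
    have ws: "d_out d l (w, t) \<Longrightarrow> fst ?w \<le> snd w ! t" "c_in d c l (w, t) \<Longrightarrow> fst (snd ?w) \<le> snd w ! t"
        "c_in d c l (w, t) \<Longrightarrow> d_out d l (w, t) \<Longrightarrow> snd (snd ?w) \<le> snd w ! t"
      using weight[OF K] t(1) by auto
    show "opt K (map (weight K d c l) (vs @ [w])) (x, y) \<le> b"
      unfolding opt opt_step.simps min_le_iff_disj
      \<comment> \<open>Which of the goals the shift \<open>t\<close> achieves selects one of the
        four alternatives of \<open>opt_step\<close>, and \<open>t\<close> costs at least the
        corresponding weight.\<close>
      using f ws t(2) by (cases "c_in d c l (w, t)"; cases "d_out d l (w, t)") force+
  qed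
qed

lemma test_iff:
  assumes "\<And>w. w \<in> set vs \<Longrightarrow> valid_voter m d w" "d < m" "c < m" "c \<noteq> d"
  shows "test B d c l vs \<longleftrightarrow> (\<exists>zs. map fst zs = vs \<and> (\<forall>z\<in>set zs. snd z < length (snd (fst z))) \<and>
     (\<Sum>z\<leftarrow>zs. snd (fst z) ! snd z) \<le> B \<and> length vs < 2 * length (filter (c_in d c l) zs) \<and>
     length vs \<le> 2 * length (filter (d_out d l) zs))"
proof -
  let ?n = "length vs" and ?T = "dp (B + 1) (keys vs) (map (weight (B + 1) d c l) vs)"
  have entry: "lookup (B + 1) ?T (x, y) \<le> B \<longleftrightarrow> feasible d c l vs B x y" if "x \<le> ?n" "y \<le> ?n" for x y
    unfolding lookup_dp[OF that] by (rule opt_le_iff[OF assms]) simp_all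
  have "test B d c l vs \<longleftrightarrow> (\<exists>x\<le>?n. \<exists>y\<le>?n. ?n < 2 * x \<and> ?n \<le> 2 * y \<and> feasible d c l vs B x y)"
  proof
    assume "test B d c l vs"
    then obtain k where k: "k \<in> set (keys vs)" "?n < snd (fst k) + snd (fst k)"
        "?n \<le> snd (snd k) + snd (snd k)" "lookup (B + 1) ?T (snd (fst k), snd (snd k)) \<le> B"
      unfolding test_def by blast
    from k(1) have "snd (fst k) \<le> ?n" "snd (snd k) \<le> ?n"
      by (auto simp: set_keys)
    then show "\<exists>x\<le>?n. \<exists>y\<le>?n. ?n < 2 * x \<and> ?n \<le> 2 * y \<and> feasible d c l vs B x y"
      using k entry unfolding mult_2 by blast
  next
    assume "\<exists>x\<le>?n. \<exists>y\<le>?n. ?n < 2 * x \<and> ?n \<le> 2 * y \<and> feasible d c l vs B x y"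
    then obtain x y where xy: "x \<le> ?n" "y \<le> ?n" "?n < x + x" "?n \<le> y + y" "feasible d c l vs B x y"
      unfolding mult_2 by blast
    have "((x - 1, x), (y - 1, y)) \<in> set (keys vs)"
      unfolding set_keys using xy(1,2) by (intro image_eqI[of _ _ "(x, y)"]) simp_all
    then show "test B d c l vs"
      unfolding test_def using xy entry[OF xy(1,2)]
      by (intro bexI[of _ "((x - 1, x), (y - 1, y))"] conjI) (simp_all only: fst_conv snd_conv)
  qed
  also have "\<dots> \<longleftrightarrow> (\<exists>zs. map fst zs = vs \<and> (\<forall>z\<in>set zs. snd z < length (snd (fst z))) \<and>
     (\<Sum>z\<leftarrow>zs. snd (fst z) ! snd z) \<le> B \<and> length vs < 2 * length (filter (c_in d c l) zs) \<and>
     length vs \<le> 2 * length (filter (d_out d l) zs))" (is "?L \<longleftrightarrow> ?R")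
  proof
    assume ?L
    then obtain x y where "length vs < 2 * x" "length vs \<le> 2 * y" "feasible d c l vs B x y"
      by blast
    then obtain zs where "length vs < 2 * x" "length vs \<le> 2 * y" "map fst zs = vs"
        "\<forall>z\<in>set zs. snd z < length (snd (fst z))" "(\<Sum>z\<leftarrow>zs. snd (fst z) ! snd z) \<le> B"
        "x \<le> length (filter (c_in d c l) zs)" "y \<le> length (filter (d_out d l) zs)"
      unfolding feasible_def by (elim exE conjE)
    then show ?R by (intro exI[of _ zs] conjI) simp_all
  next
    assume ?R
    then obtain zs where zs: "map fst zs = vs" "\<forall>z\<in>set zs. snd z < length (snd (fst z))"
        "(\<Sum>z\<leftarrow>zs. snd (fst z) ! snd z) \<le> B" "length vs < 2 * length (filter (c_in d c l) zs)"
        "length vs \<le> 2 * length (filter (d_out d l) zs)"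
      by blast
    have "length zs = length vs" using zs(1) length_map by metis
    then have "length (filter (c_in d c l) zs) \<le> length vs" "length (filter (d_out d l) zs) \<le> length vs"
      using length_filter_le by metis+
    then show ?L unfolding feasible_def using zs by blast
  qed
  finally show ?thesis .
qed

text \<open>A finite budget excludes infinite summands, so the computation returns to natural
  numbers and every shift is an index into its price list.\<close>

lemma sum_price_le_iff:
  "(\<Sum>z\<leftarrow>zs. price_of (snd (fst z)) (snd z)) \<le> enat b \<longleftrightarrow>
    (\<forall>z\<in>set zs. snd z < length (snd (fst z))) \<and> (\<Sum>z\<leftarrow>zs. snd (fst z) ! snd z) \<le> b"
proof (induction zs arbitrary: b)
  case (Cons z zs)
  show ?case
  proof (cases "snd z < length (snd (fst z))")
    case True
    let ?S = "\<Sum>z\<leftarrow>zs. price_of (snd (fst z)) (snd z)" and ?p = "snd (fst z) ! snd z"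
    have "enat ?p + ?S \<le> enat b \<longleftrightarrow> ?p \<le> b \<and> ?S \<le> enat (b - ?p)"
      by (cases ?S) auto
    then show ?thesis
      using True Cons.IH[of "b - ?p"] by (auto simp: price_of_def)
  qed (simp add: price_of_def)
qed (simp add: zero_enat_def)

lemma solve_correct:
  assumes "valid_code I"
  shows "solve I \<longleftrightarrow> to_instance I \<in> destructive_shift_bribery simplified_bucklin"
proof -
  obtain m d B vs where I: "I = (m, d, B, vs)" by (cases I)
  have d: "d < m" and vs: "\<And>w. w \<in> set vs \<Longrightarrow> valid_voter m d w"
    using assms by (auto simp: I valid_code_def)
  let ?I = "to_instance I"
  let ?us = "\<lambda>zs. map (\<lambda>z :: (nat list \<times> nat list) \<times> nat. shift_back d (snd z) (fst (fst z))) zs"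
  have zip_voters: "zip (voters ?I) ts = map (\<lambda>z. ((fst (fst z), price_of (snd (fst z))), snd z)) (zip vs ts)" for ts
    by (simp add: I to_instance_def zip_map1 case_prod_beta')
  have cost: "bribery_cost ?I ts = (\<Sum>z\<leftarrow>zip vs ts. price_of (snd (fst z)) (snd z))" for ts
    unfolding bribery_cost_def zip_voters by (simp add: o_def)
  have election: "bribed_election ?I ts = ({..<m}, mset (?us (zip vs ts)))" for ts
    unfolding bribed_election_def zip_voters by (simp add: I to_instance_def o_def)
  have "?I \<in> destructive_shift_bribery simplified_bucklin \<longleftrightarrow>
      (\<exists>ts. length ts = length vs \<and> bribery_cost ?I ts \<le> enat B \<and>
         simplified_bucklin (bribed_election ?I ts) \<noteq> {d})"
    using assms by (simp add: destructive_shift_bribery_def valid_code_iff) (simp add: I to_instance_def)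
  also have "\<dots> \<longleftrightarrow> (\<exists>zs. map fst zs = vs \<and> (\<forall>z\<in>set zs. snd z < length (snd (fst z))) \<and>
     (\<Sum>z\<leftarrow>zs. snd (fst z) ! snd z) \<le> B \<and> simplified_bucklin ({..<m}, mset (?us zs)) \<noteq> {d})"
    unfolding cost election sum_price_le_iff
  proof (intro iffI; elim exE conjE)
    fix ts
    assume "length ts = length vs" "\<forall>z\<in>set (zip vs ts). snd z < length (snd (fst z))"
      "(\<Sum>z\<leftarrow>zip vs ts. snd (fst z) ! snd z) \<le> B"
      "simplified_bucklin ({..<m}, mset (?us (zip vs ts))) \<noteq> {d}"
    then show "\<exists>zs. map fst zs = vs \<and> (\<forall>z\<in>set zs. snd z < length (snd (fst z))) \<and>
        (\<Sum>z\<leftarrow>zs. snd (fst z) ! snd z) \<le> B \<and> simplified_bucklin ({..<m}, mset (?us zs)) \<noteq> {d}"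
      by (intro exI[of _ "zip vs ts"] conjI) (rule map_fst_zip, simp, assumption+)
  next
    fix zs
    assume zs: "map fst zs = vs" "\<forall>z\<in>set zs. snd z < length (snd (fst z))"
      "(\<Sum>z\<leftarrow>zs. snd (fst z) ! snd z) \<le> B" "simplified_bucklin ({..<m}, mset (?us zs)) \<noteq> {d}"
    have "zip vs (map snd zs) = zs" "length (map snd zs) = length vs"
      using zs(1) by (auto simp: zip_map_fst_snd)
    then show "\<exists>ts. length ts = length vs \<and> ((\<forall>z\<in>set (zip vs ts). snd z < length (snd (fst z))) \<and>
        (\<Sum>z\<leftarrow>zip vs ts. snd (fst z) ! snd z) \<le> B) \<and> simplified_bucklin ({..<m}, mset (?us (zip vs ts))) \<noteq> {d}"
      using zs(2-) by (intro exI[of _ "map snd zs"] conjI) (simp_all only: not_False_eq_True)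
  qed
  also have "\<dots> \<longleftrightarrow> solve I"
  proof (cases "vs = []")
    case True
    then show ?thesis by (simp add: solve_def I no_voters_no_winner)
  next
    case False
    then have hd: "hd vs \<in> set vs" by simp
    have rank: "ranking {..<m} (fst w)" if "w \<in> set vs" for w
      using vs[OF that] valid_voter_iff[OF d] by blast
    have set_hd: "set (fst (hd vs)) = {..<m}" "length (fst (hd vs)) = m"
      using rank[OF hd] ranking_iff by (auto simp: ranking_def)
    \<comment> \<open>The choice of \<open>c\<close> and \<open>l\<close> will be exchanged with the
      choice of the shifts, so that a cheapest bribery can be sought for each pair
      separately.\<close>
    have winner: "simplified_bucklin ({..<m}, mset (?us zs)) \<noteq> {d} \<longleftrightarrow>
        (\<exists>c<m. c \<noteq> d \<and> (\<exists>l\<in>{1..m}. length vs < 2 * length (filter (c_in d c l) zs) \<and>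
           length vs \<le> 2 * length (filter (d_out d l) zs)))"
      if zs: "map fst zs = vs" "\<forall>z\<in>set zs. snd z < length (snd (fst z))" for zs
    proof -
      have rank': "ranking {..<m} u" if u: "u \<in> set (?us zs)" for u
      proof -
        obtain z where z: "z \<in> set zs" "u = shift_back d (snd z) (fst (fst z))"
          using u unfolding set_map by blast
        have w: "fst z \<in> set vs" using z(1) zs(1) by auto
        note shift = valid_voter_shift[OF vs[OF w] d bspec[OF zs(2) z(1)]]
        show ?thesis
          using set_shift_back[OF shift] distinct_shift_back[OF shift] rank[OF w] z(2)
          by (simp add: ranking_def)
      qed
      have len: "length (?us zs) = length vs" using zs(1) by auto
      have nonempty: "?us zs \<noteq> []" using zs(1) False by auto
      have "length (filter (\<lambda>u. pos u c \<le> l) (?us zs)) = length (filter (c_in d c l) zs)"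
          "length (filter (\<lambda>u. l \<le> pos u d) (?us zs)) = length (filter (d_out d l) zs)" for c l
        by (simp_all add: filter_map o_def c_in_def[abs_def] d_out_def[abs_def])
      then show ?thesis
        using not_unique_winner_iff[OF nonempty rank' d] by (simp only: len)
    qed
    have "solve I \<longleftrightarrow> (\<exists>c<m. c \<noteq> d \<and> (\<exists>l\<in>{1..m}. test B d c l vs))"
    proof -
      have "(\<exists>l\<in>{1..m}. P l) \<longleftrightarrow> (\<exists>l<m. P (l + 1))" for P
      proof
        assume "\<exists>l\<in>{1..m}. P l"
        then obtain l where "1 \<le> l" "l \<le> m" "P l" by auto
        then show "\<exists>l<m. P (l + 1)" by (intro exI[of _ "l - 1"]) auto
      qed auto
      then show ?thesis
        using False by (simp add: solve_def I set_hd Bex_def)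
    qed
    also have "\<dots> \<longleftrightarrow> (\<exists>c<m. c \<noteq> d \<and> (\<exists>l\<in>{1..m}. \<exists>zs. map fst zs = vs \<and>
        (\<forall>z\<in>set zs. snd z < length (snd (fst z))) \<and> (\<Sum>z\<leftarrow>zs. snd (fst z) ! snd z) \<le> B \<and>
        length vs < 2 * length (filter (c_in d c l) zs) \<and> length vs \<le> 2 * length (filter (d_out d l) zs)))"
      using test_iff[OF vs d] by (intro ex_cong1 conj_cong bex_cong refl) auto
    also have "\<dots> \<longleftrightarrow> (\<exists>zs. map fst zs = vs \<and> (\<forall>z\<in>set zs. snd z < length (snd (fst z))) \<and>
       (\<Sum>z\<leftarrow>zs. snd (fst z) ! snd z) \<le> B \<and> simplified_bucklin ({..<m}, mset (?us zs)) \<noteq> {d})"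
      using winner by blast
    finally show ?thesis by simp
  qed
  finally show ?thesis by simp
qed

theorem theorem5:
  shows "encode_instance ` destructive_shift_bribery simplified_bucklin \<in> class_P"
proof -
  \<comment> \<open>The first conjunct leaves only words of the form \<open>encode_code I\<close>.
    On these the parser is exact, so what it returns on other words is irrelevant.\<close>
  let ?f = "\<lambda>x. encode_code (parse_instance x) = x \<and> valid_code (parse_instance x) \<and> solve (parse_instance x)"
  have "encode_instance ` destructive_shift_bribery simplified_bucklin = {x. ?f x}"
  proof (intro equalityI subsetI)
    fix x assume "x \<in> encode_instance ` destructive_shift_bribery simplified_bucklin"
    then obtain I where I: "I \<in> destructive_shift_bribery simplified_bucklin" "x = encode_instance I"
      by blast
    then have "valid_instance I" by (simp add: destructive_shift_bribery_def)
    then have inst: "to_instance (of_instance I) = I" "valid_code (of_instance I)"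
      by (simp_all add: to_of_instance valid_code_iff)
    then have "x = encode_code (of_instance I)"
      using I(2) encode_to_instance[of "of_instance I"] by simp
    then show "x \<in> {x. ?f x}"
      using inst I(1) by (simp add: parse_encode_code solve_correct)
  next
    fix x assume "x \<in> {x. ?f x}"
    then have "x = encode_instance (to_instance (parse_instance x))"
        "to_instance (parse_instance x) \<in> destructive_shift_bribery simplified_bucklin"
      using solve_correct[of "parse_instance x"] by (auto simp: encode_to_instance)
    then show "x \<in> encode_instance ` destructive_shift_bribery simplified_bucklin"
      by blast
  qed
  moreover have "pt ?f"
    by (intro pt_basic pt_comp[OF pt_encode_code] pt_comp[OF pt_valid_code] pt_comp[OF pt_solve]
        pt_parse_instance)
  ultimately show ?thesis
    using pt_class_P by simp
qed

end
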